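(* Let $n\ge 2$, let $\sigma\in\mathcal{B}_n$ with closure the link $\hat\sigma$, let $e(\sigma)$ be the sum of all exponents of the standard generators appearing in $\sigma$, and let $\alpha\in\{1,-1\}$. Then $$T_R(\hat\sigma,\alpha)=(-1)^{n-1+e(\sigma)}\cdot\alpha^{\,n-e(\sigma)}\cdot\sqrt2\cdot J_4(\hat\sigma).$$
   Context: $\mathcal{B}_n$ is Artin's braid group with generators $\sigma_1,\dots,\sigma_{n-1}$ and relations $\sigma_i\sigma_j=\sigma_j\sigma_i$ for $|i-j|\ge 2$ and $\sigma_i\sigma_{i+1}\sigma_i=\sigma_{i+1}\sigma_i\sigma_{i+1}$ for $1\le i\le n-2$. Let $I_m$ be the $m\times m$ identity matrix and $$R=\frac{1}{\sqrt2}\begin{pmatrix}1&0&0&1\\0&1&-1&0\\0&1&1&0\\-1&0&0&1\end{pmatrix},$$ which satisfies the Yang-Baxter equation. The representation $\pi_n$ of $\mathcal{B}_n$ on $(\mathbb{C}^2)^{\otimes n}$ is defined by $\pi_n(\sigma_i)=I_2^{\otimes (i-1)}\otimes R\otimes I_2^{\otimes (n-i-1)}$. Tensor products of matrices use the "left into right" convention: if $A=\begin{pmatrix}a&b\\c&d\end{pmatrix}$ then $X\otimes A=\begin{pmatrix}aX&bX\\ cX&dX\end{pmatrix}$. The link invariant $T_R$ is $$T_R(\hat\sigma,\alpha)=\alpha^{\,n-e(\sigma)}\cdot(\sqrt2)^{-n}\cdot\mathrm{Trace}(\pi_n(\sigma)).$$ Let $q=\sqrt{-1}$. The Temperley-Lieb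 algebra $TL_n(q)$ is the (semisimple) quotient of the group algebra $\mathbb{C}[\mathcal{B}_n]$ by the relations $(\sigma_i+1)(\sigma_i-q)=0$; $\sigma_i\sigma_{i+1}\sigma_i+\sigma_i\sigma_{i+1}+\sigma_{i+1}\sigma_i+\sigma_i+\sigma_{i+1}+1=0$; and $(\sigma_i-\sigma_{i+1})^2=\sqrt{-1}$. The Jones representation $\rho_4$ of $\mathcal{B}_n$ is the representation factoring through $TL_n(\sqrt{-1})$ which is the direct sum of its irreducible representations, one from each isomorphism class: a single irreducible sector if $n$ is odd, and the direct sum of two irreducible sectors if $n$ is even. The Jones polynomial at $\sqrt{-1}$ is given by $$J_4(\hat\sigma)=(-1)^{n-1}\,e^{\pi\sqrt{-1}\,e(\sigma)/4}\cdot(\sqrt2)^{-\frac{1+(-1)^n}{2}}\cdot\mathrm{Trace}(\rho_4(\sigma)).$$ *)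

theory Defs
  imports
    "HOL-Algebra.QuotRing"
    "Jordan_Normal_Form.VS_Connect"
begin

section \<open>Groups given by generators and relations\<close>

text \<open>The letter \<open>(x, True)\<close> stands for the generator \<open>x\<close>, the letter \<open>(x, False)\<close> for its inverse.\<close>

type_synonym 'a gword = "('a \<times> bool) list"

abbreviation gwords :: "'a set \<Rightarrow> 'a gword set" where
  "gwords S \<equiv> lists (S \<times> UNIV)"

inductive pres_eq :: "'a set \<Rightarrow> ('a gword \<times> 'a gword) set \<Rightarrow> 'a gword \<Rightarrow> 'a gword \<Rightarrow> bool"
  for S R where
  refl: "w \<in> gwords S \<Longrightarrow> pres_eq S R w w"
| sym: "pres_eq S R u v \<Longrightarrow> pres_eq S R v u"
| trans: "pres_eq S R u v \<Longrightarrow> pres_eq S R v w \<Longrightarrow> pres_eq S R u w"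
| cancel: "\<lbrakk>u \<in> gwords S; v \<in> gwords S; x \<in> S\<rbrakk>
    \<Longrightarrow> pres_eq S R (u @ [(x, b), (x, \<not> b)] @ v) (u @ v)"
| rel: "\<lbrakk>(r, s) \<in> R; r \<in> gwords S; s \<in> gwords S; u \<in> gwords S; v \<in> gwords S\<rbrakk>
    \<Longrightarrow> pres_eq S R (u @ r @ v) (u @ s @ v)"

definition pres_rel :: "'a set \<Rightarrow> ('a gword \<times> 'a gword) set \<Rightarrow> ('a gword \<times> 'a gword) set" where
  "pres_rel S R = {(u, v). pres_eq S R u v}"

definition presented_group :: "'a set \<Rightarrow> ('a gword \<times> 'a gword) set \<Rightarrow> 'a gword set monoid" where
  "presented_group S R =
    \<lparr>carrier = gwords S // pres_rel S R,
     monoid.mult = (\<lambda>A B. \<Union>u\<in>A. \<Union>v\<in>B. pres_rel S R `` {u @ v}),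
     one = pres_rel S R `` {[]}\<rparr>"

definition pres_gen :: "'a set \<Rightarrow> ('a gword \<times> 'a gword) set \<Rightarrow> 'a \<Rightarrow> 'a gword set" where
  "pres_gen S R x = pres_rel S R `` {[(x, True)]}"

fun word_eval :: "('b, 'c) monoid_scheme \<Rightarrow> ('a \<Rightarrow> 'b) \<Rightarrow> 'a gword \<Rightarrow> 'b" where
  "word_eval G f [] = \<one>\<^bsub>G\<^esub>"
| "word_eval G f ((x, b) # w) = (if b then f x else inv\<^bsub>G\<^esub> f x) \<otimes>\<^bsub>G\<^esub> word_eval G f w"

text \<open>The homomorphism out of a presented group that extends \<open>f\<close>; if \<open>f\<close> respects the
  relations then \<open>word_eval G f\<close> is constant on each class, see \<open>pres_lift_hom\<close> below.\<close>

definition pres_lift :: "('b, 'c) monoid_scheme \<Rightarrow> ('a \<Rightarrow> 'b) \<Rightarrow> 'a gword set \<Rightarrow> 'b" where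
  "pres_lift G f A = the_elem (word_eval G f ` A)"

lemma pres_eq_words: "pres_eq S R u v \<Longrightarrow> u \<in> gwords S \<and> v \<in> gwords S"
  by (induction rule: pres_eq.induct) auto

lemma equiv_pres_rel: "equiv (gwords S) (pres_rel S R)"
proof (rule equivI)
  show "pres_rel S R \<subseteq> gwords S \<times> gwords S"
    unfolding pres_rel_def by (auto dest!: pres_eq_words)
  show "refl_on (gwords S) (pres_rel S R)"
    unfolding pres_rel_def by (rule refl_onI) (simp add: pres_eq.refl)
  show "sym (pres_rel S R)"
    unfolding pres_rel_def by (rule symI) (simp add: pres_eq.sym)
  show "trans (pres_rel S R)"
    unfolding pres_rel_def by (rule transI) (simp, rule pres_eq.trans)
qed

lemma pres_eq_append_left:
  assumes "pres_eq S R u v" "w \<in> gwords S"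
  shows "pres_eq S R (w @ u) (w @ v)"
  using assms
proof (induction rule: pres_eq.induct)
  case (refl u) then show ?case by (intro pres_eq.refl) auto
next
  case (sym u v) then show ?case by (simp add: pres_eq.sym)
next
  case (trans u v x) then show ?case by (meson pres_eq.trans)
next
  case (cancel u v x b)
  then show ?case using pres_eq.cancel[of "w @ u" S v x R b] by auto
next
  case (rel r s u v)
  then show ?case using pres_eq.rel[of r s R S "w @ u" v] by auto
qed

lemma pres_eq_append_right:
  assumes "pres_eq S R u v" "w \<in> gwords S"
  shows "pres_eq S R (u @ w) (v @ w)"
  using assms
proof (induction rule: pres_eq.induct)
  case (refl u) then show ?case by (intro pres_eq.refl) auto
next
  case (sym u v) then show ?case by (simp add: pres_eq.sym)
next
  case (trans u v x) then show ?case by (meson pres_eq.trans)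
next
  case (cancel u v x b)
  then show ?case using pres_eq.cancel[of u S "v @ w" x R b] by auto
next
  case (rel r s u v)
  then show ?case using pres_eq.rel[of r s R S u "v @ w"] by auto
qed

lemma pres_mult_class:
  assumes "u \<in> gwords S" "v \<in> gwords S"
  shows "pres_rel S R `` {u} \<otimes>\<^bsub>presented_group S R\<^esub> pres_rel S R `` {v} = pres_rel S R `` {u @ v}"
proof -
  have *: "pres_rel S R `` {u' @ v'} = pres_rel S R `` {u @ v}"
    if "(u, u') \<in> pres_rel S R" "(v, v') \<in> pres_rel S R" for u' v'
  proof -
    have eq: "pres_eq S R u u'" "pres_eq S R v v'" using that by (simp_all add: pres_rel_def)
    have "pres_eq S R (u @ v) (u' @ v')"
      using pres_eq.trans[OF pres_eq_append_right[OF eq(1) assms(2)]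
          pres_eq_append_left[OF eq(2) conjunct2[OF pres_eq_words[OF eq(1)]]]] .
    then have "(u @ v, u' @ v') \<in> pres_rel S R" by (simp add: pres_rel_def)
    then show ?thesis by (rule equiv_class_eq[OF equiv_pres_rel, symmetric])
  qed
  have "u \<in> pres_rel S R `` {u}" "v \<in> pres_rel S R `` {v}"
    by (rule equiv_class_self[OF equiv_pres_rel assms(1)])
      (rule equiv_class_self[OF equiv_pres_rel assms(2)])
  then have "(\<Union>u'\<in>pres_rel S R `` {u}. \<Union>v'\<in>pres_rel S R `` {v}. pres_rel S R `` {u' @ v'})
      = pres_rel S R `` {u @ v}"
    using * by blast
  then show ?thesis by (simp add: presented_group_def)
qed

lemma presented_group_carrierE:
  assumes "A \<in> carrier (presented_group S R)"
  obtains w where "w \<in> gwords S" "A = pres_rel S R `` {w}"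
  using assms by (auto simp: presented_group_def quotient_def)

lemma pres_class_closed [simp]:
  "w \<in> gwords S \<Longrightarrow> pres_rel S R `` {w} \<in> carrier (presented_group S R)"
  by (auto simp: presented_group_def quotient_def)

lemma pres_one: "\<one>\<^bsub>presented_group S R\<^esub> = pres_rel S R `` {[]}"
  by (simp add: presented_group_def)

lemma gwords_inverse: "w \<in> gwords S \<Longrightarrow> rev (map (\<lambda>(x, b). (x, \<not> b)) w) \<in> gwords S"
  by (induction w) auto

lemma pres_left_inverse:
  assumes "w \<in> gwords S"
  shows "pres_eq S R (rev (map (\<lambda>(x, b). (x, \<not> b)) w) @ w) []"
  using assms
proof (induction w rule: list.induct)
  case Nil then show ?case by (auto intro: pres_eq.refl)
next
  case (Cons a w)
  obtain x b where a: "a = (x, b)" by force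
  let ?i = "rev (map (\<lambda>(x, b). (x, \<not> b)) w)"
  have "w \<in> gwords S" using Cons.prems by simp
  then have "?i \<in> gwords S" by (rule gwords_inverse)
  then have "pres_eq S R (?i @ [(x, \<not> b), (x, \<not> \<not> b)] @ w) (?i @ w)"
    using Cons.prems a by (intro pres_eq.cancel) auto
  then show ?case using pres_eq.trans[OF _ Cons.IH[OF \<open>w \<in> gwords S\<close>]] a by simp
qed

lemma group_presented_group: "group (presented_group S R)"
proof (rule groupI)
  fix A B assume "A \<in> carrier (presented_group S R)" "B \<in> carrier (presented_group S R)"
  then show "A \<otimes>\<^bsub>presented_group S R\<^esub> B \<in> carrier (presented_group S R)"
    by (elim presented_group_carrierE) (simp add: pres_mult_class)
next
  show "\<one>\<^bsub>presented_group S R\<^esub> \<in> carrier (presented_group S R)"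
    by (simp add: pres_one)
next
  fix A B C
  assume "A \<in> carrier (presented_group S R)" "B \<in> carrier (presented_group S R)"
    "C \<in> carrier (presented_group S R)"
  then show "A \<otimes>\<^bsub>presented_group S R\<^esub> B \<otimes>\<^bsub>presented_group S R\<^esub> C
      = A \<otimes>\<^bsub>presented_group S R\<^esub> (B \<otimes>\<^bsub>presented_group S R\<^esub> C)"
    by (elim presented_group_carrierE) (simp add: pres_mult_class)
next
  fix A assume "A \<in> carrier (presented_group S R)"
  then show "\<one>\<^bsub>presented_group S R\<^esub> \<otimes>\<^bsub>presented_group S R\<^esub> A = A"
    by (elim presented_group_carrierE) (simp add: pres_mult_class pres_one)
next
  fix A assume "A \<in> carrier (presented_group S R)"
  then obtain w where w: "w \<in> gwords S" "A = pres_rel S R `` {w}"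
    by (rule presented_group_carrierE)
  let ?i = "rev (map (\<lambda>(x, b). (x, \<not> b)) w)"
  have i: "?i \<in> gwords S" using w(1) by (rule gwords_inverse)
  have "pres_rel S R `` {?i @ w} = pres_rel S R `` {[]}"
    using pres_left_inverse[OF w(1), of R]
    by (intro equiv_class_eq[OF equiv_pres_rel]) (simp add: pres_rel_def)
  then have "pres_rel S R `` {?i} \<otimes>\<^bsub>presented_group S R\<^esub> A = \<one>\<^bsub>presented_group S R\<^esub>"
    using w pres_mult_class[OF i w(1), of R] by (simp add: pres_one)
  then show "\<exists>B\<in>carrier (presented_group S R).
      B \<otimes>\<^bsub>presented_group S R\<^esub> A = \<one>\<^bsub>presented_group S R\<^esub>"
    using i pres_class_closed by blast
qed

context group
begin

lemma word_eval_closed: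
  assumes "f \<in> S \<rightarrow> carrier G" "w \<in> gwords S"
  shows "word_eval G f w \<in> carrier G"
  using assms(2)
proof (induction w rule: list.induct)
  case (Cons a w)
  obtain x b where a: "a = (x, b)" by force
  have "x \<in> S" and w: "w \<in> gwords S" using Cons.prems unfolding a by simp_all
  then have "f x \<in> carrier G" using assms(1) by blast
  then show ?case using Cons.IH[OF w] a by simp
qed simp

lemma word_eval_append:
  assumes "f \<in> S \<rightarrow> carrier G" "u \<in> gwords S" "v \<in> gwords S"
  shows "word_eval G f (u @ v) = word_eval G f u \<otimes> word_eval G f v"
  using assms(2)
proof (induction u rule: list.induct)
  case Nil
  then show ?case using word_eval_closed[OF assms(1,3)] by simp
next
  case (Cons a u)
  obtain x b where a: "a = (x, b)" by force
  have "x \<in> S" and u: "u \<in> gwords S" using Cons.prems unfolding a by simp_all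
  then have "f x \<in> carrier G" using assms(1) by blast
  then show ?case
    using Cons.IH[OF u] a word_eval_closed[OF assms(1,3)] word_eval_closed[OF assms(1) u]
    by (simp add: m_assoc)
qed

lemma word_eval_pres_eq:
  assumes f: "f \<in> S \<rightarrow> carrier G"
    and R: "\<And>r s. (r, s) \<in> R \<Longrightarrow> word_eval G f r = word_eval G f s"
    and "pres_eq S R u v"
  shows "word_eval G f u = word_eval G f v"
  using assms(3)
proof (induction rule: pres_eq.induct)
  case (cancel u v x b)
  have x: "f x \<in> carrier G" using f cancel by auto
  have c: "[(x, b), (x, \<not> b)] \<in> gwords S" using cancel by auto
  have 1: "word_eval G f [(x, b), (x, \<not> b)] = \<one>" using x by auto
  have cv: "[(x, b), (x, \<not> b)] @ v \<in> gwords S" using c cancel by auto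
  have "word_eval G f (u @ [(x, b), (x, \<not> b)] @ v)
      = word_eval G f u \<otimes> (\<one> \<otimes> word_eval G f v)"
    by (simp only: word_eval_append[OF f cancel(1) cv] word_eval_append[OF f c cancel(2)] 1)
  then show ?case
    by (simp only: word_eval_append[OF f cancel(1,2)] l_one[OF word_eval_closed[OF f cancel(2)]])
next
  case (rel r s u v)
  then have rv: "r @ v \<in> gwords S" "s @ v \<in> gwords S" by auto
  show ?case
    by (simp only: word_eval_append[OF f rel(4) rv(1)] word_eval_append[OF f rel(4) rv(2)]
      word_eval_append[OF f rel(2,5)] word_eval_append[OF f rel(3,5)] R[OF rel(1)])
qed auto

lemma pres_lift_class:
  assumes "f \<in> S \<rightarrow> carrier G"
    and "\<And>r s. (r, s) \<in> R \<Longrightarrow> word_eval G f r = word_eval G f s"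
    and "w \<in> gwords S"
  shows "pres_lift G f (pres_rel S R `` {w}) = word_eval G f w"
proof -
  have "word_eval G f v = word_eval G f w" if "v \<in> pres_rel S R `` {w}" for v
    using word_eval_pres_eq[OF assms(1,2), of R w v] that by (simp add: pres_rel_def)
  moreover have "w \<in> pres_rel S R `` {w}"
    using pres_eq.refl[OF assms(3), of R] by (simp add: pres_rel_def)
  ultimately have "word_eval G f ` (pres_rel S R `` {w}) = {word_eval G f w}"
    by blast
  then show ?thesis by (simp add: pres_lift_def)
qed

lemma pres_lift_hom:
  assumes "f \<in> S \<rightarrow> carrier G"
    and "\<And>r s. (r, s) \<in> R \<Longrightarrow> word_eval G f r = word_eval G f s"
  shows "pres_lift G f \<in> hom (presented_group S R) G"
    and "x \<in> S \<Longrightarrow> pres_lift G f (pres_gen S R x) = f x"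
proof -
  show "pres_lift G f \<in> hom (presented_group S R) G"
  proof (rule homI)
    fix A assume "A \<in> carrier (presented_group S R)"
    then show "pres_lift G f A \<in> carrier G"
      by (elim presented_group_carrierE)
        (simp add: pres_lift_class[OF assms] word_eval_closed[OF assms(1)])
  next
    fix A B assume "A \<in> carrier (presented_group S R)" "B \<in> carrier (presented_group S R)"
    then show "pres_lift G f (A \<otimes>\<^bsub>presented_group S R\<^esub> B) = pres_lift G f A \<otimes> pres_lift G f B"
      by (elim presented_group_carrierE)
        (simp add: pres_mult_class pres_lift_class[OF assms] word_eval_append[OF assms(1)])
  qed
  show "pres_lift G f (pres_gen S R x) = f x" if "x \<in> S"
  proof -
    have "f x \<in> carrier G" using assms(1) that by blast
    then show ?thesis
      using that pres_lift_class[OF assms, where R = R and w = "[(x, True)]"]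
      by (simp add: pres_gen_def)
  qed
qed

end


section \<open>The braid group\<close>

definition braid_relations :: "nat \<Rightarrow> (nat gword \<times> nat gword) set" where
  "braid_relations n =
    {([(i, True), (j, True)], [(j, True), (i, True)]) | i j.
        i \<in> {1..<n} \<and> j \<in> {1..<n} \<and> \<bar>int i - int j\<bar> \<ge> 2}
    \<union> {([(i, True), (i + 1, True), (i, True)], [(i + 1, True), (i, True), (i + 1, True)]) | i.
        1 \<le> i \<and> i + 1 < n}"

definition braid_group :: "nat \<Rightarrow> nat gword set monoid" where
  "braid_group n = presented_group {1..<n} (braid_relations n)"

definition braid_gen :: "nat \<Rightarrow> nat \<Rightarrow> nat gword set" where
  "braid_gen n i = pres_gen {1..<n} (braid_relations n) i"

definition word_exponent_sum :: "'a gword \<Rightarrow> int" where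
  "word_exponent_sum w = (\<Sum>(x, b)\<leftarrow>w. if b then 1 else - 1)"

definition exponent_sum :: "nat gword set \<Rightarrow> int" where
  "exponent_sum \<sigma> = the_elem (word_exponent_sum ` \<sigma>)"

lemma exponent_sum_class:
  assumes "w \<in> gwords {1..<n}"
  shows "exponent_sum (pres_rel {1..<n} (braid_relations n) `` {w}) = word_exponent_sum w"
proof -
  have *: "word_exponent_sum u = word_exponent_sum v"
    if "pres_eq {1..<n} (braid_relations n) u v" for u v
    using that
    by (induction rule: pres_eq.induct) (auto simp: word_exponent_sum_def braid_relations_def)
  have "word_exponent_sum v = word_exponent_sum w"
    if "v \<in> pres_rel {1..<n} (braid_relations n) `` {w}" for v
    using *[of w v] that by (simp add: pres_rel_def)
  moreover have "w \<in> pres_rel {1..<n} (braid_relations n) `` {w}"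
    using pres_eq.refl[OF assms, of "braid_relations n"] by (simp add: pres_rel_def)
  ultimately have "word_exponent_sum ` (pres_rel {1..<n} (braid_relations n) `` {w}) = {word_exponent_sum w}"
    by blast
  then show ?thesis by (simp add: exponent_sum_def)
qed


section \<open>The representations from the Yang-Baxter operator\<close>

definition mat_trace :: "'a :: comm_monoid_add mat \<Rightarrow> 'a" where
  "mat_trace A = (\<Sum>i<dim_row A. A $$ (i, i))"

text \<open>Convention ``left into right'': block \<open>(k, l)\<close> of the tensor product of \<open>X\<close> with \<open>A\<close>
  is the \<open>(k, l)\<close> entry of \<open>A\<close> times \<open>X\<close>.\<close>

definition tensor_mat :: "'a :: semiring_1 mat \<Rightarrow> 'a mat \<Rightarrow> 'a mat" where
  "tensor_mat X A = mat (dim_row A * dim_row X) (dim_col A * dim_col X)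
    (\<lambda>(i, j). A $$ (i div dim_row X, j div dim_col X) * X $$ (i mod dim_row X, j mod dim_col X))"

fun tensor_pow :: "'a :: semiring_1 mat \<Rightarrow> nat \<Rightarrow> 'a mat" where
  "tensor_pow A 0 = 1\<^sub>m 1"
| "tensor_pow A (Suc k) = tensor_mat (tensor_pow A k) A"

definition R_mat :: "complex mat" where
  "R_mat = complex_of_real (1 / sqrt 2) \<cdot>\<^sub>m mat_of_rows_list 4
    [[ 1, 0,  0, 1],
     [ 0, 1, -1, 0],
     [ 0, 1,  1, 0],
     [-1, 0,  0, 1]]"

definition GL :: "nat \<Rightarrow> complex mat monoid" where
  "GL d = units_of (ring_mat TYPE(complex) d ())"

definition YB_gen :: "nat \<Rightarrow> nat \<Rightarrow> complex mat" where
  "YB_gen n i = tensor_mat (tensor_mat (tensor_pow (1\<^sub>m 2) (i - 1)) R_mat) (tensor_pow (1\<^sub>m 2) (n - i - 1))"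

definition YB_rep :: "nat \<Rightarrow> nat gword set \<Rightarrow> complex mat" where
  "YB_rep n = pres_lift (GL (2 ^ n)) (YB_gen n)"

definition T_R :: "nat \<Rightarrow> nat gword set \<Rightarrow> complex \<Rightarrow> complex" where
  "T_R n \<sigma> \<alpha> = \<alpha> powi (int n - exponent_sum \<sigma>) * complex_of_real (sqrt 2) powi (- int n)
    * mat_trace (YB_rep n \<sigma>)"


section \<open>Group algebras\<close>

definition group_algebra :: "('g, 'm) monoid_scheme \<Rightarrow> (complex, 'g \<Rightarrow> complex) module" where
  "group_algebra G =
    \<lparr>carrier = {f. finite {x. f x \<noteq> 0} \<and> {x. f x \<noteq> 0} \<subseteq> carrier G},
     monoid.mult = (\<lambda>f g x. \<Sum>y | f y \<noteq> 0. \<Sum>z | g z \<noteq> 0 \<and> y \<otimes>\<^bsub>G\<^esub> z = x. f y * g z),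
     one = (\<lambda>x. if x = \<one>\<^bsub>G\<^esub> then 1 else 0),
     zero = (\<lambda>x. 0),
     add = (\<lambda>f g x. f x + g x),
     smult = (\<lambda>c f x. c * f x)\<rparr>"

definition ga_of :: "'g \<Rightarrow> 'g \<Rightarrow> complex" where
  "ga_of g = (\<lambda>x. if x = g then 1 else 0)"


section \<open>The Temperley-Lieb algebra at \<open>q = \<i>\<close>\<close>

abbreviation braid_algebra :: "nat \<Rightarrow> (complex, nat gword set \<Rightarrow> complex) module" where
  "braid_algebra n \<equiv> group_algebra (braid_group n)"

definition TL_relators :: "nat \<Rightarrow> (nat gword set \<Rightarrow> complex) set" where
  "TL_relators n =
    (let A = braid_algebra n; s = (\<lambda>i. ga_of (braid_gen n i)) in
      {(s i \<oplus>\<^bsub>A\<^esub> \<one>\<^bsub>A\<^esub>) \<otimes>\<^bsub>A\<^esub> (s i \<ominus>\<^bsub>A\<^esub> \<i> \<odot>\<^bsub>A\<^esub> \<one>\<^bsub>A\<^esub>) | i. 1 \<le> i \<and> i < n}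
      \<union> {s i \<otimes>\<^bsub>A\<^esub> s (i + 1) \<otimes>\<^bsub>A\<^esub> s i \<oplus>\<^bsub>A\<^esub> s i \<otimes>\<^bsub>A\<^esub> s (i + 1) \<oplus>\<^bsub>A\<^esub> s (i + 1) \<otimes>\<^bsub>A\<^esub> s i
            \<oplus>\<^bsub>A\<^esub> s i \<oplus>\<^bsub>A\<^esub> s (i + 1) \<oplus>\<^bsub>A\<^esub> \<one>\<^bsub>A\<^esub> | i. 1 \<le> i \<and> i + 1 < n}
      \<union> {(s i \<ominus>\<^bsub>A\<^esub> s (i + 1)) [^]\<^bsub>A\<^esub> (2 :: nat) \<ominus>\<^bsub>A\<^esub> \<i> \<odot>\<^bsub>A\<^esub> \<one>\<^bsub>A\<^esub> | i. 1 \<le> i \<and> i + 1 < n})"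

definition TL_ideal :: "nat \<Rightarrow> (nat gword set \<Rightarrow> complex) set" where
  "TL_ideal n = Idl\<^bsub>braid_algebra n\<^esub> (TL_relators n)"

definition TL :: "nat \<Rightarrow> (nat gword set \<Rightarrow> complex) set ring" where
  "TL n = braid_algebra n Quot TL_ideal n"

definition TL_proj :: "nat \<Rightarrow> (nat gword set \<Rightarrow> complex) \<Rightarrow> (nat gword set \<Rightarrow> complex) set" where
  "TL_proj n x = TL_ideal n +>\<^bsub>braid_algebra n\<^esub> x"

text \<open>Matrix representations of the algebra: unital ring homomorphisms that are linear over the
  complex numbers. The quotient record of the library does not carry scalars, so linearity is
  expressed through the projection from the group algebra.\<close>

definition TL_rep :: "nat \<Rightarrow> nat \<Rightarrow> ((nat gword set \<Rightarrow> complex) set \<Rightarrow> complex mat) \<Rightarrow> bool" where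
  "TL_rep n d \<phi> \<longleftrightarrow>
    \<phi> \<in> Ring.ring_hom (TL n) (ring_mat TYPE(complex) d ()) \<and>
    (\<forall>c. \<forall>x \<in> carrier (braid_algebra n).
      \<phi> (TL_proj n (c \<odot>\<^bsub>braid_algebra n\<^esub> x)) = c \<cdot>\<^sub>m \<phi> (TL_proj n x))"

definition TL_irrep :: "nat \<Rightarrow> nat \<Rightarrow> ((nat gword set \<Rightarrow> complex) set \<Rightarrow> complex mat) \<Rightarrow> bool" where
  "TL_irrep n d \<phi> \<longleftrightarrow> TL_rep n d \<phi> \<and> d > 0 \<and>
    (\<forall>W. VectorSpace.subspace class_ring W (module_vec TYPE(complex) d) \<and>
        (\<forall>x \<in> carrier (TL n). \<forall>w \<in> W. \<phi> x *\<^sub>v w \<in> W)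
      \<longrightarrow> W = {0\<^sub>v d} \<or> W = carrier_vec d)"

definition TL_rep_iso :: "nat \<Rightarrow> nat \<Rightarrow> ((nat gword set \<Rightarrow> complex) set \<Rightarrow> complex mat)
    \<Rightarrow> nat \<Rightarrow> ((nat gword set \<Rightarrow> complex) set \<Rightarrow> complex mat) \<Rightarrow> bool" where
  "TL_rep_iso n d \<phi> d' \<phi>' \<longleftrightarrow> d = d' \<and>
    (\<exists>P \<in> carrier_mat d d. invertible_mat P \<and> (\<forall>x \<in> carrier (TL n). P * \<phi> x = \<phi>' x * P))"

text \<open>A complete list of irreducible representations, one from each isomorphism class.\<close>

definition TL_irrep_list :: "nat \<Rightarrow> (nat \<times> ((nat gword set \<Rightarrow> complex) set \<Rightarrow> complex mat)) list \<Rightarrow> bool" where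
  "TL_irrep_list n L \<longleftrightarrow>
    (\<forall>(d, \<phi>) \<in> set L. TL_irrep n d \<phi>) \<and>
    (\<forall>k < length L. \<forall>l < length L. k \<noteq> l \<longrightarrow>
      \<not> TL_rep_iso n (fst (L ! k)) (snd (L ! k)) (fst (L ! l)) (snd (L ! l))) \<and>
    (\<forall>d \<phi>. TL_irrep n d \<phi> \<longrightarrow> (\<exists>(d', \<phi>') \<in> set L. TL_rep_iso n d \<phi> d' \<phi>'))"


section \<open>The Jones representation and the Jones polynomial at \<open>\<i>\<close>\<close>

definition is_jones_rep :: "nat \<Rightarrow> (nat gword set \<Rightarrow> complex mat) \<Rightarrow> bool" where
  "is_jones_rep n \<rho> \<longleftrightarrow> (\<exists>L. TL_irrep_list n L \<and>
    \<rho> = (\<lambda>\<sigma>. diag_block_mat (map (\<lambda>(d, \<phi>). \<phi> (TL_proj n (ga_of \<sigma>))) L)))"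

text \<open>The Jones representation is determined only up to isomorphism; since the choice is
  arbitrary, any fact about it has to hold for every representative.\<close>

definition jones_rep :: "nat \<Rightarrow> nat gword set \<Rightarrow> complex mat" where
  "jones_rep n = (SOME \<rho>. is_jones_rep n \<rho>)"

definition J4 :: "nat \<Rightarrow> nat gword set \<Rightarrow> complex" where
  "J4 n \<sigma> = (- 1) ^ (n - 1) * exp (complex_of_real pi * \<i> * of_int (exponent_sum \<sigma>) / 4)
    * complex_of_real (sqrt 2 powr (- ((1 + (- 1) ^ n) / 2)))
    * mat_trace (jones_rep n \<sigma>)"

end

theory Submission
  imports Defs
begin

text \<open>With \<open>c = (\<i> - 1) / 2\<close>, elements \<open>c (1 + M\<^sub>i)\<close> satisfy the relators of \<open>TL\<^sub>n(\<i>)\<close> exactly when the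
  \<open>M\<^sub>i\<close> square to \<open>-1\<close> and anticommute for adjacent indices; far commutation is a braid relation. The matrices
  \<open>\<pi>\<^sub>n(\<sigma>\<^sub>i) = (1 + M\<^sub>i) / \<surd>2\<close> are of the same shape, so both sides of the identity expand into traces of words
  in the \<open>M\<^sub>i\<close>, up to a power of the eighth root of unity \<open>c \<surd>2\<close>. The relations reduce
  every word to a multiple of a strictly increasing one. On a nonempty increasing word the trace of the
  Yang-Baxter side vanishes. On the Jones side some generator anticommutes with the word, which kills the
  trace, unless \<open>n\<close> is even and the word is the central one, \<open>M\<^sub>1 M\<^sub>3 \<dots>\<close>; that one acts by opposite
  scalars on the two irreducible sectors. So only the dimensions have to be compared.
  Averaging over the finite group generated by the \<open>M\<^sub>i\<close> and the Schur lemma show that there are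
  no other irreducible representations.\<close>

subsection \<open>The group algebra\<close>

text \<open>A matrix with square -1 has eigenvalues among \<i> and -\<i>, and c (1 + \<i>) = -1, c
  (1 - \<i>) = \<i> are the two roots of the quadratic relation; this fixes c = (\<i> - 1) / 2. The
  eighth root of unity is c sqrt 2 = - exp (- pi \<i> / 4): its power e(\<sigma>) gives the sign
  (-1)^e and undoes the exponential in the Jones polynomial. The obstacle is that
  \<open>jones_rep\<close> is an arbitrary choice. Nothing can be said about it unless a complete
  list of irreducible representations exists, and the trace must come out the same for every such
  list. So the irreducible representations of the quotient have to be constructed and classified.
  The Temperley-Lieb algebra is available only as a quotient by a generated ideal; irreducibility
  and isomorphism are therefore translated into conditions on the matrices M_i alone. The dimensions
  of the sectors add up to 2^(n div 2), against 2^n on the Yang-Baxter side. The quotient 2^((n + 1)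
  div 2), set against the normalisations by powers of sqrt 2, leaves the single factor sqrt
  2.\<close>

definition ga_eval :: "('g \<Rightarrow> complex) \<Rightarrow> ('g \<Rightarrow> complex) \<Rightarrow> complex" where
  "ga_eval h f = (\<Sum>x | f x \<noteq> 0. f x * h x)"

lemma ga_eval_superset:
  assumes "finite T" "{x. f x \<noteq> 0} \<subseteq> T"
  shows "ga_eval h f = (\<Sum>x\<in>T. f x * h x)"
  unfolding ga_eval_def using assms by (intro sum.mono_neutral_left) auto

lemma ga_eval_cong: "(\<And>x. f x \<noteq> 0 \<Longrightarrow> h x = h' x) \<Longrightarrow> ga_eval h f = ga_eval h' f"
  unfolding ga_eval_def by (intro sum.cong) auto

lemma ga_eval_delta:
  "finite {x. f x \<noteq> 0} \<Longrightarrow> ga_eval (\<lambda>y. if y = x then 1 else 0) f = f x"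
  unfolding ga_eval_def by (simp add: if_distrib cong: if_cong)

lemma ga_eval_add_left: "ga_eval (\<lambda>x. h x + k x) f = ga_eval h f + ga_eval k f"
  unfolding ga_eval_def by (simp add: sum.distrib algebra_simps)

lemma ga_eval_mult_left: "ga_eval (\<lambda>x. c * h x) f = c * ga_eval h f"
  unfolding ga_eval_def by (simp add: sum_distrib_left algebra_simps)

lemma ga_eval_sum_left: "ga_eval (\<lambda>x. \<Sum>i\<in>I. h i x) f = (\<Sum>i\<in>I. ga_eval (h i) f)"
  unfolding ga_eval_def by (subst sum.swap) (simp add: sum_distrib_left)

lemma ga_eval_scale: "ga_eval h (\<lambda>x. c * f x) = c * ga_eval h f"
  by (cases "c = 0") (simp_all add: ga_eval_def sum_distrib_left mult.assoc)

lemma ga_eval_add: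
  assumes "finite {x. f x \<noteq> 0}" "finite {x. g x \<noteq> 0}"
  shows "ga_eval h (\<lambda>x. f x + g x) = ga_eval h f + ga_eval h g"
proof -
  let ?T = "{x. f x \<noteq> 0} \<union> {x. g x \<noteq> 0}"
  have T: "finite ?T" using assms by simp
  have "{x. f x + g x \<noteq> 0} \<subseteq> ?T" by auto
  then show ?thesis
    by (simp only: ga_eval_superset[OF T Un_upper1] ga_eval_superset[OF T Un_upper2]
        ga_eval_superset[OF T] sum.distrib distrib_right)
qed

lemma ga_eval_ga_of [simp]: "ga_eval h (ga_of g) = h g"
  by (simp add: ga_eval_def ga_of_def)

lemma ga_carrier_iff:
  "f \<in> carrier (group_algebra G) \<longleftrightarrow> finite {x. f x \<noteq> 0} \<and> {x. f x \<noteq> 0} \<subseteq> carrier G"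
  by (simp add: group_algebra_def)

lemma ga_add: "f \<oplus>\<^bsub>group_algebra G\<^esub> g = (\<lambda>x. f x + g x)"
  and ga_smult: "c \<odot>\<^bsub>group_algebra G\<^esub> f = (\<lambda>x. c * f x)"
  and ga_zero: "\<zero>\<^bsub>group_algebra G\<^esub> = (\<lambda>x. 0)"
  and ga_one: "\<one>\<^bsub>group_algebra G\<^esub> = ga_of \<one>\<^bsub>G\<^esub>"
  by (simp_all add: group_algebra_def ga_of_def)

lemma ga_of_closed: "g \<in> carrier G \<Longrightarrow> ga_of g \<in> carrier (group_algebra G)"
  by (simp add: ga_carrier_iff ga_of_def)

lemma ga_add_closed:
  assumes "f \<in> carrier (group_algebra G)" "g \<in> carrier (group_algebra G)"
  shows "f \<oplus>\<^bsub>group_algebra G\<^esub> g \<in> carrier (group_algebra G)"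
proof -
  have "{x. f x + g x \<noteq> 0} \<subseteq> {x. f x \<noteq> 0} \<union> {x. g x \<noteq> 0}" by auto
  then show ?thesis
    using assms unfolding ga_carrier_iff ga_add by (meson finite_UnI finite_subset le_sup_iff order_trans)
qed

lemma ga_smult_closed:
  assumes "f \<in> carrier (group_algebra G)"
  shows "c \<odot>\<^bsub>group_algebra G\<^esub> f \<in> carrier (group_algebra G)"
  using assms unfolding ga_carrier_iff ga_smult by (cases "c = 0") auto

lemma ga_eval_oplus:
  assumes "f \<in> carrier (group_algebra G)" "g \<in> carrier (group_algebra G)"
  shows "ga_eval h (f \<oplus>\<^bsub>group_algebra G\<^esub> g) = ga_eval h f + ga_eval h g"
  using assms by (simp add: ga_carrier_iff ga_add ga_eval_add)

lemma ga_eval_smult: "ga_eval h (c \<odot>\<^bsub>group_algebra G\<^esub> f) = c * ga_eval h f"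
  by (simp add: ga_smult ga_eval_scale)

text \<open>Evaluation at the indicator of a point returns a coefficient, so the linear functionals
  \<open>ga_eval h\<close> separate elements. The laws of the convolution product are checked
  through them, which avoids reassociating convolution sums.\<close>

lemma ga_eqI:
  assumes "f \<in> carrier (group_algebra G)" "g \<in> carrier (group_algebra G)"
    and "\<And>h. ga_eval h f = ga_eval h g"
  shows "f = g"
proof
  fix x show "f x = g x"
    using assms(3)[of "\<lambda>y. if y = x then 1 else 0"] assms(1,2)
    by (simp add: ga_eval_delta ga_carrier_iff)
qed

lemma ga_mult_apply:
  assumes "finite {x. f x \<noteq> 0}" "finite {x. g x \<noteq> 0}"
  shows "(f \<otimes>\<^bsub>group_algebra G\<^esub> g) x
    = (\<Sum>y | f y \<noteq> 0. \<Sum>z | g z \<noteq> 0. if y \<otimes>\<^bsub>G\<^esub> z = x then f y * g z else 0)"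
proof -
  have "(\<Sum>z | g z \<noteq> 0 \<and> y \<otimes>\<^bsub>G\<^esub> z = x. f y * g z)
      = (\<Sum>z | g z \<noteq> 0. if y \<otimes>\<^bsub>G\<^esub> z = x then f y * g z else 0)" for y
    using assms(2) by (intro sum.mono_neutral_cong_left) auto
  then show ?thesis by (simp add: group_algebra_def)
qed

lemma ga_mult_support:
  assumes "finite {x. f x \<noteq> 0}" "finite {x. g x \<noteq> 0}"
  shows "{x. (f \<otimes>\<^bsub>group_algebra G\<^esub> g) x \<noteq> 0}
    \<subseteq> (\<lambda>(y, z). y \<otimes>\<^bsub>G\<^esub> z) ` ({x. f x \<noteq> 0} \<times> {x. g x \<noteq> 0})"
proof
  fix x assume "x \<in> {x. (f \<otimes>\<^bsub>group_algebra G\<^esub> g) x \<noteq> 0}"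
  then obtain y where y: "f y \<noteq> 0"
      "(\<Sum>z | g z \<noteq> 0. if y \<otimes>\<^bsub>G\<^esub> z = x then f y * g z else 0) \<noteq> 0"
    unfolding ga_mult_apply[OF assms] mem_Collect_eq
    by (rule sum.not_neutral_contains_not_neutral) simp
  from y(2) obtain z where "g z \<noteq> 0" "y \<otimes>\<^bsub>G\<^esub> z = x"
    by (rule sum.not_neutral_contains_not_neutral) (simp split: if_splits)
  then show "x \<in> (\<lambda>(y, z). y \<otimes>\<^bsub>G\<^esub> z) ` ({x. f x \<noteq> 0} \<times> {x. g x \<noteq> 0})"
    using y by force
qed

text \<open>Fubini for the convolution: pairs \<open>(y, z)\<close> are grouped by their product.
  The outer sum runs over all products of support elements, a finite set that may exceed the support
  of the convolution because of cancellation.\<close>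

lemma ga_eval_mult:
  assumes "finite {x. f x \<noteq> 0}" "finite {x. g x \<noteq> 0}"
  shows "ga_eval h (f \<otimes>\<^bsub>group_algebra G\<^esub> g) = ga_eval (\<lambda>y. ga_eval (\<lambda>z. h (y \<otimes>\<^bsub>G\<^esub> z)) g) f"
proof -
  let ?F = "{x. f x \<noteq> 0}" and ?K = "{x. g x \<noteq> 0}"
  let ?T = "(\<lambda>(y, z). y \<otimes>\<^bsub>G\<^esub> z) ` (?F \<times> ?K)"
  have T: "finite ?T" using assms by simp
  have "ga_eval h (f \<otimes>\<^bsub>group_algebra G\<^esub> g)
      = (\<Sum>x\<in>?T. \<Sum>y\<in>?F. \<Sum>z\<in>?K. if y \<otimes>\<^bsub>G\<^esub> z = x then f y * g z * h x else 0)"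
    by (subst ga_eval_superset[OF T ga_mult_support[OF assms]])
      (auto simp: ga_mult_apply[OF assms] sum_distrib_right if_distrib[of "\<lambda>u. u * _"] cong: if_cong)
  also have "\<dots> = (\<Sum>y\<in>?F. \<Sum>z\<in>?K. \<Sum>x\<in>?T. if y \<otimes>\<^bsub>G\<^esub> z = x then f y * g z * h x else 0)"
    by (subst sum.swap, rule sum.cong[OF HOL.refl], rule sum.swap)
  also have "\<dots> = (\<Sum>y\<in>?F. \<Sum>z\<in>?K. f y * g z * h (y \<otimes>\<^bsub>G\<^esub> z))"
  proof (intro sum.cong HOL.refl)
    fix y z assume "y \<in> ?F" "z \<in> ?K"
    then have "y \<otimes>\<^bsub>G\<^esub> z \<in> ?T" by force
    then show "(\<Sum>x\<in>?T. if y \<otimes>\<^bsub>G\<^esub> z = x then f y * g z * h x else 0) = f y * g z * h (y \<otimes>\<^bsub>G\<^esub> z)"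
      using T by (simp add: sum.delta')
  qed
  finally show ?thesis by (simp add: ga_eval_def sum_distrib_left mult.assoc)
qed

section \<open>The ring structure of the group algebra\<close>

lemma (in monoid) ga_mult_closed:
  assumes "f \<in> carrier (group_algebra G)" "g \<in> carrier (group_algebra G)"
  shows "f \<otimes>\<^bsub>group_algebra G\<^esub> g \<in> carrier (group_algebra G)"
proof -
  have fin: "finite {x. f x \<noteq> 0}" "finite {x. g x \<noteq> 0}" using assms by (auto simp: ga_carrier_iff)
  have "(\<lambda>(y, z). y \<otimes> z) ` ({x. f x \<noteq> 0} \<times> {x. g x \<noteq> 0}) \<subseteq> carrier G"
    using assms by (auto simp: ga_carrier_iff)
  then show ?thesis
    using ga_mult_support[OF fin, of G] fin
    by (auto simp: ga_carrier_iff intro: finite_subset)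
qed

lemma (in monoid) ga_eval_times:
  assumes "f \<in> carrier (group_algebra G)" "g \<in> carrier (group_algebra G)"
  shows "ga_eval h (f \<otimes>\<^bsub>group_algebra G\<^esub> g) = ga_eval (\<lambda>y. ga_eval (\<lambda>z. h (y \<otimes> z)) g) f"
  using assms by (intro ga_eval_mult) (auto simp: ga_carrier_iff)

lemma (in monoid) ring_group_algebra: "ring (group_algebra G)"
proof (rule ringI)
  have neg: "(\<lambda>x. - f x) \<in> carrier (group_algebra G)" if "f \<in> carrier (group_algebra G)" for f
    using ga_smult_closed[OF that, of "- 1"] by (simp add: ga_smult)
  show "abelian_group (group_algebra G)"
  proof (rule abelian_groupI)
    fix f assume f: "f \<in> carrier (group_algebra G)"
    show "\<exists>g\<in>carrier (group_algebra G). g \<oplus>\<^bsub>group_algebra G\<^esub> f = \<zero>\<^bsub>group_algebra G\<^esub>"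
      using neg[OF f] by (auto simp: ga_add ga_zero intro!: bexI[of _ "\<lambda>x. - f x"])
  qed (simp_all add: ga_add_closed, simp_all add: ga_add ga_zero ga_carrier_iff algebra_simps)
  have one: "\<one>\<^bsub>group_algebra G\<^esub> \<in> carrier (group_algebra G)"
    by (simp add: ga_one ga_of_closed)
  show "monoid (group_algebra G)"
  proof (rule monoidI)
    fix f g k
    assume fgk: "f \<in> carrier (group_algebra G)" "g \<in> carrier (group_algebra G)"
      "k \<in> carrier (group_algebra G)"
    \<comment> \<open>Both bracketings unfold to the same threefold evaluation; associativity in the
      group is invoked only at points of the supports.\<close>
    have "ga_eval h ((f \<otimes>\<^bsub>group_algebra G\<^esub> g) \<otimes>\<^bsub>group_algebra G\<^esub> k)
        = ga_eval h (f \<otimes>\<^bsub>group_algebra G\<^esub> (g \<otimes>\<^bsub>group_algebra G\<^esub> k))" for h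
      unfolding ga_eval_times[OF ga_mult_closed[OF fgk(1,2)] fgk(3)]
        ga_eval_times[OF fgk(1) ga_mult_closed[OF fgk(2,3)]]
        ga_eval_times[OF fgk(1,2)] ga_eval_times[OF fgk(2,3)]
      using fgk by (intro ga_eval_cong) (auto simp: ga_carrier_iff subset_iff m_assoc)
    then show "(f \<otimes>\<^bsub>group_algebra G\<^esub> g) \<otimes>\<^bsub>group_algebra G\<^esub> k
        = f \<otimes>\<^bsub>group_algebra G\<^esub> (g \<otimes>\<^bsub>group_algebra G\<^esub> k)"
      using fgk by (intro ga_eqI[where G = G]) (auto simp: ga_mult_closed)
  next
    fix f assume f: "f \<in> carrier (group_algebra G)"
    show "\<one>\<^bsub>group_algebra G\<^esub> \<otimes>\<^bsub>group_algebra G\<^esub> f = f"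
      using f one
      by (intro ga_eqI[OF ga_mult_closed], simp_all, subst ga_eval_times)
         (auto simp: ga_one ga_carrier_iff subset_iff intro!: ga_eval_cong)
    show "f \<otimes>\<^bsub>group_algebra G\<^esub> \<one>\<^bsub>group_algebra G\<^esub> = f"
      using f one
      by (intro ga_eqI[OF ga_mult_closed], simp_all, subst ga_eval_times)
         (auto simp: ga_one ga_carrier_iff subset_iff intro!: ga_eval_cong)
  qed (simp_all add: one ga_mult_closed)
  fix f g k
  assume fgk: "f \<in> carrier (group_algebra G)" "g \<in> carrier (group_algebra G)"
    "k \<in> carrier (group_algebra G)"
  show "(f \<oplus>\<^bsub>group_algebra G\<^esub> g) \<otimes>\<^bsub>group_algebra G\<^esub> k
      = f \<otimes>\<^bsub>group_algebra G\<^esub> k \<oplus>\<^bsub>group_algebra G\<^esub> g \<otimes>\<^bsub>group_algebra G\<^esub> k"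
    by (rule ga_eqI[where G = G])
      (simp_all add: fgk ga_mult_closed ga_add_closed ga_eval_times ga_eval_oplus)
  show "k \<otimes>\<^bsub>group_algebra G\<^esub> (f \<oplus>\<^bsub>group_algebra G\<^esub> g)
      = k \<otimes>\<^bsub>group_algebra G\<^esub> f \<oplus>\<^bsub>group_algebra G\<^esub> k \<otimes>\<^bsub>group_algebra G\<^esub> g"
    by (rule ga_eqI[where G = G])
      (simp_all add: fgk ga_mult_closed ga_add_closed ga_eval_times ga_eval_oplus ga_eval_add_left)
qed

lemma (in monoid) ga_of_mult:
  assumes "g \<in> carrier G" "h \<in> carrier G"
  shows "ga_of g \<otimes>\<^bsub>group_algebra G\<^esub> ga_of h = ga_of (g \<otimes> h)"
  using assms
  by (intro ga_eqI[where G = G])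
    (simp_all add: ga_mult_closed ga_of_closed ga_eval_times)

lemma (in monoid) ga_minus:
  assumes "f \<in> carrier (group_algebra G)" "g \<in> carrier (group_algebra G)"
  shows "f \<ominus>\<^bsub>group_algebra G\<^esub> g = f \<oplus>\<^bsub>group_algebra G\<^esub> (- 1) \<odot>\<^bsub>group_algebra G\<^esub> g"
proof -
  interpret A: ring "group_algebra G" by (rule ring_group_algebra)
  have "\<ominus>\<^bsub>group_algebra G\<^esub> g = (- 1) \<odot>\<^bsub>group_algebra G\<^esub> g"
    by (rule A.minus_equality) (simp_all add: assms ga_smult_closed, simp add: ga_add ga_zero ga_smult)
  then show ?thesis by (simp add: a_minus_def)
qed

text \<open>One point of the finite support is split off at a time. Linear statements about the
  algebra thereby reduce to single group elements.\<close>

lemma group_algebra_induct [consumes 1, case_names zero smult add]: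
  assumes f: "f \<in> carrier (group_algebra G)"
    and zero: "P (\<lambda>x. 0)"
    and smult: "\<And>c g. g \<in> carrier G \<Longrightarrow> P (c \<odot>\<^bsub>group_algebra G\<^esub> ga_of g)"
    and add: "\<And>f g. f \<in> carrier (group_algebra G) \<Longrightarrow> g \<in> carrier (group_algebra G)
      \<Longrightarrow> P f \<Longrightarrow> P g \<Longrightarrow> P (f \<oplus>\<^bsub>group_algebra G\<^esub> g)"
  shows "P f"
proof -
  have "P f" if "finite S" "{x. f x \<noteq> 0} = S" "S \<subseteq> carrier G" for S f
    using that
  proof (induction S arbitrary: f rule: finite_induct)
    case empty
    then have "f = (\<lambda>x. 0)" by auto
    then show ?case using zero by simp
  next
    case (insert a S)
    let ?g = "f(a := 0)" and ?h = "f a \<odot>\<^bsub>group_algebra G\<^esub> ga_of a"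
    have S: "{x. ?g x \<noteq> 0} = S" using insert by (auto simp: set_eq_iff)
    have a: "a \<in> carrier G" using insert by auto
    have h: "?h \<in> carrier (group_algebra G)" by (rule ga_smult_closed[OF ga_of_closed[OF a]])
    have g: "?g \<in> carrier (group_algebra G)"
      unfolding ga_carrier_iff S using insert by auto
    have "P ?g" using insert S by auto
    then have "P (?h \<oplus>\<^bsub>group_algebra G\<^esub> ?g)" by (rule add[OF h g smult[OF a]])
    also have "?h \<oplus>\<^bsub>group_algebra G\<^esub> ?g = f"
      by (auto simp: ga_add ga_smult ga_of_def fun_eq_iff)
    finally show ?case .
  qed
  then show ?thesis using f by (auto simp: ga_carrier_iff)
qed

subsection \<open>Traces\<close>

lemma mat_trace_add:
  "A \<in> carrier_mat d d \<Longrightarrow> B \<in> carrier_mat d d \<Longrightarrow> mat_trace (A + B) = mat_trace A + mat_trace B"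
  by (simp add: mat_trace_def sum.distrib)

lemma mat_trace_smult:
  "A \<in> carrier_mat d d \<Longrightarrow> mat_trace (c \<cdot>\<^sub>m A) = c * (mat_trace A :: complex)"
  by (simp add: mat_trace_def sum_distrib_left)

lemma mat_trace_one: "mat_trace (1\<^sub>m d :: complex mat) = of_nat d"
  by (simp add: mat_trace_def)

lemma mat_trace_comm:
  fixes A B :: "complex mat"
  assumes "A \<in> carrier_mat k l" "B \<in> carrier_mat l k"
  shows "mat_trace (A * B) = mat_trace (B * A)"
proof -
  have "mat_trace (A * B) = (\<Sum>i<k. \<Sum>j<l. A $$ (i, j) * B $$ (j, i))"
    using assms by (simp add: mat_trace_def scalar_prod_def lessThan_atLeast0)
  also have "\<dots> = (\<Sum>j<l. \<Sum>i<k. B $$ (j, i) * A $$ (i, j))"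
    by (subst sum.swap) (simp add: mult.commute)
  also have "\<dots> = mat_trace (B * A)"
    using assms by (simp add: mat_trace_def scalar_prod_def lessThan_atLeast0)
  finally show ?thesis .
qed

lemma mat_trace_four_block:
  assumes "A \<in> carrier_mat k k" "D \<in> carrier_mat l l"
  shows "mat_trace (four_block_mat A B C D) = (mat_trace A + mat_trace D :: complex)"
proof -
  have "mat_trace (four_block_mat A B C D)
      = (\<Sum>i<k + l. if i < k then A $$ (i, i) else D $$ (i - k, i - k))"
    using assms by (auto simp: mat_trace_def intro!: sum.cong)
  also have "\<dots> = (\<Sum>i<k. A $$ (i, i)) + (\<Sum>i<l. D $$ (i, i))"
    by (simp add: sum.nat_group[symmetric] lessThan_atLeast0 sum.atLeastLessThan_concat[of 0 k "k + l", symmetric]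
        sum.shift_bounds_nat_ivl[of _ 0 k l, simplified add.commute[of l] add_0])
  finally show ?thesis using assms by (simp add: mat_trace_def)
qed

lemma mat_trace_diag_block_mat:
  assumes "\<forall>A\<in>set As. square_mat A"
  shows "mat_trace (diag_block_mat As) = (\<Sum>A\<leftarrow>As. mat_trace A :: complex)"
  using assms
proof (induction As)
  case Nil
  then show ?case by (simp add: mat_trace_def)
next
  case (Cons A As)
  have "square_mat (diag_block_mat As)" by (rule diag_block_mat_square) (use Cons.prems in auto)
  then have "mat_trace (diag_block_mat (A # As)) = mat_trace A + mat_trace (diag_block_mat As)"
    using Cons.prems unfolding diag_block_mat.simps Let_def
    by (intro mat_trace_four_block[of _ "dim_row A" _ "dim_row (diag_block_mat As)"]) auto
  then show ?case using Cons by simp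
qed

lemma smult_smult_mat: "a \<cdot>\<^sub>m (b \<cdot>\<^sub>m A) = (a * b :: complex) \<cdot>\<^sub>m A"
  by (rule eq_matI) auto

lemma one_smult_mat: "(1 :: complex) \<cdot>\<^sub>m A = A"
  by (rule eq_matI) auto

lemma smult_mult_left:
  "A \<in> carrier_mat k l \<Longrightarrow> B \<in> carrier_mat l m \<Longrightarrow> (c \<cdot>\<^sub>m A) * B = (c :: complex) \<cdot>\<^sub>m (A * B)"
  by (rule mult_smult_assoc_mat)

lemma smult_mult_right:
  "A \<in> carrier_mat k l \<Longrightarrow> B \<in> carrier_mat l m \<Longrightarrow> A * (c \<cdot>\<^sub>m B) = (c :: complex) \<cdot>\<^sub>m (A * B)"
  by (rule mult_smult_distrib)

lemma smult_mat_vec: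
  "A \<in> carrier_mat k l \<Longrightarrow> v \<in> carrier_vec l \<Longrightarrow> (c \<cdot>\<^sub>m A) *\<^sub>v v = (c :: complex) \<cdot>\<^sub>v (A *\<^sub>v v)"
  by (rule eq_vecI) (auto simp: scalar_prod_def sum_distrib_left mult.assoc)

lemma mat_smult_vec:
  "A \<in> carrier_mat k l \<Longrightarrow> v \<in> carrier_vec l \<Longrightarrow> A *\<^sub>v (c \<cdot>\<^sub>v v) = (c :: complex) \<cdot>\<^sub>v (A *\<^sub>v v)"
  by (rule eq_vecI) (auto simp: scalar_prod_def sum_distrib_left algebra_simps)

lemma zero_mat_vec: "v \<in> carrier_vec l \<Longrightarrow> 0\<^sub>m k l *\<^sub>v v = (0\<^sub>v k :: complex vec)"
  by (rule eq_vecI) auto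

lemma eq_mat_on_vecI:
  fixes A B :: "complex mat"
  assumes "A \<in> carrier_mat k l" "B \<in> carrier_mat k l"
    and "\<And>v. v \<in> carrier_vec l \<Longrightarrow> A *\<^sub>v v = B *\<^sub>v v"
  shows "A = B"
proof (rule eq_matI)
  fix i j assume ij: "i < dim_row B" "j < dim_col B"
  then have "A *\<^sub>v unit_vec l j = B *\<^sub>v unit_vec l j" using assms by simp
  then have "(A *\<^sub>v unit_vec l j) $ i = (B *\<^sub>v unit_vec l j) $ i" by simp
  then show "A $$ (i, j) = B $$ (i, j)" using assms(1,2) ij by simp
qed (use assms in auto)

subsection \<open>Invariant subspaces\<close>

abbreviation subspace_vec :: "nat \<Rightarrow> complex vec set \<Rightarrow> bool" where
  "subspace_vec d W \<equiv> VectorSpace.subspace class_ring W (module_vec TYPE(complex) d)"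

lemma subspace_vecI:
  assumes "W \<subseteq> carrier_vec d" "0\<^sub>v d \<in> W"
    and "\<And>v w. v \<in> W \<Longrightarrow> w \<in> W \<Longrightarrow> v + w \<in> W" "\<And>c v. v \<in> W \<Longrightarrow> c \<cdot>\<^sub>v v \<in> W"
  shows "subspace_vec d W"
  unfolding VectorSpace.subspace_def submodule_def
  using assms vec_vs[of d] vec_module[of d] by (auto simp: module_vec_simps)

lemma subspace_vecD:
  assumes "subspace_vec d W"
  shows "W \<subseteq> carrier_vec d" "0\<^sub>v d \<in> W"
    and "\<And>v w. v \<in> W \<Longrightarrow> w \<in> W \<Longrightarrow> v + w \<in> W" "\<And>c v. v \<in> W \<Longrightarrow> c \<cdot>\<^sub>v v \<in> W"
  using assms unfolding VectorSpace.subspace_def submodule_def by (auto simp: module_vec_simps)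

text \<open>No algebra is attached to the family: irreducibility is a condition on generators only,
  so it can be moved between a representation and its matrices M_i.\<close>

definition irr_family :: "'i set \<Rightarrow> nat \<Rightarrow> ('i \<Rightarrow> complex mat) \<Rightarrow> bool" where
  "irr_family I d M \<longleftrightarrow> d > 0 \<and> (\<forall>W. subspace_vec d W \<and> (\<forall>i\<in>I. \<forall>w\<in>W. M i *\<^sub>v w \<in> W)
      \<longrightarrow> W = {0\<^sub>v d} \<or> W = carrier_vec d)"

lemma irr_familyD:
  assumes "irr_family I d M" "subspace_vec d W" "\<And>i w. i \<in> I \<Longrightarrow> w \<in> W \<Longrightarrow> M i *\<^sub>v w \<in> W"
  shows "W = {0\<^sub>v d} \<or> W = carrier_vec d"
  using assms unfolding irr_family_def by blast

section \<open>The Schur lemma for families of matrices\<close>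

lemma kernel_cases:
  assumes irr: "irr_family I d V"
    and V: "\<And>i. i \<in> I \<Longrightarrow> V i \<in> carrier_mat d d" and W: "\<And>i. i \<in> I \<Longrightarrow> W i \<in> carrier_mat d' d'"
    and P: "P \<in> carrier_mat d' d" and comm: "\<And>i. i \<in> I \<Longrightarrow> W i * P = P * V i"
  shows "P = 0\<^sub>m d' d \<or> (\<forall>v\<in>carrier_vec d. P *\<^sub>v v = 0\<^sub>v d' \<longrightarrow> v = 0\<^sub>v d)"
proof -
  let ?K = "{v \<in> carrier_vec d. P *\<^sub>v v = 0\<^sub>v d'}"
  have "?K = {0\<^sub>v d} \<or> ?K = carrier_vec d"
  proof (rule irr_familyD[OF irr])
    show "subspace_vec d ?K"
      using P by (intro subspace_vecI) (auto simp: mult_add_distrib_mat_vec[OF P] mat_smult_vec[OF P])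
    fix i v assume i: "i \<in> I" and v: "v \<in> ?K"
    have "P *\<^sub>v (V i *\<^sub>v v) = W i *\<^sub>v (P *\<^sub>v v)"
      using comm[OF i] assoc_mult_mat_vec[OF P V[OF i], of v] assoc_mult_mat_vec[OF W[OF i] P, of v] v
      by simp
    also have "\<dots> = 0\<^sub>v d'" using v W[OF i] by auto
    finally show "V i *\<^sub>v v \<in> ?K" using v V[OF i] by simp
  qed
  moreover have "P = 0\<^sub>m d' d" if "?K = carrier_vec d"
    using that P by (intro eq_mat_on_vecI[OF P]) (auto simp: zero_mat_vec)
  ultimately show ?thesis by blast
qed

text \<open>The image of an intertwiner is invariant under the target family, just as its kernel is
  under the source family; irreducibility leaves only the two extremes.\<close>

lemma image_cases:
  assumes irr: "irr_family I d' W"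
    and V: "\<And>i. i \<in> I \<Longrightarrow> V i \<in> carrier_mat d d" and W: "\<And>i. i \<in> I \<Longrightarrow> W i \<in> carrier_mat d' d'"
    and P: "P \<in> carrier_mat d' d" and comm: "\<And>i. i \<in> I \<Longrightarrow> W i * P = P * V i"
  shows "P = 0\<^sub>m d' d \<or> (\<forall>w\<in>carrier_vec d'. \<exists>v\<in>carrier_vec d. P *\<^sub>v v = w)"
proof -
  let ?K = "(\<lambda>v. P *\<^sub>v v) ` carrier_vec d"
  have "?K = {0\<^sub>v d'} \<or> ?K = carrier_vec d'"
  proof (rule irr_familyD[OF irr])
    show "subspace_vec d' ?K"
    proof (rule subspace_vecI)
      show "0\<^sub>v d' \<in> ?K" using P by (auto intro!: image_eqI[of _ _ "0\<^sub>v d"])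
      fix v w c assume "v \<in> ?K"
      then obtain v' where v': "v' \<in> carrier_vec d" "v = P *\<^sub>v v'" by auto
      show "c \<cdot>\<^sub>v v \<in> ?K"
        using v' by (auto simp: mat_smult_vec[OF P, symmetric] intro!: imageI)
      assume "w \<in> ?K"
      then obtain w' where "w' \<in> carrier_vec d" "w = P *\<^sub>v w'" by auto
      then show "v + w \<in> ?K"
        using v' by (auto simp: mult_add_distrib_mat_vec[OF P, symmetric] intro!: imageI)
    qed (use P in auto)
    fix i w assume i: "i \<in> I" and "w \<in> ?K"
    then obtain v where v: "v \<in> carrier_vec d" "w = P *\<^sub>v v" by auto
    then have "W i *\<^sub>v w = P *\<^sub>v (V i *\<^sub>v v)"
      using comm[OF i] assoc_mult_mat_vec[OF P V[OF i], of v] assoc_mult_mat_vec[OF W[OF i] P, of v]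
      by simp
    then show "W i *\<^sub>v w \<in> ?K" using V[OF i] v by auto
  qed
  moreover have "P = 0\<^sub>m d' d" if K: "?K = {0\<^sub>v d'}"
  proof (rule eq_mat_on_vecI[OF P])
    fix v :: "complex vec" assume v: "v \<in> carrier_vec d"
    then have "P *\<^sub>v v \<in> ?K" by blast
    then show "P *\<^sub>v v = 0\<^sub>m d' d *\<^sub>v v" using K v by (simp add: zero_mat_vec)
  qed simp
  ultimately show ?thesis by (metis (no_types, lifting) imageE)
qed

text \<open>A nonzero intertwiner has zero kernel and full image. The columns of \<open>Q\<close>
  are chosen preimages of the unit vectors, and comparing the traces of P Q and Q P equates the
  dimensions without any rank theory.\<close>

lemma schur_iso:
  assumes irrV: "irr_family I d V" and irrW: "irr_family I d' W"
    and V: "\<And>i. i \<in> I \<Longrightarrow> V i \<in> carrier_mat d d" and W: "\<And>i. i \<in> I \<Longrightarrow> W i \<in> carrier_mat d' d'"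
    and P: "P \<in> carrier_mat d' d" and comm: "\<And>i. i \<in> I \<Longrightarrow> W i * P = P * V i"
    and nz: "P \<noteq> 0\<^sub>m d' d"
  shows "d' = d" "invertible_mat P"
proof -
  have inj: "v = 0\<^sub>v d" if "v \<in> carrier_vec d" "P *\<^sub>v v = 0\<^sub>v d'" for v
    using kernel_cases[OF irrV V W P comm] nz that by blast
  have "\<forall>w\<in>carrier_vec d'. \<exists>v\<in>carrier_vec d. P *\<^sub>v v = w"
    using image_cases[OF irrW V W P comm] nz by blast
  then obtain r where r: "\<And>w. w \<in> carrier_vec d' \<Longrightarrow> r w \<in> carrier_vec d"
      "\<And>w. w \<in> carrier_vec d' \<Longrightarrow> P *\<^sub>v r w = w"
    by metis
  define Q where "Q = mat_of_cols d (map (\<lambda>j. r (unit_vec d' j)) [0..<d'])"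
  have Q: "Q \<in> carrier_mat d d'" unfolding Q_def by (intro carrier_matI) simp_all
  have colQ: "col Q j = r (unit_vec d' j)" if "j < d'" for j
    using that r(1)[of "unit_vec d' j"] unfolding Q_def by (subst col_mat_of_cols) auto
  have PQ: "P * Q = 1\<^sub>m d'"
  proof (rule eq_matI)
    fix i j assume ij: "i < dim_row (1\<^sub>m d' :: complex mat)" "j < dim_col (1\<^sub>m d' :: complex mat)"
    have "(P * Q) $$ (i, j) = (P *\<^sub>v col Q j) $ i" using ij P Q by simp
    also have "P *\<^sub>v col Q j = unit_vec d' j" using ij r(2) colQ by simp
    finally show "(P * Q) $$ (i, j) = 1\<^sub>m d' $$ (i, j)" using ij by simp
  qed (use P Q in auto)
  \<comment> \<open>So far \<open>Q\<close> is a right inverse. From P Q P = P the vector (Q P) v -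
    v lies in the kernel of \<open>P\<close>, which is zero.\<close>
  have QP: "Q * P = 1\<^sub>m d"
  proof (rule eq_mat_on_vecI)
    fix v :: "complex vec" assume v: "v \<in> carrier_vec d"
    let ?u = "(Q * P) *\<^sub>v v"
    have u: "?u \<in> carrier_vec d" using P Q v by auto
    have "P *\<^sub>v ?u = (P * (Q * P)) *\<^sub>v v" 
      by (rule assoc_mult_mat_vec[OF P mult_carrier_mat[OF Q P] v, symmetric])
    also have "P * (Q * P) = P" using PQ P Q by (metis assoc_mult_mat left_mult_one_mat)
    finally have "P *\<^sub>v (?u - v) = 0\<^sub>v d'"
      using P u v by (simp add: mult_minus_distrib_mat_vec[OF P u v])
    then have "?u - v = 0\<^sub>v d" by (intro inj) (use u v in auto)
    then have "?u = v"
      using u v by (metis (no_types, lifting) carrier_vecD eq_vecI index_minus_vec(1) index_zero_vec(1)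
          right_minus_eq)
    then show "Q * P *\<^sub>v v = 1\<^sub>m d *\<^sub>v v" using v by simp
  qed (use P Q in auto)
  have "of_nat d' = (of_nat d :: complex)"
    using mat_trace_comm[OF P Q] by (simp add: PQ QP mat_trace_one)
  then show "d' = d" by simp
  then show "invertible_mat P"
    using P Q PQ QP unfolding invertible_mat_def inverts_mat_def by auto
qed

text \<open>The factorisation (Z + c) (Z - c) = 0 replaces the search for an eigenvalue: either Z -
  c vanishes, or its image is everything, and on that image Z acts as -c.\<close>

lemma schur_involution:
  assumes irr: "irr_family I d V"
    and V: "\<And>i. i \<in> I \<Longrightarrow> V i \<in> carrier_mat d d"
    and Z: "Z \<in> carrier_mat d d" and comm: "\<And>i. i \<in> I \<Longrightarrow> V i * Z = Z * V i"
    and sq: "Z * Z = c\<^sup>2 \<cdot>\<^sub>m 1\<^sub>m d"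
  shows "Z = c \<cdot>\<^sub>m 1\<^sub>m d \<or> Z = (- c) \<cdot>\<^sub>m 1\<^sub>m d"
proof -
  let ?P = "Z + (- c) \<cdot>\<^sub>m 1\<^sub>m d"
  have P: "?P \<in> carrier_mat d d" using Z by simp
  have PZ: "Z * ?P = (- c) \<cdot>\<^sub>m ?P"
  proof -
    have "Z * ?P = Z * Z + (- c) \<cdot>\<^sub>m Z"
      using Z by (simp add: mult_add_distrib_mat[OF Z Z] smult_mult_right[OF Z one_carrier_mat])
    then show ?thesis using Z unfolding sq by (intro eq_matI) (auto simp: power2_eq_square algebra_simps)
  qed
  have c: "V i * ?P = ?P * V i" if "i \<in> I" for i
    using comm[OF that] V[OF that] Z
    by (simp add: mult_add_distrib_mat[OF V[OF that] Z] add_mult_distrib_mat[OF Z]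
        smult_mult_left[of _ d d _ d] smult_mult_right[of _ d d _ d])
  from image_cases[OF irr V V P c] show ?thesis
  proof
    assume "?P = 0\<^sub>m d d"
    then have "(?P $$ (i, j)) = 0" if "i < d" "j < d" for i j using that by simp
    then have "Z = c \<cdot>\<^sub>m 1\<^sub>m d" using Z by (intro eq_matI) (auto simp: eq_neg_iff_add_eq_0)
    then show ?thesis ..
  next
    assume surj: "\<forall>w\<in>carrier_vec d. \<exists>v\<in>carrier_vec d. ?P *\<^sub>v v = w"
    have "Z = (- c) \<cdot>\<^sub>m 1\<^sub>m d"
    proof (rule eq_mat_on_vecI[OF Z])
      fix w :: "complex vec" assume w: "w \<in> carrier_vec d"
      then obtain v where v: "v \<in> carrier_vec d" "?P *\<^sub>v v = w" using surj by blast
      have "Z *\<^sub>v w = (Z * ?P) *\<^sub>v v" using v Z P by (simp add: assoc_mult_mat_vec[OF Z P])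
      also have "\<dots> = (- c) \<cdot>\<^sub>v w" unfolding PZ using v by (simp add: smult_mat_vec[OF P])
      also have "\<dots> = ((- c) \<cdot>\<^sub>m 1\<^sub>m d) *\<^sub>v w" using w by (subst smult_mat_vec[of _ d d]) auto
      finally show "Z *\<^sub>v w = ((- c) \<cdot>\<^sub>m 1\<^sub>m d) *\<^sub>v w" .
    qed simp
    then show ?thesis ..
  qed
qed

text \<open>Keeps the index set in the form \<open>{1..<n}\<close> instead of \<open>{Suc 0..<n}\<close>.\<close>
declare One_nat_def [simp del]

subsection \<open>Families of anticommuting square roots of minus one\<close>

definition nb_sign :: "nat \<Rightarrow> nat \<Rightarrow> complex" where
  "nb_sign i j = (if i = Suc j \<or> j = Suc i then - 1 else 1)"

lemma nb_sign_commute: "nb_sign i j = nb_sign j i"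
  by (auto simp: nb_sign_def)

lemma nb_sign_square [simp]: "nb_sign i j * nb_sign i j = 1"
  by (simp add: nb_sign_def)

fun wmat :: "nat \<Rightarrow> (nat \<Rightarrow> complex mat) \<Rightarrow> nat list \<Rightarrow> complex mat" where
  "wmat d M [] = 1\<^sub>m d"
| "wmat d M (i # w) = M i * wmat d M w"

text \<open>Clifford-type relations for the path graph on the letters: neighbours anticommute, other
  pairs commute. Up to sign every product of generators is one of the 2^(n - 1) increasing words, so
  a finite group stands behind the averaging further down.\<close>

locale nb_clifford =
  fixes n d :: nat and M :: "nat \<Rightarrow> complex mat"
  assumes closed: "i \<in> {1..<n} \<Longrightarrow> M i \<in> carrier_mat d d"
    and square: "i \<in> {1..<n} \<Longrightarrow> M i * M i = (- 1) \<cdot>\<^sub>m 1\<^sub>m d"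
    and commute: "i \<in> {1..<n} \<Longrightarrow> j \<in> {1..<n} \<Longrightarrow> M i * M j = nb_sign i j \<cdot>\<^sub>m (M j * M i)"
begin

lemma wmat_closed [simp]: "set w \<subseteq> {1..<n} \<Longrightarrow> wmat d M w \<in> carrier_mat d d"
  by (induction w) (auto intro!: mult_carrier_mat closed)

lemma wmat_append:
  "set u \<subseteq> {1..<n} \<Longrightarrow> set w \<subseteq> {1..<n} \<Longrightarrow> wmat d M (u @ w) = wmat d M u * wmat d M w"
proof (induction u)
  case Nil
  then show ?case using left_mult_one_mat[OF wmat_closed[of w]] by simp
next
  case (Cons i u)
  then have "M i \<in> carrier_mat d d" "wmat d M u \<in> carrier_mat d d" "wmat d M w \<in> carrier_mat d d"
    using closed by simp_all
  then show ?case using Cons by (simp add: assoc_mult_mat[of _ d d _ d _ d])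
qed

lemma wmat_commute:
  assumes "j \<in> {1..<n}" "set w \<subseteq> {1..<n}"
  shows "M j * wmat d M w = prod_list (map (nb_sign j) w) \<cdot>\<^sub>m (wmat d M w * M j)"
  using assms(2)
proof (induction w)
  case Nil
  then show ?case using closed[OF assms(1)] by (simp add: one_smult_mat)
next
  case (Cons i w)
  have j: "M j \<in> carrier_mat d d" and i: "M i \<in> carrier_mat d d" and w: "wmat d M w \<in> carrier_mat d d"
    using closed assms Cons.prems by simp_all
  have "M j * (M i * wmat d M w) = nb_sign j i \<cdot>\<^sub>m (M i * M j) * wmat d M w"
    using commute[OF assms(1), of i] Cons.prems
    by (simp add: assoc_mult_mat[OF j i w, symmetric])
  also have "\<dots> = nb_sign j i \<cdot>\<^sub>m (M i * (M j * wmat d M w))"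
    using assoc_mult_mat[OF i j w] by (simp add: smult_mult_left[OF mult_carrier_mat[OF i j] w])
  also have "M j * wmat d M w = prod_list (map (nb_sign j) w) \<cdot>\<^sub>m (wmat d M w * M j)"
    using Cons by simp
  also have "nb_sign j i \<cdot>\<^sub>m (M i * (prod_list (map (nb_sign j) w) \<cdot>\<^sub>m (wmat d M w * M j)))
     = prod_list (map (nb_sign j) (i # w)) \<cdot>\<^sub>m (M i * (wmat d M w * M j))"
    by (simp add: smult_mult_right[OF i mult_carrier_mat[OF w j]] smult_smult_mat)
  finally show ?case using assoc_mult_mat[OF i w j] by simp
qed

text \<open>With A the word, the trace of M_j A M_j is computed twice: cyclicity and the square -1
  give minus the trace of A, while anticommuting M_j past A gives the trace of A.\<close>

lemma trace_zero:
  assumes j: "j \<in> {1..<n}" and w: "set w \<subseteq> {1..<n}" and s: "prod_list (map (nb_sign j) w) = - 1"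
  shows "mat_trace (wmat d M w) = 0"
proof -
  let ?A = "wmat d M w"
  have A: "?A \<in> carrier_mat d d" and Mj: "M j \<in> carrier_mat d d" using w j closed by simp_all
  have "mat_trace (M j * (?A * M j)) = mat_trace ((?A * M j) * M j)"
    by (rule mat_trace_comm[OF Mj mult_carrier_mat[OF A Mj]])
  also have "(?A * M j) * M j = (- 1) \<cdot>\<^sub>m ?A"
    using A by (simp add: assoc_mult_mat[OF A Mj Mj] square[OF j] smult_mult_right[OF A one_carrier_mat])
  also have "M j * (?A * M j) = (M j * ?A) * M j" by (rule assoc_mult_mat[OF Mj A Mj, symmetric])
  also have "M j * ?A = (- 1) \<cdot>\<^sub>m (?A * M j)" using wmat_commute[OF j w] s by simp
  also have "(- 1) \<cdot>\<^sub>m (?A * M j) * M j = (- 1) \<cdot>\<^sub>m ((- 1) \<cdot>\<^sub>m ?A)"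
    using A by (simp add: smult_mult_left[OF mult_carrier_mat[OF A Mj] Mj] assoc_mult_mat[OF A Mj Mj]
        square[OF j] smult_mult_right[OF A one_carrier_mat])
  finally show ?thesis using A by (simp add: smult_smult_mat mat_trace_smult[OF A] one_smult_mat)
qed

text \<open>The letters cancel in pairs from the middle outwards. Up to sign the reversed word is
  the inverse, which is the form in which inverses enter the trace sum below.\<close>

lemma wmat_rev:
  assumes "set w \<subseteq> {1..<n}"
  shows "wmat d M (rev w) * wmat d M w = (- 1) ^ length w \<cdot>\<^sub>m 1\<^sub>m d"
  using assms
proof (induction w)
  case Nil
  then show ?case by (simp add: one_smult_mat)
next
  case (Cons i w)
  have i: "M i \<in> carrier_mat d d" and w: "wmat d M w \<in> carrier_mat d d"
    and r: "wmat d M (rev w) \<in> carrier_mat d d"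
    using closed Cons.prems by simp_all
  have "wmat d M (rev (i # w)) = wmat d M (rev w) * M i"
    using Cons.prems i r by (simp add: wmat_append right_mult_one_mat[OF i])
  then have "wmat d M (rev (i # w)) * wmat d M (i # w)
      = wmat d M (rev w) * ((M i * M i) * wmat d M w)"
    using assoc_mult_mat[OF r i mult_carrier_mat[OF i w]] assoc_mult_mat[OF i i w] by simp
  also have "\<dots> = (- 1) \<cdot>\<^sub>m (wmat d M (rev w) * wmat d M w)"
    using w Cons.prems
    by (simp add: square smult_mult_left[OF one_carrier_mat w] smult_mult_right[OF r w] left_mult_one_mat[OF w])
  finally show ?case using Cons by (simp add: smult_smult_mat)
qed

lemma wmat_square:
  assumes "set w \<subseteq> {1..<n}" "\<And>i j. i \<in> set w \<Longrightarrow> j \<in> set w \<Longrightarrow> nb_sign i j = 1"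
  shows "wmat d M w * wmat d M w = (- 1) ^ length w \<cdot>\<^sub>m 1\<^sub>m d"
  using assms
proof (induction w)
  case Nil
  then show ?case by (simp add: one_smult_mat)
next
  case (Cons i w)
  have i: "M i \<in> carrier_mat d d" and w: "wmat d M w \<in> carrier_mat d d"
    using closed Cons.prems by simp_all
  have "prod_list (map (nb_sign i) w) = 1" using Cons.prems(2) by (induction w) auto
  then have c: "M i * wmat d M w = wmat d M w * M i"
    using wmat_commute[of i w] Cons.prems by (simp add: one_smult_mat)
  have "(M i * wmat d M w) * (M i * wmat d M w) = M i * ((wmat d M w * M i) * wmat d M w)"
    using i w by (simp add: assoc_mult_mat[of _ d d _ d _ d])
  also have "\<dots> = (M i * M i) * (wmat d M w * wmat d M w)"
    unfolding c[symmetric] using i w by (simp add: assoc_mult_mat[of _ d d _ d _ d])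
  also have "\<dots> = (- 1) \<cdot>\<^sub>m (wmat d M w * wmat d M w)"
    using Cons.prems w by (simp add: square smult_mult_left[OF one_carrier_mat mult_carrier_mat[OF w w]]
        left_mult_one_mat[OF mult_carrier_mat[OF w w]])
  finally show ?case using Cons by (simp add: smult_smult_mat)
qed

end

subsection \<open>The central word\<close>

text \<open>For even n the letters are 1, 3, ..., n - 1. For odd n at least 3 the word is not
  central: the letter n - 1 has n - 2 as its only neighbour, and n - 2 occurs in the word.\<close>

definition odd_word :: "nat \<Rightarrow> nat list" where
  "odd_word n = filter odd [1..<n]"

text \<open>A word without repetitions meets at most the two neighbours of \<open>j\<close>, and
  each contributes one sign. Since \<open>j \<ge> 1\<close>, the truncated \<open>j - 1\<close>
  really is the left neighbour.\<close>

lemma nb_sign_prod: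
  assumes "distinct w" "j \<ge> 1"
  shows "prod_list (map (nb_sign j) w)
    = (if j + 1 \<in> set w then - 1 else 1) * (if j - 1 \<in> set w then - 1 else 1)"
  using assms by (induction w) (auto simp: nb_sign_def Suc_eq_plus1)

text \<open>The condition makes membership in \<open>W\<close> periodic with period 2 on 0, ..., n.
  Neither 0 nor n is a letter: 0 rules out the even letters, and an odd n would rule out the odd
  ones as well.\<close>

lemma neighbour_closed_imp_odd:
  assumes W: "W \<subseteq> {1..<n}" "W \<noteq> {}"
    and nb: "\<And>j. j \<in> {1..<n::nat} \<Longrightarrow> j - 1 \<in> W \<longleftrightarrow> j + 1 \<in> W"
  shows "even n \<and> W = {i \<in> {1..<n}. odd i}"
proof -
  have up: "a + 2 * k \<in> W \<longleftrightarrow> a \<in> W" if "a + 2 * k \<le> n" for a k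
    using that
  proof (induction k)
    case (Suc k)
    then show ?case using nb[of "Suc (a + 2 * k)"] by auto
  qed simp
  have ev: "i \<notin> W" if "even i" for i
  proof
    assume "i \<in> W"
    then have "0 + 2 * (i div 2) \<in> W" using that by simp
    then have "0 \<in> W" using up[of 0 "i div 2"] W(1) \<open>i \<in> W\<close> that by auto
    then show False using W(1) by auto
  qed
  have od: "i \<in> W \<longleftrightarrow> 1 \<in> W" if "odd i" "i \<le> n" for i
    using up[of 1 "i div 2"] that odd_pos[of i] by simp
  obtain i where i: "i \<in> W" using W(2) by auto
  then have one: "1 \<in> W" using od[of i] ev[of i] W(1) by fastforce
  have "n \<notin> W" using W(1) by auto
  then have "even n" using od[of n] one by auto
  moreover have "W = {i \<in> {1..<n}. odd i}"
  proof (rule Set.set_eqI)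
    fix i show "i \<in> W \<longleftrightarrow> i \<in> {i \<in> {1..<n}. odd i}"
      using W(1) ev[of i] od[of i] one by fastforce
  qed
  ultimately show ?thesis ..
qed

text \<open>If no generator anticommutes with the word, every letter has both or none of its
  neighbours in it. This determines the set of letters, and sortedness then determines the
  word.\<close>

lemma anticommuting_letter_or_odd_word:
  assumes "sorted_wrt (<) w" "set w \<subseteq> {1..<n}" "w \<noteq> []"
  shows "(\<exists>j\<in>{1..<n}. prod_list (map (nb_sign j) w) = - 1) \<or> even n \<and> w = odd_word n"
proof (cases "\<exists>j\<in>{1..<n}. prod_list (map (nb_sign j) w) = - 1")
  case False
  have dw: "distinct w" using assms(1) by (simp add: strict_sorted_iff)
  have "j - 1 \<in> set w \<longleftrightarrow> j + 1 \<in> set w" if "j \<in> {1..<n}" for j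
    using False that nb_sign_prod[OF dw, of j] by (auto split: if_splits)
  from neighbour_closed_imp_odd[OF assms(2) _ this] assms(3)
  have "even n" "set w = {i \<in> {1..<n}. odd i}" by auto
  moreover have "set (odd_word n) = {i \<in> {1..<n}. odd i}" "sorted_wrt (<) (odd_word n)"
    by (auto simp: odd_word_def sorted_wrt_filter)
  ultimately show ?thesis
    using assms(1) strict_sorted_equal by metis
qed simp

lemma odd_word_subset: "set (odd_word n) \<subseteq> {1..<n}"
  by (auto simp: odd_word_def)

lemma odd_word_nb_sign: "i \<in> set (odd_word n) \<Longrightarrow> j \<in> set (odd_word n) \<Longrightarrow> nb_sign i j = 1"
  by (auto simp: odd_word_def nb_sign_def)

text \<open>Odd letters have no neighbour in the word. Even letters have both, because for even n
  the last letter n - 1 is odd.\<close>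

lemma odd_word_central:
  assumes "even n" "j \<in> {1..<n}"
  shows "prod_list (map (nb_sign j) (odd_word n)) = 1"
proof -
  have "distinct (odd_word n)" by (simp add: odd_word_def)
  moreover have "j + 1 \<in> set (odd_word n) \<longleftrightarrow> j - 1 \<in> set (odd_word n)"
    using assms unfolding odd_word_def by (cases j) (auto elim!: evenE oddE, presburger+)
  ultimately show ?thesis using nb_sign_prod[of "odd_word n" j] assms by simp
qed

context nb_clifford
begin

lemma odd_word_scalar:
  assumes irr: "irr_family {1..<n} d M" and "even n"
  shows "\<exists>c. c\<^sup>2 = (- 1) ^ length (odd_word n) \<and> wmat d M (odd_word n) = c \<cdot>\<^sub>m 1\<^sub>m d"
proof -
  \<comment> \<open>Either square root serves, since the conclusion fixes only the square of the
    scalar.\<close>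
  define c :: complex where "c = csqrt ((- 1) ^ length (odd_word n))"
  have c: "c\<^sup>2 = (- 1) ^ length (odd_word n)" by (simp add: c_def)
  let ?Z = "wmat d M (odd_word n)"
  have "?Z = c \<cdot>\<^sub>m 1\<^sub>m d \<or> ?Z = (- c) \<cdot>\<^sub>m 1\<^sub>m d"
  proof (rule schur_involution[OF irr closed])
    show "?Z \<in> carrier_mat d d" by (rule wmat_closed[OF odd_word_subset])
    show "M i * ?Z = ?Z * M i" if "i \<in> {1..<n}" for i
      using wmat_commute[OF that odd_word_subset] odd_word_central[OF assms(2) that]
      by (simp add: one_smult_mat)
    show "?Z * ?Z = c\<^sup>2 \<cdot>\<^sub>m 1\<^sub>m d"
      using wmat_square[OF odd_word_subset odd_word_nb_sign] c by simp
  qed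
  then show ?thesis using c by (metis power2_minus)
qed

end

subsection \<open>Averaging intertwiners\<close>

text \<open>If \<open>Y\<close> intertwines the generators in \<open>l\<close>, then \<open>Y - W\<^sub>j Y V\<^sub>j\<close> intertwines those in
  \<open>l\<close> and \<open>j\<close>, because \<open>W\<^sub>j\<^sup>2 = V\<^sub>j\<^sup>2 = -1\<close>.\<close>

fun avg :: "(nat \<Rightarrow> complex mat) \<Rightarrow> (nat \<Rightarrow> complex mat) \<Rightarrow> nat list \<Rightarrow> complex mat \<Rightarrow> complex mat" where
  "avg W V [] X = X"
| "avg W V (j # l) X = avg W V l X + (- 1) \<cdot>\<^sub>m (W j * avg W V l X * V j)"

definition elem_mat :: "nat \<Rightarrow> nat \<Rightarrow> nat \<Rightarrow> nat \<Rightarrow> complex mat" where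
  "elem_mat k l a b = mat k l (\<lambda>(i, j). if i = a \<and> j = b then 1 else 0)"

lemma sorted_wrt_subseqs:
  "sorted_wrt P l \<Longrightarrow> w \<in> set (subseqs l) \<Longrightarrow> sorted_wrt P w \<and> set w \<subseteq> set l"
  by (induction l arbitrary: w) (auto simp: Let_def, blast+)

lemma Nil_in_subseqs: "[] \<in> set (subseqs l)"
  by (induction l) (auto simp: Let_def)

lemma of_nat_sum_list: "of_nat (\<Sum>x\<leftarrow>xs. f x) = (\<Sum>x\<leftarrow>xs. of_nat (f x) :: 'a :: semiring_1)"
  by (induction xs) auto

text \<open>The matrix unit makes the product a column of A times a row of B. At position (a, b) two
  diagonal entries appear, which is how sums over matrix units become products of traces.\<close>

lemma elem_mat_sandwich:
  assumes "A \<in> carrier_mat k k" "B \<in> carrier_mat l l" "a < k" "b < l" "i < k" "j < l"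
  shows "(A * elem_mat k l a b * B) $$ (i, j) = A $$ (i, a) * B $$ (b, j)"
proof -
  have "(A * elem_mat k l a b) $$ (i, q) = (if q = b then A $$ (i, a) else 0)" if "q < l" for q
    using assms that by (auto simp: elem_mat_def scalar_prod_def if_distrib cong: if_cong)
  then show ?thesis
    using assms by (simp add: scalar_prod_def elem_mat_def if_distrib[of "\<lambda>x. x * _"] cong: if_cong)
qed

lemma sum_list_uminus: "(\<Sum>x\<leftarrow>xs. - f x) = - (\<Sum>x\<leftarrow>xs. f x :: 'a :: ab_group_add)"
  by (induction xs) auto

locale nb_clifford_pair = V: nb_clifford n d V + W: nb_clifford n d' W for n d V d' W
begin

lemma avg_closed: "set l \<subseteq> {1..<n} \<Longrightarrow> X \<in> carrier_mat d' d \<Longrightarrow> avg W V l X \<in> carrier_mat d' d"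
proof (induction l)
  case (Cons j l)
  then have "W j \<in> carrier_mat d' d'" "V j \<in> carrier_mat d d" "avg W V l X \<in> carrier_mat d' d"
    using V.closed W.closed by auto
  then show ?case by simp
qed simp

lemma avg_intertwines:
  assumes "set l \<subseteq> {1..<n}" "X \<in> carrier_mat d' d" "i \<in> set l"
  shows "W i * avg W V l X = avg W V l X * V i"
  using assms(1,3)
proof (induction l)
  case (Cons j l)
  define Y where "Y = avg W V l X"
  have Y: "Y \<in> carrier_mat d' d" unfolding Y_def using Cons.prems assms by (intro avg_closed) auto
  have j: "j \<in> {1..<n}" and i: "i \<in> {1..<n}" using Cons.prems by auto
  note car = Y W.closed[OF j] V.closed[OF j] W.closed[OF i] V.closed[OF i]
  note asc = assoc_mult_mat[of _ d' d' _ d' _ d] assoc_mult_mat[of _ d' d' _ d _ d]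
    assoc_mult_mat[of _ d' d _ d _ d]
  show ?case
  proof (cases "i = j")
    case True
    have 1: "W j * (W j * (Y * V j)) = (- 1) \<cdot>\<^sub>m (Y * V j)"
    proof -
      have "W j * (W j * (Y * V j)) = (W j * W j) * (Y * V j)"
        using car by (simp add: asc)
      then show ?thesis using car by (simp add: W.square[OF j] smult_mult_left[of _ d' d' _ d])
    qed
    have "W j * (Y + (- 1) \<cdot>\<^sub>m (W j * Y * V j)) = W j * Y + Y * V j"
      using car by (simp add: asc mult_add_distrib_mat[of _ d' d' _ d] smult_mult_right[of _ d' d' _ d] 1
        smult_smult_mat one_smult_mat)
    also have "\<dots> = (Y + (- 1) \<cdot>\<^sub>m (W j * Y * V j)) * V j"
      using car by (simp add: asc add_mult_distrib_mat[of _ d' d _ _ d] smult_mult_left[of _ d' d _ d]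
        smult_mult_right[of _ d' d _ d] smult_mult_right[of _ d' d' _ d] V.square[OF j] smult_smult_mat one_smult_mat comm_add_mat[of "Y * V j" d' d])
    finally show ?thesis unfolding True by (simp add: Y_def)
  next
    case False
    \<comment> \<open>Moving \<open>W i\<close> past \<open>W j\<close> on the left and
      \<open>V i\<close> past \<open>V j\<close> on the right costs the same sign, so the two signs
      cancel.\<close>
    then have IH: "W i * Y = Y * V i" using Cons unfolding Y_def by auto
    have "W i * (W j * (Y * V j)) = (W i * W j) * (Y * V j)"
      using car by (simp add: asc)
    also have "\<dots> = nb_sign i j \<cdot>\<^sub>m (W j * ((W i * Y) * V j))"
      using car by (simp add: W.commute[OF i j] smult_mult_left[of _ d' d' _ d] asc)
    also have "(W i * Y) * V j = Y * (V i * V j)"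
      unfolding IH using car by (simp add: asc)
    also have "\<dots> = nb_sign i j \<cdot>\<^sub>m (Y * (V j * V i))"
      using car by (simp add: V.commute[OF i j] smult_mult_right[of _ d' d _ d])
    also have "nb_sign i j \<cdot>\<^sub>m (W j * (nb_sign i j \<cdot>\<^sub>m (Y * (V j * V i)))) = W j * (Y * (V j * V i))"
      using car by (simp add: smult_mult_right[of _ d' d' _ d] smult_smult_mat one_smult_mat)
    finally have 1: "W i * (W j * (Y * V j)) = W j * (Y * (V j * V i))" .
    have "W i * (Y + (- 1) \<cdot>\<^sub>m (W j * Y * V j)) = W i * Y + (- 1) \<cdot>\<^sub>m (W j * Y * V j * V i)"
      using car by (simp add: asc mult_add_distrib_mat[of _ d' d' _ d] smult_mult_right[of _ d' d' _ d] 1)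
    also have "\<dots> = (Y + (- 1) \<cdot>\<^sub>m (W j * Y * V j)) * V i"
      using car by (simp add: asc add_mult_distrib_mat[of _ d' d _ _ d] smult_mult_left[of _ d' d _ d] IH)
    finally show ?thesis by (simp add: Y_def)
  qed
qed simp

text \<open>Unfolding the average produces the terms (-1)^|w| \<open>W\<close>_w X
  \<open>V\<close>_rev(w) over the subwords w of \<open>l\<close>. The outer factors
  \<open>A\<close> and \<open>B\<close> are arbitrary so that the induction can absorb
  \<open>W j\<close> into the left one and \<open>V j\<close> into the right one.\<close>

lemma avg_trace_expansion:
  assumes "set l \<subseteq> {1..<n}" "A \<in> carrier_mat d' d'" "B \<in> carrier_mat d d"
  shows "(\<Sum>a<d'. \<Sum>b<d. (A * avg W V l (elem_mat d' d a b) * B) $$ (a, b))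
    = (\<Sum>w\<leftarrow>subseqs l. (- 1) ^ length w
        * (mat_trace (A * wmat d' W w) * mat_trace (wmat d V (rev w) * B)))"
  using assms
proof (induction l arbitrary: A B)
  case Nil
  then show ?case
    by (simp add: elem_mat_sandwich mat_trace_def sum_product right_mult_one_mat[of _ d' d'] del: index_mult_mat(1))
next
  case (Cons j l)
  have j: "j \<in> {1..<n}" and l: "set l \<subseteq> {1..<n}" using Cons.prems by auto
  note car = W.closed[OF j] V.closed[OF j] Cons.prems(2,3)
  have E: "elem_mat d' d a b \<in> carrier_mat d' d" for a b by (simp add: elem_mat_def)
  have Y: "avg W V l (elem_mat d' d a b) \<in> carrier_mat d' d" for a b
    using l E by (rule avg_closed)
  have split: "A * avg W V (j # l) (elem_mat d' d a b) * B
      = A * avg W V l (elem_mat d' d a b) * B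
        + (- 1) \<cdot>\<^sub>m ((A * W j) * avg W V l (elem_mat d' d a b) * (V j * B))" for a b
  proof -
    let ?Y = "avg W V l (elem_mat d' d a b)"
    have "A * (W j * ?Y * V j) * B = (A * W j) * ?Y * (V j * B)"
      using car Y[of a b]
      by (simp add: assoc_mult_mat[of _ d' d _ d _ d] assoc_mult_mat[of _ d' d' _ d _ d]
          assoc_mult_mat[of _ d' d' _ d' _ d])
    then show ?thesis
      using car Y[of a b]
      by (simp add: mult_add_distrib_mat[of _ d' d' _ d] smult_mult_right[of _ d' d' _ d]
        add_mult_distrib_mat[of _ d' d _ _ d] smult_mult_left[of _ d' d _ d])
  qed
  have "(\<Sum>a<d'. \<Sum>b<d. (A * avg W V (j # l) (elem_mat d' d a b) * B) $$ (a, b))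
     = (\<Sum>a<d'. \<Sum>b<d. (A * avg W V l (elem_mat d' d a b) * B) $$ (a, b))
      - (\<Sum>a<d'. \<Sum>b<d. ((A * W j) * avg W V l (elem_mat d' d a b) * (V j * B)) $$ (a, b))"
    unfolding split sum_subtractf[symmetric]
  proof (intro sum.cong HOL.refl)
    fix a b assume "a \<in> {..<d'}" "b \<in> {..<d}"
    then show "(A * avg W V l (elem_mat d' d a b) * B
        + (- 1) \<cdot>\<^sub>m ((A * W j) * avg W V l (elem_mat d' d a b) * (V j * B))) $$ (a, b)
      = (A * avg W V l (elem_mat d' d a b) * B) $$ (a, b)
        - ((A * W j) * avg W V l (elem_mat d' d a b) * (V j * B)) $$ (a, b)"
      using car Y[of a b] by (simp del: index_mult_mat(1))
  qed
  also have "\<dots> = (\<Sum>w\<leftarrow>subseqs l. (- 1) ^ length w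
        * (mat_trace (A * wmat d' W w) * mat_trace (wmat d V (rev w) * B)))
      - (\<Sum>w\<leftarrow>subseqs l. (- 1) ^ length w
        * (mat_trace ((A * W j) * wmat d' W w) * mat_trace (wmat d V (rev w) * (V j * B))))"
    using Cons.IH[OF l car(3,4)] Cons.IH[OF l mult_carrier_mat[OF car(3,1)] mult_carrier_mat[OF car(2,4)]]
    by simp
  also have "(\<Sum>w\<leftarrow>subseqs l. (- 1) ^ length w
        * (mat_trace ((A * W j) * wmat d' W w) * mat_trace (wmat d V (rev w) * (V j * B))))
      = - (\<Sum>w\<leftarrow>map ((#) j) (subseqs l). (- 1) ^ length w
        * (mat_trace (A * wmat d' W w) * mat_trace (wmat d V (rev w) * B)))"
  proof -
    have "(- 1) ^ length w * (mat_trace ((A * W j) * wmat d' W w) * mat_trace (wmat d V (rev w) * (V j * B)))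
      = - ((- 1) ^ length (j # w) * (mat_trace (A * wmat d' W (j # w)) * mat_trace (wmat d V (rev (j # w)) * B)))"
      if "w \<in> set (subseqs l)" for w
    proof -
      have w: "set w \<subseteq> {1..<n}" using that l by (metis Pow_iff imageI subseqs_powset subset_trans)
      have "A * wmat d' W (j # w) = (A * W j) * wmat d' W w"
        using car w by (simp add: assoc_mult_mat[of _ d' d' _ d' _ d'])
      moreover have "wmat d V (rev (j # w)) * B = wmat d V (rev w) * (V j * B)"
        using car w j by (simp add: V.wmat_append assoc_mult_mat[of _ d d _ d _ d] right_mult_one_mat[of _ d d])
      ultimately show ?thesis by simp
    qed
    then have "map (\<lambda>w. (- 1) ^ length w
          * (mat_trace ((A * W j) * wmat d' W w) * mat_trace (wmat d V (rev w) * (V j * B)))) (subseqs l)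
        = map (\<lambda>w. - ((- 1) ^ length (j # w)
          * (mat_trace (A * wmat d' W (j # w)) * mat_trace (wmat d V (rev (j # w)) * B)))) (subseqs l)"
      by (intro map_cong HOL.refl)
    then show ?thesis by (simp only: sum_list_uminus map_map o_def)
  qed
  finally show ?case by (simp add: Let_def)
qed

text \<open>This is orthogonality of characters. If all averaged matrix units vanished, so would the
  sum of the trace products over all increasing words. But the empty word contributes d d', for even
  n the central word does too because both families give it the same scalar, and every other word
  contributes 0.\<close>

lemma ex_nonzero_intertwiner:
  assumes pos: "d > 0" "d' > 0"
    and ch: "even n \<Longrightarrow> \<exists>c. c \<noteq> 0 \<and> wmat d V (odd_word n) = c \<cdot>\<^sub>m 1\<^sub>m d \<and> wmat d' W (odd_word n) = c \<cdot>\<^sub>m 1\<^sub>m d'"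
  shows "\<exists>P\<in>carrier_mat d' d. P \<noteq> 0\<^sub>m d' d \<and> (\<forall>i\<in>{1..<n}. W i * P = P * V i)"
proof (rule ccontr)
  assume neg: "\<not> ?thesis"
  have E: "elem_mat d' d a b \<in> carrier_mat d' d" for a b by (simp add: elem_mat_def)
  have "avg W V [1..<n] (elem_mat d' d a b) = 0\<^sub>m d' d" for a b
  proof -
    have "avg W V [1..<n] (elem_mat d' d a b) \<in> carrier_mat d' d"
      by (rule avg_closed[OF _ E]) simp
    moreover have "\<forall>i\<in>{1..<n}. W i * avg W V [1..<n] (elem_mat d' d a b)
        = avg W V [1..<n] (elem_mat d' d a b) * V i"
      by (intro ballI avg_intertwines[OF _ E]) simp_all
    ultimately show ?thesis using neg by blast
  qed
  then have "(\<Sum>w\<leftarrow>subseqs [1..<n]. (- 1) ^ length w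
        * (mat_trace (1\<^sub>m d' * wmat d' W w) * mat_trace (wmat d V (rev w) * 1\<^sub>m d))) = 0"
    by (subst avg_trace_expansion[symmetric]) simp_all
  \<comment> \<open>The contributions are recorded as natural numbers, so that a vanishing sum
    forces each single one to vanish.\<close>
  moreover define k where "k w = (if w = [] \<or> (even n \<and> w = odd_word n) then d * d' else 0)" for w
  have "(- 1) ^ length w * (mat_trace (1\<^sub>m d' * wmat d' W w) * mat_trace (wmat d V (rev w) * 1\<^sub>m d)) = of_nat (k w)"
    if "w \<in> set (subseqs [1..<n])" for w
  proof -
    have w: "set w \<subseteq> {1..<n}" "sorted_wrt (<) w"
      using sorted_wrt_subseqs[OF _ that, of "(<)"] by auto
    have [simp]: "1\<^sub>m d' * wmat d' W w = wmat d' W w" "wmat d V (rev w) * 1\<^sub>m d = wmat d V (rev w)"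
      using left_mult_one_mat[OF W.wmat_closed[OF w(1)]] right_mult_one_mat[OF V.wmat_closed[of "rev w"]] w(1)
      by simp_all
    consider "w = []" | "w \<noteq> []" "even n \<and> w = odd_word n"
      | "w \<noteq> []" "\<not> (even n \<and> w = odd_word n)" by blast
    then show ?thesis
    proof cases
      case 1
      then show ?thesis by (simp add: k_def mat_trace_one)
    next
      case 2
      then obtain c where c: "c \<noteq> 0" "wmat d V w = c \<cdot>\<^sub>m 1\<^sub>m d" "wmat d' W w = c \<cdot>\<^sub>m 1\<^sub>m d'"
        using ch by blast
      \<comment> \<open>The reversed word has trace (-1)^|w| d / c. The scalar c is kept as a factor
        and supplied by the trace c d' of the word in the other family.\<close>
      have r: "wmat d V (rev w) \<in> carrier_mat d d" using w(1) by simp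
      have "c \<cdot>\<^sub>m wmat d V (rev w) = (- 1) ^ length w \<cdot>\<^sub>m 1\<^sub>m d"
        using V.wmat_rev[OF w(1)] r
        by (simp add: c(2) smult_mult_right[OF r one_carrier_mat])
      then have "mat_trace (c \<cdot>\<^sub>m wmat d V (rev w)) = mat_trace ((- 1) ^ length w \<cdot>\<^sub>m (1\<^sub>m d :: complex mat))"
        by simp
      then have tr: "c * mat_trace (wmat d V (rev w)) = (- 1) ^ length w * of_nat d"
        by (simp add: mat_trace_smult[OF r] mat_trace_smult[OF one_carrier_mat] mat_trace_one)
      have "(- 1) ^ length w * (mat_trace (wmat d' W w) * mat_trace (wmat d V (rev w)))
          = (- 1) ^ length w * of_nat d' * (c * mat_trace (wmat d V (rev w)))"
        by (simp add: c(3) mat_trace_smult[OF one_carrier_mat] mat_trace_one)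
      also have "\<dots> = of_nat d * of_nat d'"
        unfolding tr by (simp add: power_mult_distrib[symmetric])
      finally have "(- 1) ^ length w * (mat_trace (wmat d' W w) * mat_trace (wmat d V (rev w)))
          = of_nat d * of_nat d'" .
      moreover have "k w = d * d'" using 2 by (simp add: k_def)
      ultimately show ?thesis by simp
    next
      case 3
      then obtain j where "j \<in> {1..<n}" "prod_list (map (nb_sign j) w) = - 1"
        using anticommuting_letter_or_odd_word[OF w(2,1)] by blast
      then have "mat_trace (wmat d' W w) = 0" using W.trace_zero w(1) by blast
      moreover have "k w = 0" using 3 unfolding k_def by auto
      ultimately show ?thesis by simp
    qed
  qed
  ultimately have "(\<Sum>w\<leftarrow>subseqs [1..<n]. of_nat (k w) :: complex) = 0"
    by (simp cong: map_cong)
  then have "(\<Sum>w\<leftarrow>subseqs [1..<n]. k w) = 0"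
    by (metis (no_types, lifting) of_nat_0_eq_iff of_nat_sum_list map_map comp_apply map_cong)
  moreover have "[] \<in> set (subseqs [1..<n])" by (rule Nil_in_subseqs)
  ultimately have "k [] = 0" by simp
  then show False using pos by (simp add: k_def)
qed

end

subsection \<open>Functionals on words\<close>

text \<open>The relations are imposed on complex-valued functions of words instead of matrices, so
  that linear combinations of traces of families of different dimensions can be treated as one
  object.\<close>

locale word_functional =
  fixes n :: nat and g :: "nat list \<Rightarrow> complex"
  assumes square: "set u \<subseteq> {1..<n} \<Longrightarrow> set w \<subseteq> {1..<n} \<Longrightarrow> i \<in> {1..<n}
      \<Longrightarrow> g (u @ i # i # w) = - g (u @ w)"
    and swap: "set u \<subseteq> {1..<n} \<Longrightarrow> set w \<subseteq> {1..<n} \<Longrightarrow> i \<in> {1..<n} \<Longrightarrow> j \<in> {1..<n}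
      \<Longrightarrow> g (u @ i # j # w) = nb_sign i j * g (u @ j # i # w)"
begin

text \<open>This is the step of insertion sort, where equal letters annihilate with a sign. The
  scalar is independent of the left context \<open>u\<close>, which lets the step be applied behind
  further letters.\<close>

lemma insert_sorted:
  assumes "sorted_wrt (<) w" "set w \<subseteq> {1..<n}" "i \<in> {1..<n}"
  shows "\<exists>w' s. sorted_wrt (<) w' \<and> set w' \<subseteq> insert i (set w)
    \<and> (\<forall>u. set u \<subseteq> {1..<n} \<longrightarrow> g (u @ i # w) = s * g (u @ w'))"
  using assms
proof (induction w)
  case Nil
  show ?case by (intro exI[of _ "[i]"] exI[of _ 1]) simp
next
  case (Cons j w)
  consider "i < j" | "i = j" | "j < i" by linarith
  then show ?case
  proof cases
    case 1
    then show ?thesis using Cons.prems by (intro exI[of _ "i # j # w"] exI[of _ 1]) auto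
  next
    case 2
    then show ?thesis using Cons.prems square
      by (intro exI[of _ w] exI[of _ "- 1"]) auto
  next
    case 3
    from Cons obtain w' s where w': "sorted_wrt (<) w'" "set w' \<subseteq> insert i (set w)"
      "\<And>u. set u \<subseteq> {1..<n} \<Longrightarrow> g (u @ i # w) = s * g (u @ w')"
      by auto
    have "g (u @ i # j # w) = (nb_sign i j * s) * g (u @ j # w')" if "set u \<subseteq> {1..<n}" for u
      using swap[OF that, of w i j] w'(3)[of "u @ [j]"] that Cons.prems by simp
    moreover have "sorted_wrt (<) (j # w')" using w'(1,2) Cons.prems(1) 3 by auto
    moreover have "set (j # w') \<subseteq> insert i (set (j # w))" using w'(2) by auto
    ultimately show ?thesis by blast
  qed
qed

lemma sort_word:
  assumes "set w \<subseteq> {1..<n}"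
  shows "\<exists>w' s. sorted_wrt (<) w' \<and> set w' \<subseteq> {1..<n}
    \<and> (\<forall>u. set u \<subseteq> {1..<n} \<longrightarrow> g (u @ w) = s * g (u @ w'))"
  using assms
proof (induction w)
  case Nil
  show ?case by (intro exI[of _ "[]"] exI[of _ 1]) simp
next
  case (Cons i w)
  then obtain w' s where w': "sorted_wrt (<) w'" "set w' \<subseteq> {1..<n}"
      "\<And>u. set u \<subseteq> {1..<n} \<Longrightarrow> g (u @ w) = s * g (u @ w')"
    by auto
  have i: "i \<in> {1..<n}" using Cons.prems by simp
  from insert_sorted[OF w'(1,2) i] obtain w'' t where w'': "sorted_wrt (<) w''" "set w'' \<subseteq> insert i (set w')"
      "\<And>u. set u \<subseteq> {1..<n} \<Longrightarrow> g (u @ i # w') = t * g (u @ w'')"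
    by blast
  have "g (u @ i # w) = (s * t) * g (u @ w'')" if "set u \<subseteq> {1..<n}" for u
    using w'(3)[of "u @ [i]"] w''(3)[OF that] that i by simp
  then show ?case using w''(1,2) w'(2) i by (intro exI[of _ w''] exI[of _ "s * t"]) auto
qed

text \<open>Applied to the difference of two functionals, this compares them on increasing words
  only; the scalar produced by sorting is common to both and never has to be computed.\<close>

lemma vanishes:
  assumes "\<And>w. sorted_wrt (<) w \<Longrightarrow> set w \<subseteq> {1..<n} \<Longrightarrow> g w = 0" "set w \<subseteq> {1..<n}"
  shows "g w = 0"
proof -
  obtain w' s where "sorted_wrt (<) w'" "set w' \<subseteq> {1..<n}"
      "\<forall>u. set u \<subseteq> {1..<n} \<longrightarrow> g (u @ w) = s * g (u @ w')"
    using sort_word[OF assms(2)] by blast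
  then show ?thesis using assms(1)[of w'] by (metis append_Nil empty_set empty_subsetI mult_zero_right)
qed

end

lemma (in nb_clifford) word_functional_trace: "word_functional n (\<lambda>w. mat_trace (wmat d M w))"
proof
  fix u w i assume u: "set u \<subseteq> {1..<n}" and w: "set w \<subseteq> {1..<n}" and i: "i \<in> {1..<n}"
  have car: "wmat d M u \<in> carrier_mat d d" "wmat d M w \<in> carrier_mat d d" "M i \<in> carrier_mat d d"
    using u w i closed by simp_all
  have "M i * (M i * wmat d M w) = (- 1) \<cdot>\<^sub>m wmat d M w"
    using car left_mult_one_mat[OF car(2)]
    by (simp add: assoc_mult_mat[OF car(3,3,2), symmetric] square[OF i] smult_mult_left[OF one_carrier_mat car(2)])
  then have "wmat d M (u @ i # i # w) = (- 1) \<cdot>\<^sub>m wmat d M (u @ w)"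
    using u w i by (simp add: wmat_append smult_mult_right[OF car(1,2)])
  moreover have "wmat d M (u @ w) \<in> carrier_mat d d" using u w by simp
  ultimately show "mat_trace (wmat d M (u @ i # i # w)) = - mat_trace (wmat d M (u @ w))"
    by (simp add: mat_trace_smult)
  fix j assume j: "j \<in> {1..<n}"
  have carj: "M j \<in> carrier_mat d d" using j closed by simp
  have "M i * (M j * wmat d M w) = nb_sign i j \<cdot>\<^sub>m (M j * (M i * wmat d M w))"
    using car carj assoc_mult_mat[OF carj car(3,2)]
    by (simp add: assoc_mult_mat[OF car(3) carj car(2), symmetric] commute[OF i j]
        smult_mult_left[OF mult_carrier_mat[OF carj car(3)] car(2)])
  then have "wmat d M (u @ i # j # w) = nb_sign i j \<cdot>\<^sub>m wmat d M (u @ j # i # w)"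
    using u w i j
    by (simp add: wmat_append smult_mult_right[OF car(1) mult_carrier_mat[OF carj mult_carrier_mat[OF car(3,2)]]])
  moreover have "wmat d M (u @ j # i # w) \<in> carrier_mat d d" using u w i j by (intro wmat_closed) simp
  ultimately show "mat_trace (wmat d M (u @ i # j # w)) = nb_sign i j * mat_trace (wmat d M (u @ j # i # w))"
    by (simp add: mat_trace_smult)
qed

subsection \<open>Monomial matrices\<close>

text \<open>The operator sending the basis vector e_x to s(x) e_f(x). Both concrete families below
  have this shape, so their relations become identities between functions on indices.\<close>

definition mono_mat :: "nat \<Rightarrow> (nat \<Rightarrow> nat) \<Rightarrow> (nat \<Rightarrow> complex) \<Rightarrow> complex mat" where
  "mono_mat d f s = mat d d (\<lambda>(i, j). if i = f j then s j else 0)"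

lemma mono_mat_closed [simp]: "mono_mat d f s \<in> carrier_mat d d"
  by (simp add: mono_mat_def)

lemma mono_mat_index: "i < d \<Longrightarrow> j < d \<Longrightarrow> mono_mat d f s $$ (i, j) = (if i = f j then s j else 0)"
  by (simp add: mono_mat_def)

lemma mono_mat_cong:
  "(\<And>x. x < d \<Longrightarrow> f x = g x \<and> s x = t x) \<Longrightarrow> mono_mat d f s = mono_mat d g t"
  by (rule eq_matI) (auto simp: mono_mat_def)

lemma mono_mat_mult:
  assumes "\<And>x. x < d \<Longrightarrow> g x < d"
  shows "mono_mat d f s * mono_mat d g t = mono_mat d (\<lambda>x. f (g x)) (\<lambda>x. s (g x) * t x)"
proof (rule eq_matI)
  fix i j
  assume "i < dim_row (mono_mat d (\<lambda>x. f (g x)) (\<lambda>x. s (g x) * t x))"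
    and "j < dim_col (mono_mat d (\<lambda>x. f (g x)) (\<lambda>x. s (g x) * t x))"
  then have ij: "i < d" "j < d" by (simp_all add: mono_mat_def)
  have "(mono_mat d f s * mono_mat d g t) $$ (i, j)
      = (\<Sum>k<d. (if i = f k then s k else 0) * (if k = g j then t j else 0))"
    using ij by (simp add: mono_mat_def scalar_prod_def lessThan_atLeast0)
  also have "\<dots> = (\<Sum>k<d. if k = g j then (if i = f k then s k else 0) * t j else 0)"
    by (intro sum.cong) auto
  also have "\<dots> = (if i = f (g j) then s (g j) else 0) * t j"
    using assms[OF ij(2)] by simp
  finally show "(mono_mat d f s * mono_mat d g t) $$ (i, j)
      = mono_mat d (\<lambda>x. f (g x)) (\<lambda>x. s (g x) * t x) $$ (i, j)"
    using ij by (simp add: mono_mat_index)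
qed (simp_all add: mono_mat_def)

lemma mono_mat_smult: "c \<cdot>\<^sub>m mono_mat d f s = mono_mat d f (\<lambda>x. c * s x)"
  by (rule eq_matI) (auto simp: mono_mat_def)

lemma mono_mat_one: "1\<^sub>m d = mono_mat d (\<lambda>x. x) (\<lambda>x. 1)"
  by (rule eq_matI) (auto simp: mono_mat_def)

lemma mono_mat_trace:
  "mat_trace (mono_mat d f s) = (\<Sum>x<d. if f x = x then s x else 0)"
  by (auto simp: mat_trace_def mono_mat_def intro!: sum.cong)

lemma mono_mat_unit_vec:
  assumes "x < d"
  shows "mono_mat d f s *\<^sub>v unit_vec d x = s x \<cdot>\<^sub>v unit_vec d (f x)"
proof -
  have "unit_vec d (f x) $ i = (if i = f x then 1 else 0 :: complex)" if "i < d" for i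
    using that by (simp add: unit_vec_def)
  then show ?thesis using assms by (intro eq_vecI) (auto simp: mono_mat_def)
qed

lemma mono_mat_id_vec:
  assumes "v \<in> carrier_vec d" "x < d"
  shows "(mono_mat d (\<lambda>x. x) s *\<^sub>v v) $ x = s x * v $ x"
  using assms by (simp add: mono_mat_def scalar_prod_def if_distrib[of "\<lambda>u. u * _"] cong: if_cong)

lemma nb_clifford_monoI:
  assumes f: "\<And>i x. i \<in> {1..<n} \<Longrightarrow> x < d \<Longrightarrow> f i x < d"
    and inv: "\<And>i x. i \<in> {1..<n} \<Longrightarrow> x < d \<Longrightarrow> f i (f i x) = x"
    and sq: "\<And>i x. i \<in> {1..<n} \<Longrightarrow> x < d \<Longrightarrow> s i (f i x) * s i x = - 1"
    and comm: "\<And>i j x. i \<in> {1..<n} \<Longrightarrow> j \<in> {1..<n} \<Longrightarrow> x < d \<Longrightarrow> f i (f j x) = f j (f i x)"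
    and sgn: "\<And>i j x. i \<in> {1..<n} \<Longrightarrow> j \<in> {1..<n} \<Longrightarrow> x < d
      \<Longrightarrow> s i (f j x) * s j x = nb_sign i j * (s j (f i x) * s i x)"
  shows "nb_clifford n d (\<lambda>i. mono_mat d (f i) (s i))"
proof
  fix i assume i: "i \<in> {1..<n}"
  show "mono_mat d (f i) (s i) \<in> carrier_mat d d" by simp
  show "mono_mat d (f i) (s i) * mono_mat d (f i) (s i) = (- 1) \<cdot>\<^sub>m 1\<^sub>m d"
    unfolding mono_mat_one mono_mat_smult using i f inv sq
    by (subst mono_mat_mult) (auto intro!: mono_mat_cong)
  fix j assume j: "j \<in> {1..<n}"
  show "mono_mat d (f i) (s i) * mono_mat d (f j) (s j)
      = nb_sign i j \<cdot>\<^sub>m (mono_mat d (f j) (s j) * mono_mat d (f i) (s i))"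
    using f[OF i] f[OF j] comm[OF i j] sgn[OF i j]
    by (simp add: mono_mat_mult mono_mat_smult, intro mono_mat_cong) auto
qed

subsection \<open>An irreducible family on bit strings\<close>

lemma nat_less_power_iff_bit: "(x :: nat) < 2 ^ m \<longleftrightarrow> (\<forall>l\<ge>m. \<not> bit x l)"
proof
  assume "x < 2 ^ m"
  then have "take_bit m x = x" by (simp add: take_bit_nat_eq_self)
  then show "\<forall>l\<ge>m. \<not> bit x l" by (metis bit_take_bit_iff leD)
next
  assume *: "\<forall>l\<ge>m. \<not> bit x l"
  have "take_bit m x = x"
    by (rule bit_eqI) (use * in \<open>auto simp: bit_take_bit_iff not_le[symmetric]\<close>)
  then show "x < 2 ^ m" by (metis take_bit_nat_less_exp)
qed

lemma flip_bit_less: "k < m \<Longrightarrow> (x :: nat) < 2 ^ m \<Longrightarrow> flip_bit k x < 2 ^ m"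
  by (auto simp: nat_less_power_iff_bit bit_flip_bit_iff)

lemma bit_flip_bit_nat: "bit (flip_bit k (x :: nat)) l \<longleftrightarrow> (if l = k then \<not> bit x l else bit x l)"
  by (auto simp: bit_flip_bit_iff)

lemma flip_bit_flip_bit: "flip_bit k (flip_bit k (x :: nat)) = x"
  by (rule bit_eqI) (simp add: bit_flip_bit_nat)

lemma flip_bit_commute: "flip_bit k (flip_bit l (x :: nat)) = flip_bit l (flip_bit k x)"
  by (rule bit_eqI) (simp add: bit_flip_bit_nat)

definition bit_sign :: "nat \<Rightarrow> nat \<Rightarrow> complex" where
  "bit_sign k x = (if bit x k then - 1 else 1)"

lemma bit_sign_flip: "bit_sign k (flip_bit l x) = (if k = l then - bit_sign k x else bit_sign k x)"
  by (simp add: bit_sign_def bit_flip_bit_nat)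

lemma bit_sign_square [simp]: "bit_sign k x * bit_sign k x = 1"
  by (simp add: bit_sign_def)

text \<open>In Pauli notation: generator \<open>2k + 2\<close> is \<open>\<i>X\<^sub>k\<close> and generator \<open>2k + 1\<close> is
  \<open>\<i>Z\<^sub>k\<^sub>-\<^sub>1Z\<^sub>k\<close>, with \<open>Z\<^sub>-\<^sub>1\<close> and \<open>Z\<^sub>m\<close> read as the identity.\<close>

definition std_perm :: "nat \<Rightarrow> nat \<Rightarrow> nat" where
  "std_perm j x = (if even j then flip_bit (j div 2 - 1) x else x)"

definition std_sign :: "nat \<Rightarrow> nat \<Rightarrow> nat \<Rightarrow> complex" where
  "std_sign m j x = (if even j then \<i> else
    \<i> * (if j = 1 then 1 else bit_sign (j div 2 - 1) x) * (if j div 2 < m then bit_sign (j div 2) x else 1))"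

definition std_gen :: "nat \<Rightarrow> nat \<Rightarrow> complex mat" where
  "std_gen m j = mono_mat (2 ^ m) (std_perm j) (std_sign m j)"

text \<open>An even letter 2 l + 2 flips bit l, which is read by exactly the odd letters 2 l + 1 and
  2 l + 3. The bound on \<open>i div 2\<close> gives l < m, so letter 2 l + 1 does carry the sign of
  bit l.\<close>

lemma std_sign_flip:
  assumes "odd j" "even i" "i \<ge> 1" "i div 2 \<le> m"
  shows "std_sign m j (flip_bit (i div 2 - 1) x) = nb_sign i j * std_sign m j x"
proof -
  obtain k where k: "j = 2 * k + 1" using assms(1) by (elim oddE)
  obtain l where l: "i = 2 * Suc l" using assms(2,3) by (metis evenE mult_is_0 not_one_le_zero old.nat.exhaust)
  have jd: "j div 2 = k" "i div 2 = Suc l" using k l by auto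
  have "nb_sign i j = (if k = l then - 1 else if k = Suc l then - 1 else 1)"
    unfolding k l nb_sign_def by auto
  moreover have "l < m" using assms(4) jd by simp
  moreover have "even j = False" "(j = 1) = (k = 0)" using k by auto
  ultimately show ?thesis
    unfolding std_sign_def jd by (cases k) (auto simp: bit_sign_flip)
qed

text \<open>Exactly (n - 1) div 2 letters below n are even, and each of them is given a bit of its
  own to flip.\<close>

lemma std_clifford:
  assumes "m = (n - 1) div 2"
  shows "nb_clifford n (2 ^ m) (std_gen m)"
  unfolding std_gen_def
proof (rule nb_clifford_monoI)
  fix i x assume i: "i \<in> {1..<n}" and x: "x < (2 :: nat) ^ m"
  have im: "i div 2 - 1 < m" if "even i" using that i assms by (auto elim!: evenE)
  show "std_perm i x < 2 ^ m" using x im by (auto simp: std_perm_def flip_bit_less)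
  show "std_perm i (std_perm i x) = x" by (simp add: std_perm_def flip_bit_flip_bit)
  have "(\<i> * a * b) * (\<i> * a * b) = - ((a * a) * (b * b))" "(\<i> * a) * (\<i> * a) = - (a * a)" for a b
    by (simp_all add: algebra_simps)
  then show "std_sign m i (std_perm i x) * std_sign m i x = - 1"
    by (auto simp: std_sign_def std_perm_def)
  fix j assume j: "j \<in> {1..<n}"
  show "std_perm i (std_perm j x) = std_perm j (std_perm i x)"
    by (simp add: std_perm_def flip_bit_commute)
  have par: "nb_sign a b = 1" if "even a \<longleftrightarrow> even b" for a b
    using that by (auto simp: nb_sign_def)
  have half: "even a \<Longrightarrow> a div 2 \<le> m" if "a \<in> {1..<n}" for a using that assms by auto
  consider "even i \<longleftrightarrow> even j" | "even i" "odd j" | "odd i" "even j" by blast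
  then show "std_sign m i (std_perm j x) * std_sign m j x
      = nb_sign i j * (std_sign m j (std_perm i x) * std_sign m i x)"
  proof cases
    case 1
    then show ?thesis using par[OF 1] by (cases "even i") (simp_all add: std_perm_def std_sign_def)
  next
    case 2
    have "std_sign m j (std_perm i x) = nb_sign i j * std_sign m j x"
      using std_sign_flip[of j i m x] 2 i half[OF i] by (simp add: std_perm_def)
    moreover have "std_sign m i y = \<i>" for y using 2 by (simp add: std_sign_def)
    ultimately show ?thesis by (simp add: mult.assoc[symmetric])
  next
    case 3
    have "std_sign m i (std_perm j x) = nb_sign i j * std_sign m i x"
      using std_sign_flip[of i j m x] 3 j half[OF j] by (simp add: std_perm_def nb_sign_commute)
    moreover have "std_sign m j y = \<i>" for y using 3 by (simp add: std_sign_def)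
    ultimately show ?thesis by simp
  qed
qed

lemma subspace_vec_all_units:
  assumes W: "subspace_vec d W" and e: "\<And>x. x < d \<Longrightarrow> unit_vec d x \<in> W"
  shows "W = carrier_vec d"
proof -
  have "v \<in> W" if "v \<in> carrier_vec d" "\<And>x. k \<le> x \<Longrightarrow> x < d \<Longrightarrow> v $ x = 0" "k \<le> d" for k v
    using that
  proof (induction k arbitrary: v)
    case 0
    then have "v = 0\<^sub>v d" by (intro eq_vecI) auto
    then show ?case using subspace_vecD(2)[OF W] by simp
  next
    case (Suc k)
    let ?u = "vec d (\<lambda>x. if x = k then 0 else v $ x)"
    have "?u \<in> W" by (rule Suc.IH) (use Suc.prems in auto)
    moreover have "v $ k \<cdot>\<^sub>v unit_vec d k \<in> W"
      using subspace_vecD(4)[OF W e] Suc.prems by simp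
    moreover have "v = ?u + v $ k \<cdot>\<^sub>v unit_vec d k"
      using Suc.prems by (intro eq_vecI) auto
    ultimately show ?case using subspace_vecD(3)[OF W] by metis
  qed
  from this[of _ d] have "carrier_vec d \<subseteq> W" by auto
  then show ?thesis using subspace_vecD(1)[OF W] by blast
qed

text \<open>Letter 2 k + 1 multiplies the signs of the bits k - 1 and k. At the least position where
  x and y differ, bit k - 1 still agrees while bit k does not.\<close>

lemma std_sign_separates:
  assumes "x < 2 ^ m" "y < 2 ^ m" "x \<noteq> y"
  obtains k where "k < m" "std_sign m (2 * k + 1) x \<noteq> std_sign m (2 * k + 1) y"
proof -
  define k where "k = (LEAST l. bit x l \<noteq> bit y l)"
  have "\<exists>l. bit x l \<noteq> bit y l" using assms(3) bit_eqI by blast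
  then have k: "bit x k \<noteq> bit y k" unfolding k_def by (rule LeastI_ex)
  have less: "bit x l = bit y l" if "l < k" for l
    using not_less_Least[OF that[unfolded k_def]] by simp
  have km: "k < m" using k assms(1,2) by (metis nat_less_power_iff_bit not_le)
  have "(2 * k + 1) div 2 = k" by simp
  then have "std_sign m (2 * k + 1) x \<noteq> std_sign m (2 * k + 1) y"
    using k km less[of "k - 1"] by (cases "k = 0") (auto simp: std_sign_def bit_sign_def)
  then show ?thesis using km that by blast
qed

text \<open>The odd letters act diagonally and separate the basis vectors, so a nonzero vector of
  minimal support in an invariant subspace is a multiple of a basis vector. The even letters flip
  single bits and carry it to all the others.\<close>

lemma std_irr:
  assumes m: "m = (n - 1) div 2"
  shows "irr_family {1..<n} (2 ^ m) (std_gen m)"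
  unfolding irr_family_def
proof (intro conjI allI impI)
  show "0 < (2 :: nat) ^ m" by simp
  fix W assume "subspace_vec (2 ^ m) W \<and> (\<forall>i\<in>{1..<n}. \<forall>w\<in>W. std_gen m i *\<^sub>v w \<in> W)"
  then have W: "subspace_vec (2 ^ m) W" and inv: "\<And>i w. i \<in> {1..<n} \<Longrightarrow> w \<in> W \<Longrightarrow> std_gen m i *\<^sub>v w \<in> W"
    by auto
  show "W = {0\<^sub>v (2 ^ m)} \<or> W = carrier_vec (2 ^ m)"
  proof (cases "W = {0\<^sub>v (2 ^ m)}")
    case False
    define supp where "supp v = {x. x < 2 ^ m \<and> v $ x \<noteq> 0}" for v :: "complex vec"
    have fin: "finite (supp v)" for v by (simp add: supp_def)
    obtain v0 where "v0 \<in> W" "v0 \<noteq> 0\<^sub>v (2 ^ m)" using False subspace_vecD(2)[OF W] by auto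
    then obtain v where v: "v \<in> W" "v \<noteq> 0\<^sub>v (2 ^ m)"
      and least: "\<And>u. u \<in> W \<Longrightarrow> u \<noteq> 0\<^sub>v (2 ^ m) \<Longrightarrow> card (supp v) \<le> card (supp u)"
      using ex_has_least_nat[of "\<lambda>v. v \<in> W \<and> v \<noteq> 0\<^sub>v (2 ^ m)" v0 "\<lambda>v. card (supp v)"] by auto
    have vc: "v \<in> carrier_vec (2 ^ m)" using v subspace_vecD(1)[OF W] by auto
    have "supp v \<noteq> {}"
    proof
      assume "supp v = {}"
      then have "v = 0\<^sub>v (2 ^ m)" using vc by (intro eq_vecI) (auto simp: supp_def)
      then show False using v(2) by simp
    qed
    then obtain x where x: "x \<in> supp v" by blast
    have uniq: "y = x" if y: "y \<in> supp v" for y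
    proof (rule ccontr)
      assume "y \<noteq> x"
      then obtain k where k: "k < m" "std_sign m (2 * k + 1) y \<noteq> std_sign m (2 * k + 1) x"
        using std_sign_separates[of y m x] x y unfolding supp_def by auto
      let ?s = "std_sign m (2 * k + 1)"
      \<comment> \<open>Subtracting the eigenvalue at x removes the coordinate x but keeps the
        coordinate y, contradicting minimality of the support.\<close>
      let ?u = "std_gen m (2 * k + 1) *\<^sub>v v + (- ?s x) \<cdot>\<^sub>v v"
      have gen: "2 * k + 1 \<in> {1..<n}" using k(1) m by auto
      have u: "?u \<in> W" using inv[OF gen v(1)] subspace_vecD(3,4)[OF W] v(1) by blast
      have "std_gen m (2 * k + 1) = mono_mat (2 ^ m) (\<lambda>x. x) ?s"
        unfolding std_gen_def by (rule mono_mat_cong) (simp add: std_perm_def)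
      then have ui: "?u $ z = (?s z - ?s x) * v $ z" if "z < 2 ^ m" for z
        using that vc by (simp add: mono_mat_id_vec algebra_simps)
      have "supp ?u \<subseteq> supp v - {x}" unfolding supp_def using ui by auto
      then have "card (supp ?u) < card (supp v)"
        using x fin by (meson card_Diff1_less card_mono finite_Diff le_less_trans)
      moreover have "?u \<noteq> 0\<^sub>v (2 ^ m)" using ui[of y] k(2) y unfolding supp_def by auto
      ultimately show False using least[OF u] by simp
    qed
    have v0: "v $ y = 0" if "y < 2 ^ m" "y \<noteq> x" for y
      using uniq[of y] that unfolding supp_def by blast
    have "(inverse (v $ x)) \<cdot>\<^sub>v v = unit_vec (2 ^ m) x"
      using vc x by (intro eq_vecI) (auto simp: supp_def unit_vec_def v0)
    then have ex: "unit_vec (2 ^ m) x \<in> W" using subspace_vecD(4)[OF W v(1)] by metis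
    have flip: "unit_vec (2 ^ m) (flip_bit k z) \<in> W"
      if "unit_vec (2 ^ m) z \<in> W" "z < 2 ^ m" "k < m" for k z
    proof -
      have gen: "2 * k + 2 \<in> {1..<n}" using that(3) m by auto
      have "\<i> \<cdot>\<^sub>v unit_vec (2 ^ m) (flip_bit k z) \<in> W"
        using inv[OF gen that(1)] that(2) by (simp add: std_gen_def mono_mat_unit_vec std_perm_def std_sign_def)
      then have "(- \<i>) \<cdot>\<^sub>v (\<i> \<cdot>\<^sub>v unit_vec (2 ^ m) (flip_bit k z)) \<in> W" using subspace_vecD(4)[OF W] by blast
      then show ?thesis by (simp add: smult_smult_assoc)
    qed
    have "unit_vec (2 ^ m) y \<in> W" if y: "y < 2 ^ m" for y
    proof -
      \<comment> \<open>The bits of the reached index are corrected one at a time from below until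
        it agrees with y.\<close>
      have "\<exists>z < 2 ^ m. unit_vec (2 ^ m) z \<in> W \<and> (\<forall>l<k. bit z l = bit y l)" if "k \<le> m" for k
        using that
      proof (induction k)
        case 0
        then show ?case using ex x unfolding supp_def by auto
      next
        case (Suc k)
        then obtain z where z: "z < 2 ^ m" "unit_vec (2 ^ m) z \<in> W" "\<And>l. l < k \<Longrightarrow> bit z l = bit y l"
          by auto
        show ?case
        proof (cases "bit z k = bit y k")
          case True
          then show ?thesis using z by (intro exI[of _ z]) (auto simp: less_Suc_eq)
        next
          case False
          then show ?thesis using z flip[OF z(2,1), of k] Suc.prems
            by (intro exI[of _ "flip_bit k z"]) (auto simp: less_Suc_eq bit_flip_bit_nat flip_bit_less)
        qed
      qed
      from this[of m] obtain z where z: "z < 2 ^ m" "unit_vec (2 ^ m) z \<in> W" "\<And>l. l < m \<Longrightarrow> bit z l = bit y l"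
        by auto
      have "z = y"
      proof (rule bit_eqI)
        fix l show "bit z l \<longleftrightarrow> bit y l"
          using z(1,3) y unfolding nat_less_power_iff_bit by (cases "l < m") auto
      qed
      then show ?thesis using z(2) by simp
    qed
    then show ?thesis using subspace_vec_all_units[OF W] by blast
  qed simp
qed

subsection \<open>Braid representations from anticommuting families\<close>

abbreviation braid_class :: "nat \<Rightarrow> nat gword \<Rightarrow> nat gword set" where
  "braid_class n w \<equiv> pres_rel {1..<n} (braid_relations n) `` {w}"

lemma group_braid_group: "group (braid_group n)"
  by (simp add: braid_group_def group_presented_group)

lemma braid_class_closed: "w \<in> gwords {1..<n} \<Longrightarrow> braid_class n w \<in> carrier (braid_group n)"
  by (simp add: braid_group_def)

lemma braid_carrierE:
  assumes "\<sigma> \<in> carrier (braid_group n)"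
  obtains w where "w \<in> gwords {1..<n}" "\<sigma> = braid_class n w"
  using assms unfolding braid_group_def by (rule presented_group_carrierE)

lemma braid_class_mult:
  "u \<in> gwords {1..<n} \<Longrightarrow> v \<in> gwords {1..<n}
    \<Longrightarrow> braid_class n u \<otimes>\<^bsub>braid_group n\<^esub> braid_class n v = braid_class n (u @ v)"
  by (simp add: braid_group_def pres_mult_class)

lemma braid_one: "\<one>\<^bsub>braid_group n\<^esub> = braid_class n []"
  by (simp add: braid_group_def pres_one)

lemma braid_gen_class: "braid_gen n i = braid_class n [(i, True)]"
  by (simp add: braid_gen_def pres_gen_def)

lemma braid_gen_closed: "i \<in> {1..<n} \<Longrightarrow> braid_gen n i \<in> carrier (braid_group n)"
  unfolding braid_gen_class by (rule braid_class_closed) auto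

lemma braid_class_cancel:
  assumes "x \<in> {1..<n}"
  shows "braid_class n [(x, True), (x, False)] = braid_class n []"
proof (rule equiv_class_eq[OF equiv_pres_rel])
  show "([(x, True), (x, False)], []) \<in> pres_rel {1..<n} (braid_relations n)"
    using pres_eq.cancel[of "[]" "{1..<n}" "[]" x "braid_relations n" True] assms
    by (simp add: pres_rel_def)
qed

lemma braid_gen_far_commute:
  assumes "i \<in> {1..<n}" "j \<in> {1..<n}" "\<bar>int i - int j\<bar> \<ge> 2"
  shows "braid_gen n i \<otimes>\<^bsub>braid_group n\<^esub> braid_gen n j = braid_gen n j \<otimes>\<^bsub>braid_group n\<^esub> braid_gen n i"
proof -
  have "([(i, True), (j, True)], [(j, True), (i, True)]) \<in> braid_relations n"
    using assms unfolding braid_relations_def by blast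
  then have "pres_eq {1..<n} (braid_relations n) [(i, True), (j, True)] [(j, True), (i, True)]"
    using pres_eq.rel[of "[(i, True), (j, True)]" "[(j, True), (i, True)]" "braid_relations n" "{1..<n}" "[]" "[]"]
      assms by simp
  then have "braid_class n [(i, True), (j, True)] = braid_class n [(j, True), (i, True)]"
    by (intro equiv_class_eq[OF equiv_pres_rel]) (simp add: pres_rel_def)
  then show ?thesis using assms by (simp add: braid_gen_class braid_class_mult)
qed

section \<open>Matrices of the form c (1 + M) and braid words in them\<close>

lemma lin_mult:
  fixes S T :: "complex mat"
  assumes "S \<in> carrier_mat d d" "T \<in> carrier_mat d d"
  shows "(a \<cdot>\<^sub>m S + b \<cdot>\<^sub>m 1\<^sub>m d) * (a' \<cdot>\<^sub>m T + b' \<cdot>\<^sub>m 1\<^sub>m d)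
    = (a * a') \<cdot>\<^sub>m (S * T) + (a * b') \<cdot>\<^sub>m S + (b * a') \<cdot>\<^sub>m T + (b * b') \<cdot>\<^sub>m 1\<^sub>m d"
proof -
  have "(a \<cdot>\<^sub>m S + b \<cdot>\<^sub>m 1\<^sub>m d) * (a' \<cdot>\<^sub>m T + b' \<cdot>\<^sub>m 1\<^sub>m d)
      = ((a * a') \<cdot>\<^sub>m (S * T) + (b * a') \<cdot>\<^sub>m T) + ((a * b') \<cdot>\<^sub>m S + (b * b') \<cdot>\<^sub>m 1\<^sub>m d)"
    using assms
    by (simp add: mult_add_distrib_mat[of _ d d _ d] add_mult_distrib_mat[of _ d d _ _ d]
        smult_mult_left[of _ d d _ d] smult_mult_right[of _ d d _ d] smult_smult_mat mult.commute
        add_smult_distrib_left_mat[of _ d d]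
        left_mult_one_mat[of _ d d] right_mult_one_mat[of _ d d])
  then show ?thesis
    using assms by (auto intro!: eq_matI simp del: index_mult_mat(1))
qed

text \<open>As (1 + M) (1 - M) = 2, the inverse of c (1 + M) is (1 - M) / (2 c). With these scalars
  split off, the remaining product of factors 1 + M and 1 - M does not involve c, so the two sides
  of the main identity differ in scale only.\<close>

definition letter_scale :: "complex \<Rightarrow> 'a gword \<Rightarrow> complex" where
  "letter_scale c w = (\<Prod>(x, b)\<leftarrow>w. if b then c else 1 / (2 * c))"

fun sgn_mat :: "nat \<Rightarrow> (nat \<Rightarrow> complex mat) \<Rightarrow> nat gword \<Rightarrow> complex mat" where
  "sgn_mat d M [] = 1\<^sub>m d"
| "sgn_mat d M ((x, b) # w) = ((if b then 1 else - 1) \<cdot>\<^sub>m M x + 1 \<cdot>\<^sub>m 1\<^sub>m d) * sgn_mat d M w"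

definition half_gen :: "nat \<Rightarrow> complex \<Rightarrow> complex mat \<Rightarrow> complex mat" where
  "half_gen d c A = c \<cdot>\<^sub>m A + c \<cdot>\<^sub>m 1\<^sub>m d"

lemma half_gen_closed: "A \<in> carrier_mat d d \<Longrightarrow> half_gen d c A \<in> carrier_mat d d"
  by (simp add: half_gen_def)

context nb_clifford
begin

lemma sgn_mat_closed: "w \<in> gwords {1..<n} \<Longrightarrow> sgn_mat d M w \<in> carrier_mat d d"
proof (induction w)
  case (Cons a w)
  then show ?case using closed by (cases a) (auto intro!: mult_carrier_mat add_carrier_mat)
qed simp

lemma half_gen_inverse:
  assumes "i \<in> {1..<n}" "c \<noteq> 0"
  shows "half_gen d c (M i) * ((1 / (2 * c)) \<cdot>\<^sub>m ((- 1) \<cdot>\<^sub>m M i + 1 \<cdot>\<^sub>m 1\<^sub>m d)) = 1\<^sub>m d"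
    and "((1 / (2 * c)) \<cdot>\<^sub>m ((- 1) \<cdot>\<^sub>m M i + 1 \<cdot>\<^sub>m 1\<^sub>m d)) * half_gen d c (M i) = 1\<^sub>m d"
proof -
  have M: "M i \<in> carrier_mat d d" by (rule closed[OF assms(1)])
  have e: "(1 / (2 * c)) \<cdot>\<^sub>m ((- 1) \<cdot>\<^sub>m M i + 1 \<cdot>\<^sub>m 1\<^sub>m d)
      = (- (1 / (2 * c))) \<cdot>\<^sub>m M i + (1 / (2 * c)) \<cdot>\<^sub>m 1\<^sub>m d"
    using M by (intro eq_matI) (auto simp: algebra_simps)
  show "half_gen d c (M i) * ((1 / (2 * c)) \<cdot>\<^sub>m ((- 1) \<cdot>\<^sub>m M i + 1 \<cdot>\<^sub>m 1\<^sub>m d)) = 1\<^sub>m d"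
    unfolding e half_gen_def lin_mult[OF M M] square[OF assms(1)] using M assms(2)
    by (intro eq_matI) (auto simp: field_simps)
  show "((1 / (2 * c)) \<cdot>\<^sub>m ((- 1) \<cdot>\<^sub>m M i + 1 \<cdot>\<^sub>m 1\<^sub>m d)) * half_gen d c (M i) = 1\<^sub>m d"
    unfolding e half_gen_def lin_mult[OF M M] square[OF assms(1)] using M assms(2)
    by (intro eq_matI) (auto simp: field_simps)
qed

lemma half_gen_commute:
  assumes "i \<in> {1..<n}" "j \<in> {1..<n}" "nb_sign i j = 1"
  shows "half_gen d c (M i) * half_gen d c (M j) = half_gen d c (M j) * half_gen d c (M i)"
proof -
  have M: "M i \<in> carrier_mat d d" "M j \<in> carrier_mat d d" using closed assms by auto
  have "M i * M j = M j * M i" using commute[OF assms(1,2)] assms(3) by (simp add: one_smult_mat)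
  then show ?thesis
    unfolding half_gen_def lin_mult[OF M] lin_mult[OF M(2,1)] using M
    by (intro eq_matI) (auto simp del: index_mult_mat(1))
qed

text \<open>For anticommuting M and N with squares -1 one has M N M = N, and (1 + M) (1 + N) (1 + M)
  collapses to 2 (M + N). The symmetry of this value is the braid relation, and the cubic relator
  reuses it.\<close>

lemma half_gen_triple:
  assumes "i \<in> {1..<n}" "j \<in> {1..<n}" "nb_sign i j = - 1"
  shows "half_gen d c (M i) * half_gen d c (M j) * half_gen d c (M i) = (2 * c ^ 3) \<cdot>\<^sub>m (M i + M j)"
proof -
  have M: "M i \<in> carrier_mat d d" "M j \<in> carrier_mat d d" using closed assms by auto
  have ji: "M j * M i = (- 1) \<cdot>\<^sub>m (M i * M j)"
    using commute[OF assms(2,1)] assms(3) by (simp add: nb_sign_commute)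
  have iji: "(M i * M j) * M i = M j"
    using M by (simp add: assoc_mult_mat[OF M(1,2,1)] ji smult_mult_right[of _ d d _ d]
        assoc_mult_mat[OF M(1,1,2), symmetric] square[OF assms(1)] smult_mult_left[of _ d d _ d]
        smult_smult_mat one_smult_mat left_mult_one_mat[OF M(2)])
  let ?P = "c \<cdot>\<^sub>m (M i * M j) + (c \<cdot>\<^sub>m M i + c \<cdot>\<^sub>m M j)"
  have "half_gen d c (M i) * half_gen d c (M j) = c \<cdot>\<^sub>m ?P + (c * c) \<cdot>\<^sub>m 1\<^sub>m d"
    unfolding half_gen_def lin_mult[OF M] using M
    by (intro eq_matI) (auto simp: algebra_simps simp del: index_mult_mat(1))
  moreover have P: "?P \<in> carrier_mat d d" using M by simp
  moreover have "?P * M i = c \<cdot>\<^sub>m M j + ((- c) \<cdot>\<^sub>m 1\<^sub>m d + (- c) \<cdot>\<^sub>m (M i * M j))"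
    using M by (simp add: add_mult_distrib_mat[of _ d d _ _ d] smult_mult_left[of _ d d _ d] iji
        square[OF assms(1)] ji smult_smult_mat del: assoc_mult_mat)
  ultimately show ?thesis
    unfolding half_gen_def using M
    by (simp only: lin_mult[OF P M(1)])
      (auto intro!: eq_matI simp: algebra_simps power3_eq_cube simp del: index_mult_mat(1))
qed

lemma half_gen_braid:
  assumes "i \<in> {1..<n}" "j \<in> {1..<n}" "nb_sign i j = - 1"
  shows "half_gen d c (M i) * half_gen d c (M j) * half_gen d c (M i)
    = half_gen d c (M j) * half_gen d c (M i) * half_gen d c (M j)"
  using half_gen_triple[OF assms] half_gen_triple[OF assms(2,1)] assms closed[OF assms(1)] closed[OF assms(2)]
  by (simp add: nb_sign_commute comm_add_mat[of "M i" d d])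

text \<open>Stated for any multiplicative map \<open>h\<close> on the braid group with these values
  on generators, so that it covers the Yang-Baxter representation as well as every representation of
  the algebra.\<close>

lemma word_expansion:
  assumes c: "c \<noteq> 0"
    and h: "\<And>x. x \<in> carrier (braid_group n) \<Longrightarrow> h x \<in> carrier_mat d d"
    and h_mult: "\<And>x y. x \<in> carrier (braid_group n) \<Longrightarrow> y \<in> carrier (braid_group n)
      \<Longrightarrow> h (x \<otimes>\<^bsub>braid_group n\<^esub> y) = h x * h y"
    and h_one: "h \<one>\<^bsub>braid_group n\<^esub> = 1\<^sub>m d"
    and h_gen: "\<And>i. i \<in> {1..<n} \<Longrightarrow> h (braid_gen n i) = half_gen d c (M i)"
    and w: "w \<in> gwords {1..<n}"
  shows "h (braid_class n w) = letter_scale c w \<cdot>\<^sub>m sgn_mat d M w"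
  using w
proof (induction w rule: list.induct)
  case Nil
  then show ?case using h_one by (simp add: braid_one letter_scale_def one_smult_mat)
next
  case (Cons a w)
  obtain x b where a: "a = (x, b)" by force
  have x: "x \<in> {1..<n}" and w: "w \<in> gwords {1..<n}" using Cons.prems a by auto
  have M: "M x \<in> carrier_mat d d" by (rule closed[OF x])
  let ?s = "if b then c else 1 / (2 * c)"
  let ?L = "(if b then 1 else - 1) \<cdot>\<^sub>m M x + 1 \<cdot>\<^sub>m 1\<^sub>m d"
  have xw: "[(x, b)] \<in> gwords {1..<n}" for b using x by auto
  have "h (braid_class n [(x, b)]) = ?s \<cdot>\<^sub>m ?L"
  proof (cases b)
    case True
    then show ?thesis using h_gen[OF x] M
      by (simp add: braid_gen_class half_gen_def) (auto intro!: eq_matI simp: algebra_simps)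
  next
    case False
    let ?X = "h (braid_class n [(x, False)])" and ?I = "(1 / (2 * c)) \<cdot>\<^sub>m ((- 1) \<cdot>\<^sub>m M x + 1 \<cdot>\<^sub>m 1\<^sub>m d)"
    have X: "?X \<in> carrier_mat d d" by (intro h braid_class_closed xw)
    have I: "?I \<in> carrier_mat d d" using M by simp
    have G: "half_gen d c (M x) \<in> carrier_mat d d" by (rule half_gen_closed[OF M])
    \<comment> \<open>The values of \<open>h\<close> are plain matrices, not elements of a group, so
      the image of an inverse letter is identified through the product 1 with the image of the
      generator.\<close>
    have "half_gen d c (M x) * ?X = h (braid_class n [(x, True), (x, False)])"
      unfolding h_gen[OF x, symmetric] braid_gen_class
      using h_mult[OF braid_class_closed[OF xw] braid_class_closed[OF xw], of True False]
      by (simp add: braid_class_mult[OF xw xw])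
    then have 1: "half_gen d c (M x) * ?X = 1\<^sub>m d"
      using braid_class_cancel[OF x] h_one by (simp add: braid_one)
    have "?X = (?I * half_gen d c (M x)) * ?X"
      unfolding half_gen_inverse(2)[OF x c] by (rule left_mult_one_mat[OF X, symmetric])
    also have "\<dots> = ?I * (half_gen d c (M x) * ?X)" by (rule assoc_mult_mat[OF I G X])
    also have "\<dots> = ?I" unfolding 1 by (rule right_mult_one_mat[OF I])
    finally show ?thesis using False by simp
  qed
  moreover have "h (braid_class n (a # w)) = h (braid_class n [(x, b)]) * h (braid_class n w)"
    using h_mult[OF braid_class_closed[OF xw] braid_class_closed[OF w], of b]
    by (simp add: braid_class_mult[OF xw w] a)
  moreover have "?L \<in> carrier_mat d d" using M by simp
  moreover note sgn_mat_closed[OF w] Cons.IH[OF w]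
  ultimately show ?case
    unfolding a by (simp add: letter_scale_def smult_mult_left[of _ d d _ d] smult_mult_right[of _ d d _ d]
      smult_smult_mat mult.commute)
qed

lemma GL_unit:
  assumes "i \<in> {1..<n}" "c \<noteq> 0"
  shows "half_gen d c (M i) \<in> carrier (GL d)"
proof -
  have "(1 / (2 * c)) \<cdot>\<^sub>m ((- 1) \<cdot>\<^sub>m M i + 1 \<cdot>\<^sub>m 1\<^sub>m d) \<in> carrier_mat d d"
    using closed[OF assms(1)] by simp
  then show ?thesis
    using half_gen_inverse[OF assms] half_gen_closed[OF closed[OF assms(1)]]
    unfolding GL_def units_of_def Units_def by (auto simp: ring_mat_simps)
qed

lemma GL_mult: "x \<otimes>\<^bsub>GL d\<^esub> y = x * y" and GL_one: "\<one>\<^bsub>GL d\<^esub> = 1\<^sub>m d"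
  and GL_closed: "x \<in> carrier (GL d) \<Longrightarrow> x \<in> carrier_mat d d"
  by (auto simp: GL_def units_of_def ring_mat_simps Units_def)

lemma group_GL: "group (GL d)"
proof -
  interpret R: ring "ring_mat TYPE(complex) d ()" by (rule ring_mat)
  show ?thesis unfolding GL_def by (rule R.units_group)
qed

text \<open>This is the universal property of the presentation. Only the values of \<open>S\<close>
  on the letters are prescribed, so that the tensor product matrices \<open>YB_gen\<close> can be
  inserted directly.\<close>

lemma braid_hom:
  assumes c: "c \<noteq> 0" and S: "\<And>i. i \<in> {1..<n} \<Longrightarrow> S i = half_gen d c (M i)"
  shows "pres_lift (GL d) S \<in> hom (braid_group n) (GL d)"
    and "i \<in> {1..<n} \<Longrightarrow> pres_lift (GL d) S (braid_gen n i) = half_gen d c (M i)"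
proof -
  interpret GL: group "GL d" by (rule group_GL)
  have f: "S \<in> {1..<n} \<rightarrow> carrier (GL d)" using S GL_unit c by auto
  have car: "half_gen d c (M i) \<in> carrier_mat d d" if "i \<in> {1..<n}" for i
    using half_gen_closed[OF closed[OF that]] .
  have rel: "word_eval (GL d) S r = word_eval (GL d) S s" if rs: "(r, s) \<in> braid_relations n" for r s
  proof -
    consider i j where "r = [(i, True), (j, True)]" "s = [(j, True), (i, True)]"
        "i \<in> {1..<n}" "j \<in> {1..<n}" "\<bar>int i - int j\<bar> \<ge> 2"
      | i where "r = [(i, True), (i + 1, True), (i, True)]" "s = [(i + 1, True), (i, True), (i + 1, True)]"
        "1 \<le> i" "i + 1 < n"
      using rs unfolding braid_relations_def by blast
    then show ?thesis
    proof cases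
      case 1
      then have "nb_sign i j = 1" by (auto simp: nb_sign_def)
      then show ?thesis using half_gen_commute[OF 1(3,4)] car[OF 1(3)] car[OF 1(4)] 1
        by (simp add: S GL_mult GL_one right_mult_one_mat[of _ d d])
    next
      case 2
      then have ij: "i \<in> {1..<n}" "i + 1 \<in> {1..<n}" by auto
      note car2 = car[OF ij(1)] car[OF ij(2)]
      have "nb_sign i (i + 1) = - 1" by (simp add: nb_sign_def)
      from half_gen_braid[OF ij this, of c] show ?thesis using car2 ij 2(1,2)
        unfolding assoc_mult_mat[OF car2(1,2,1)] assoc_mult_mat[OF car2(2,1,2)]
        by (simp add: S GL_mult GL_one right_mult_one_mat[of _ d d])
    qed
  qed
  show "pres_lift (GL d) S \<in> hom (braid_group n) (GL d)"
    unfolding braid_group_def by (rule GL.pres_lift_hom(1)[OF f rel])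
  show "pres_lift (GL d) S (braid_gen n i) = half_gen d c (M i)" if "i \<in> {1..<n}"
    unfolding braid_gen_def using GL.pres_lift_hom(2)[OF f rel that] S[OF that] by simp
qed

text \<open>Either M_x or 1 is chosen from the leading factor, and the prefix \<open>u\<close>
  collects the letters chosen so far. Iteration turns the trace of a braid word into a signed sum of
  traces of words in the M_i.\<close>

lemma trace_sgn_mat_step:
  assumes "u \<in> lists {1..<n}" "x \<in> {1..<n}" "w \<in> gwords {1..<n}"
  shows "mat_trace (wmat d M u * sgn_mat d M ((x, b) # w))
    = (if b then 1 else - 1) * mat_trace (wmat d M (u @ [x]) * sgn_mat d M w) + mat_trace (wmat d M u * sgn_mat d M w)"
proof -
  have us: "set u \<subseteq> {1..<n}" using assms(1) by auto
  have car: "wmat d M u \<in> carrier_mat d d" "M x \<in> carrier_mat d d" "sgn_mat d M w \<in> carrier_mat d d"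
    using us closed[OF assms(2)] sgn_mat_closed[OF assms(3)] by auto
  have "wmat d M (u @ [x]) = wmat d M u * M x"
    using us assms(2) by (simp add: wmat_append right_mult_one_mat[OF car(2)])
  then have "wmat d M u * sgn_mat d M ((x, b) # w)
      = (if b then 1 else - 1) \<cdot>\<^sub>m (wmat d M (u @ [x]) * sgn_mat d M w) + wmat d M u * sgn_mat d M w"
    using car
    by (simp add: add_mult_distrib_mat[of _ d d _ _ d] mult_add_distrib_mat[of _ d d _ d] one_smult_mat
        smult_mult_left[of _ d d _ d] smult_mult_right[of _ d d _ d] left_mult_one_mat[of _ d d]
        assoc_mult_mat[of _ d d _ d _ d])
  moreover have "wmat d M (u @ [x]) \<in> carrier_mat d d" using us assms(2) by simp
  ultimately show ?thesis
    using car by (simp add: mat_trace_add[of _ d] mat_trace_smult[of _ d])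
qed

end

subsection \<open>Representations of the braid algebra\<close>

lemma ring_braid_algebra: "ring (braid_algebra n)"
proof -
  interpret group "braid_group n" by (rule group_braid_group)
  show ?thesis by (rule ring_group_algebra)
qed

abbreviation ga_gen :: "nat \<Rightarrow> nat \<Rightarrow> nat gword set \<Rightarrow> complex" where
  "ga_gen n i \<equiv> ga_of (braid_gen n i)"

lemma ga_gen_closed: "i \<in> {1..<n} \<Longrightarrow> ga_gen n i \<in> carrier (braid_algebra n)"
  by (intro ga_of_closed braid_gen_closed)

text \<open>The ring power in the third family is rewritten as a product, the form to which the
  homomorphism laws apply.\<close>

lemma TL_relators_cases:
  assumes "r \<in> TL_relators n"
  obtains (quadratic) i where "i \<in> {1..<n}"
      "r = (ga_gen n i \<oplus>\<^bsub>braid_algebra n\<^esub> \<one>\<^bsub>braid_algebra n\<^esub>)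
        \<otimes>\<^bsub>braid_algebra n\<^esub> (ga_gen n i \<ominus>\<^bsub>braid_algebra n\<^esub> \<i> \<odot>\<^bsub>braid_algebra n\<^esub> \<one>\<^bsub>braid_algebra n\<^esub>)"
  | (cubic) i where "i \<in> {1..<n}" "i + 1 \<in> {1..<n}"
      "r = ga_gen n i \<otimes>\<^bsub>braid_algebra n\<^esub> ga_gen n (i + 1) \<otimes>\<^bsub>braid_algebra n\<^esub> ga_gen n i
        \<oplus>\<^bsub>braid_algebra n\<^esub> ga_gen n i \<otimes>\<^bsub>braid_algebra n\<^esub> ga_gen n (i + 1)
        \<oplus>\<^bsub>braid_algebra n\<^esub> ga_gen n (i + 1) \<otimes>\<^bsub>braid_algebra n\<^esub> ga_gen n i
        \<oplus>\<^bsub>braid_algebra n\<^esub> ga_gen n i \<oplus>\<^bsub>braid_algebra n\<^esub> ga_gen n (i + 1)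
        \<oplus>\<^bsub>braid_algebra n\<^esub> \<one>\<^bsub>braid_algebra n\<^esub>"
  | (square) i where "i \<in> {1..<n}" "i + 1 \<in> {1..<n}"
      "r = (ga_gen n i \<ominus>\<^bsub>braid_algebra n\<^esub> ga_gen n (i + 1))
        \<otimes>\<^bsub>braid_algebra n\<^esub> (ga_gen n i \<ominus>\<^bsub>braid_algebra n\<^esub> ga_gen n (i + 1))
        \<ominus>\<^bsub>braid_algebra n\<^esub> \<i> \<odot>\<^bsub>braid_algebra n\<^esub> \<one>\<^bsub>braid_algebra n\<^esub>"
proof -
  interpret A: ring "braid_algebra n" by (rule ring_braid_algebra)
  have sq: "x [^]\<^bsub>braid_algebra n\<^esub> (2 :: nat) = x \<otimes>\<^bsub>braid_algebra n\<^esub> x"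
    if "x \<in> carrier (braid_algebra n)" for x
    using that by (simp add: numeral_2_eq_2)
  have mem: "ga_gen n i \<ominus>\<^bsub>braid_algebra n\<^esub> ga_gen n (i + 1) \<in> carrier (braid_algebra n)"
    if "1 \<le> i" "i + 1 < n" for i
    using that by (intro A.minus_closed ga_gen_closed) auto
  show ?thesis
    using assms unfolding TL_relators_def Let_def
    apply (elim UnE CollectE exE conjE)
    subgoal using quadratic by auto
    subgoal using cubic by auto
    subgoal for i using square[of i] sq[OF mem[of i]] by auto
    done
qed

lemma TL_relators_members:
  shows "i \<in> {1..<n} \<Longrightarrow> (ga_gen n i \<oplus>\<^bsub>braid_algebra n\<^esub> \<one>\<^bsub>braid_algebra n\<^esub>)
        \<otimes>\<^bsub>braid_algebra n\<^esub> (ga_gen n i \<ominus>\<^bsub>braid_algebra n\<^esub> \<i> \<odot>\<^bsub>braid_algebra n\<^esub> \<one>\<^bsub>braid_algebra n\<^esub>)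
      \<in> TL_relators n"
    and "i \<in> {1..<n} \<Longrightarrow> i + 1 \<in> {1..<n} \<Longrightarrow> (ga_gen n i \<ominus>\<^bsub>braid_algebra n\<^esub> ga_gen n (i + 1))
        \<otimes>\<^bsub>braid_algebra n\<^esub> (ga_gen n i \<ominus>\<^bsub>braid_algebra n\<^esub> ga_gen n (i + 1))
        \<ominus>\<^bsub>braid_algebra n\<^esub> \<i> \<odot>\<^bsub>braid_algebra n\<^esub> \<one>\<^bsub>braid_algebra n\<^esub> \<in> TL_relators n"
proof -
  interpret A: ring "braid_algebra n" by (rule ring_braid_algebra)
  assume i: "i \<in> {1..<n}"
  then show "(ga_gen n i \<oplus>\<^bsub>braid_algebra n\<^esub> \<one>\<^bsub>braid_algebra n\<^esub>)
        \<otimes>\<^bsub>braid_algebra n\<^esub> (ga_gen n i \<ominus>\<^bsub>braid_algebra n\<^esub> \<i> \<odot>\<^bsub>braid_algebra n\<^esub> \<one>\<^bsub>braid_algebra n\<^esub>)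
      \<in> TL_relators n"
    unfolding TL_relators_def Let_def by auto
  assume i1: "i + 1 \<in> {1..<n}"
  have "ga_gen n i \<ominus>\<^bsub>braid_algebra n\<^esub> ga_gen n (i + 1) \<in> carrier (braid_algebra n)"
    using i i1 by (intro A.minus_closed ga_gen_closed)
  then have "(ga_gen n i \<ominus>\<^bsub>braid_algebra n\<^esub> ga_gen n (i + 1)) [^]\<^bsub>braid_algebra n\<^esub> (2 :: nat)
      = (ga_gen n i \<ominus>\<^bsub>braid_algebra n\<^esub> ga_gen n (i + 1))
        \<otimes>\<^bsub>braid_algebra n\<^esub> (ga_gen n i \<ominus>\<^bsub>braid_algebra n\<^esub> ga_gen n (i + 1))"
    by (simp add: numeral_2_eq_2)
  moreover have "(ga_gen n i \<ominus>\<^bsub>braid_algebra n\<^esub> ga_gen n (i + 1)) [^]\<^bsub>braid_algebra n\<^esub> (2 :: nat)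
      \<ominus>\<^bsub>braid_algebra n\<^esub> \<i> \<odot>\<^bsub>braid_algebra n\<^esub> \<one>\<^bsub>braid_algebra n\<^esub> \<in> TL_relators n"
    unfolding TL_relators_def Let_def using i i1 by auto
  ultimately show "(ga_gen n i \<ominus>\<^bsub>braid_algebra n\<^esub> ga_gen n (i + 1))
        \<otimes>\<^bsub>braid_algebra n\<^esub> (ga_gen n i \<ominus>\<^bsub>braid_algebra n\<^esub> ga_gen n (i + 1))
        \<ominus>\<^bsub>braid_algebra n\<^esub> \<i> \<odot>\<^bsub>braid_algebra n\<^esub> \<one>\<^bsub>braid_algebra n\<^esub> \<in> TL_relators n" by simp
qed

lemma TL_relators_closed: "TL_relators n \<subseteq> carrier (braid_algebra n)"
proof
  interpret A: ring "braid_algebra n" by (rule ring_braid_algebra)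
  fix r assume "r \<in> TL_relators n"
  then show "r \<in> carrier (braid_algebra n)"
    by (cases rule: TL_relators_cases)
      (simp_all only:, (intro A.minus_closed A.m_closed A.a_closed ga_smult_closed ga_gen_closed A.one_closed; assumption)+)
qed

lemma ideal_TL_ideal: "ideal (TL_ideal n) (braid_algebra n)"
proof -
  interpret A: ring "braid_algebra n" by (rule ring_braid_algebra)
  show ?thesis unfolding TL_ideal_def by (rule A.genideal_ideal[OF TL_relators_closed])
qed

lemma TL_proj_hom: "TL_proj n \<in> Ring.ring_hom (braid_algebra n) (TL n)"
proof -
  interpret I: ideal "TL_ideal n" "braid_algebra n" by (rule ideal_TL_ideal)
  have "TL_proj n = (+>\<^bsub>braid_algebra n\<^esub>) (TL_ideal n)" by (rule ext) (simp add: TL_proj_def)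
  then show ?thesis using I.rcos_ring_hom by (simp add: TL_def)
qed

lemma TL_carrier: "carrier (TL n) = TL_proj n ` carrier (braid_algebra n)"
  unfolding TL_def FactRing_def A_RCOSETS_def' TL_proj_def by auto

definition tl_scale :: complex where
  "tl_scale = (\<i> - 1) / 2"

lemma tl_scale_nonzero: "tl_scale \<noteq> 0"
  by (simp add: tl_scale_def complex_eq_iff)

locale braid_alg_rep =
  fixes n d :: nat and \<theta> :: "(nat gword set \<Rightarrow> complex) \<Rightarrow> complex mat"
  assumes closed: "f \<in> carrier (braid_algebra n) \<Longrightarrow> \<theta> f \<in> carrier_mat d d"
    and hom_one: "\<theta> \<one>\<^bsub>braid_algebra n\<^esub> = 1\<^sub>m d"
    and hom_mult: "f \<in> carrier (braid_algebra n) \<Longrightarrow> g \<in> carrier (braid_algebra n)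
      \<Longrightarrow> \<theta> (f \<otimes>\<^bsub>braid_algebra n\<^esub> g) = \<theta> f * \<theta> g"
    and hom_add: "f \<in> carrier (braid_algebra n) \<Longrightarrow> g \<in> carrier (braid_algebra n)
      \<Longrightarrow> \<theta> (f \<oplus>\<^bsub>braid_algebra n\<^esub> g) = \<theta> f + \<theta> g"
    and hom_smult: "f \<in> carrier (braid_algebra n) \<Longrightarrow> \<theta> (c \<odot>\<^bsub>braid_algebra n\<^esub> f) = c \<cdot>\<^sub>m \<theta> f"
begin

text \<open>The solution M of S = c (1 + M) with S the image of the generator: M = S / c - 1, where
  1 / c = - (1 + \<i>).\<close>

definition gens :: "nat \<Rightarrow> complex mat" where
  "gens i = (- (1 + \<i>)) \<cdot>\<^sub>m \<theta> (ga_gen n i) + (- 1) \<cdot>\<^sub>m 1\<^sub>m d"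

lemma gen_closed: "i \<in> {1..<n} \<Longrightarrow> \<theta> (ga_gen n i) \<in> carrier_mat d d"
  by (intro closed ga_gen_closed)

lemma gens_closed: "i \<in> {1..<n} \<Longrightarrow> gens i \<in> carrier_mat d d"
  using gen_closed by (simp add: gens_def)

lemma half_gen_gens:
  assumes "i \<in> {1..<n}"
  shows "half_gen d tl_scale (gens i) = \<theta> (ga_gen n i)"
  using gen_closed[OF assms]
  by (intro eq_matI) (auto simp: half_gen_def gens_def tl_scale_def field_simps)

lemma hom_minus:
  assumes "f \<in> carrier (braid_algebra n)" "g \<in> carrier (braid_algebra n)"
  shows "\<theta> (f \<ominus>\<^bsub>braid_algebra n\<^esub> g) = \<theta> f + (- 1) \<cdot>\<^sub>m \<theta> g"
proof -
  interpret group "braid_group n" by (rule group_braid_group)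
  show ?thesis using assms by (simp add: ga_minus hom_add hom_smult ga_smult_closed)
qed

lemma hom_zero: "\<theta> (\<lambda>x. 0) = 0\<^sub>m d d"
proof -
  have "\<theta> (0 \<odot>\<^bsub>braid_algebra n\<^esub> (\<lambda>x. 0)) = 0 \<cdot>\<^sub>m \<theta> (\<lambda>x. 0)"
    by (rule hom_smult) (simp add: ga_carrier_iff)
  moreover have "\<theta> (\<lambda>x. 0) \<in> carrier_mat d d" by (rule closed) (simp add: ga_carrier_iff)
  moreover have "0 \<cdot>\<^sub>m A = 0\<^sub>m d d" if "A \<in> carrier_mat d d" for A :: "complex mat"
    using that by (intro eq_matI) auto
  ultimately show ?thesis by (simp add: ga_smult)
qed

lemma of_mult:
  assumes "x \<in> carrier (braid_group n)" "y \<in> carrier (braid_group n)"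
  shows "\<theta> (ga_of (x \<otimes>\<^bsub>braid_group n\<^esub> y)) = \<theta> (ga_of x) * \<theta> (ga_of y)"
proof -
  interpret group "braid_group n" by (rule group_braid_group)
  show ?thesis using assms by (simp add: ga_of_mult[symmetric] hom_mult ga_of_closed)
qed

end

section \<open>From the Temperley-Lieb relators to anticommuting matrices\<close>

locale TL_alg_rep = braid_alg_rep +
  assumes kills: "r \<in> TL_relators n \<Longrightarrow> \<theta> r = 0\<^sub>m d d"
begin

lemma quadratic:
  assumes i: "i \<in> {1..<n}"
  shows "\<theta> (ga_gen n i) * \<theta> (ga_gen n i) = (\<i> - 1) \<cdot>\<^sub>m \<theta> (ga_gen n i) + \<i> \<cdot>\<^sub>m 1\<^sub>m d"
proof -
  interpret A: ring "braid_algebra n" by (rule ring_braid_algebra)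
  let ?S = "\<theta> (ga_gen n i)"
  note s = ga_gen_closed[OF i]
  have S: "?S \<in> carrier_mat d d" by (rule gen_closed[OF i])
  have "0\<^sub>m d d = (?S + 1\<^sub>m d) * (?S + (- 1) \<cdot>\<^sub>m (\<i> \<cdot>\<^sub>m 1\<^sub>m d))"
    unfolding kills[OF TL_relators_members(1)[OF i], symmetric]
    using s by (simp add: hom_mult hom_add hom_minus hom_smult hom_one ga_smult_closed)
  also have "\<dots> = (1 \<cdot>\<^sub>m ?S + 1 \<cdot>\<^sub>m 1\<^sub>m d) * (1 \<cdot>\<^sub>m ?S + (- \<i>) \<cdot>\<^sub>m 1\<^sub>m d)"
    by (simp add: one_smult_mat smult_smult_mat)
  also have "\<dots> = 1 \<cdot>\<^sub>m (?S * ?S) + (- \<i>) \<cdot>\<^sub>m ?S + 1 \<cdot>\<^sub>m ?S + (- \<i>) \<cdot>\<^sub>m 1\<^sub>m d"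
    by (subst lin_mult[OF S S]) simp
  finally have *: "1 \<cdot>\<^sub>m (?S * ?S) + (- \<i>) \<cdot>\<^sub>m ?S + 1 \<cdot>\<^sub>m ?S + (- \<i>) \<cdot>\<^sub>m 1\<^sub>m d = 0\<^sub>m d d" by simp
  show ?thesis
  proof (rule eq_matI)
    fix a b assume "a < dim_row ((\<i> - 1) \<cdot>\<^sub>m ?S + \<i> \<cdot>\<^sub>m 1\<^sub>m d)" "b < dim_col ((\<i> - 1) \<cdot>\<^sub>m ?S + \<i> \<cdot>\<^sub>m 1\<^sub>m d)"
    then have ab: "a < d" "b < d" by simp_all
    have "(1 \<cdot>\<^sub>m (?S * ?S) + (- \<i>) \<cdot>\<^sub>m ?S + 1 \<cdot>\<^sub>m ?S + (- \<i>) \<cdot>\<^sub>m 1\<^sub>m d) $$ (a, b) = 0"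
      unfolding * using ab by simp
    then show "(?S * ?S) $$ (a, b) = ((\<i> - 1) \<cdot>\<^sub>m ?S + \<i> \<cdot>\<^sub>m 1\<^sub>m d) $$ (a, b)"
      using ab S by (simp add: algebra_simps eq_neg_iff_add_eq_0 del: index_mult_mat(1))
  qed (use S in auto)
qed

text \<open>Expanding (S - T)^2 = \<i> gives S T + T S = S^2 + T^2 - \<i>, and the quadratic
  relation eliminates both squares.\<close>

lemma anticommutator:
  assumes i: "i \<in> {1..<n}" and j: "i + 1 \<in> {1..<n}"
  shows "\<theta> (ga_gen n i) * \<theta> (ga_gen n (i + 1)) + \<theta> (ga_gen n (i + 1)) * \<theta> (ga_gen n i)
    = (\<i> - 1) \<cdot>\<^sub>m (\<theta> (ga_gen n i) + \<theta> (ga_gen n (i + 1))) + \<i> \<cdot>\<^sub>m 1\<^sub>m d"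
proof -
  interpret A: ring "braid_algebra n" by (rule ring_braid_algebra)
  let ?S = "\<theta> (ga_gen n i)" and ?T = "\<theta> (ga_gen n (i + 1))"
  note s = ga_gen_closed[OF i] ga_gen_closed[OF j]
  have S: "?S \<in> carrier_mat d d" "?T \<in> carrier_mat d d" by (rule gen_closed[OF i], rule gen_closed[OF j])
  have "0\<^sub>m d d = (?S + (- 1) \<cdot>\<^sub>m ?T) * (?S + (- 1) \<cdot>\<^sub>m ?T) + (- 1) \<cdot>\<^sub>m (\<i> \<cdot>\<^sub>m 1\<^sub>m d)"
    unfolding kills[OF TL_relators_members(2)[OF i j], symmetric]
    using s by (simp add: hom_mult hom_minus hom_smult hom_one ga_smult_closed)
  also have "(?S + (- 1) \<cdot>\<^sub>m ?T) * (?S + (- 1) \<cdot>\<^sub>m ?T)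
      = (?S * ?S + (- 1) \<cdot>\<^sub>m (?T * ?S)) + ((- 1) \<cdot>\<^sub>m (?S * ?T) + ?T * ?T)"
    using S by (simp add: mult_add_distrib_mat[of _ d d _ d] add_mult_distrib_mat[of _ d d _ _ d]
        smult_mult_left[of _ d d _ d] smult_mult_right[of _ d d _ d] smult_smult_mat one_smult_mat
        add_smult_distrib_left_mat[of _ d d])
  finally have *: "(?S * ?S + (- 1) \<cdot>\<^sub>m (?T * ?S)) + ((- 1) \<cdot>\<^sub>m (?S * ?T) + ?T * ?T)
      + (- 1) \<cdot>\<^sub>m (\<i> \<cdot>\<^sub>m 1\<^sub>m d) = 0\<^sub>m d d" by simp
  show ?thesis
  proof (rule eq_matI)
    fix a b assume "a < dim_row ((\<i> - 1) \<cdot>\<^sub>m (?S + ?T) + \<i> \<cdot>\<^sub>m 1\<^sub>m d)"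
      "b < dim_col ((\<i> - 1) \<cdot>\<^sub>m (?S + ?T) + \<i> \<cdot>\<^sub>m 1\<^sub>m d)"
    then have ab: "a < d" "b < d" by simp_all
    have "((?S * ?S + (- 1) \<cdot>\<^sub>m (?T * ?S)) + ((- 1) \<cdot>\<^sub>m (?S * ?T) + ?T * ?T)
      + (- 1) \<cdot>\<^sub>m (\<i> \<cdot>\<^sub>m 1\<^sub>m d)) $$ (a, b) = 0"
      unfolding * using ab by simp
    then have "(?S * ?T) $$ (a, b) + (?T * ?S) $$ (a, b)
        = (?S * ?S) $$ (a, b) + (?T * ?T) $$ (a, b) - \<i> * 1\<^sub>m d $$ (a, b)"
      using ab S by (simp add: algebra_simps eq_neg_iff_add_eq_0 del: index_mult_mat(1) index_one_mat(1))
    also have "(?S * ?S) $$ (a, b) = (\<i> - 1) * ?S $$ (a, b) + \<i> * 1\<^sub>m d $$ (a, b)"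
      unfolding quadratic[OF i] using ab S by simp
    also have "(?T * ?T) $$ (a, b) = (\<i> - 1) * ?T $$ (a, b) + \<i> * 1\<^sub>m d $$ (a, b)"
      unfolding quadratic[OF j] using ab S by simp
    finally show "(?S * ?T + ?T * ?S) $$ (a, b) = ((\<i> - 1) \<cdot>\<^sub>m (?S + ?T) + \<i> \<cdot>\<^sub>m 1\<^sub>m d) $$ (a, b)"
      using ab S by (simp add: algebra_simps del: index_mult_mat(1))
  qed (use S in auto)
qed

text \<open>After the affine change of variables the quadratic relation says that M_i has square -1
  and the anticommutator formula that neighbours anticommute; distant letters commute already in the
  braid group.\<close>

sublocale gens: nb_clifford n d gens
proof
  fix i assume i: "i \<in> {1..<n}"
  let ?S = "\<theta> (ga_gen n i)"
  have S: "?S \<in> carrier_mat d d" by (rule gen_closed[OF i])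
  show "gens i \<in> carrier_mat d d" by (rule gens_closed[OF i])
  show "gens i * gens i = (- 1) \<cdot>\<^sub>m 1\<^sub>m d"
    unfolding gens_def lin_mult[OF S S] quadratic[OF i] using S
    by (intro eq_matI) (auto simp: algebra_simps)
  have adj: "gens i * gens (i + 1) = (- 1) \<cdot>\<^sub>m (gens (i + 1) * gens i)"
    if i: "i \<in> {1..<n}" and j: "i + 1 \<in> {1..<n}" for i
  proof (rule eq_matI)
    let ?S = "\<theta> (ga_gen n i)" and ?T = "\<theta> (ga_gen n (i + 1))"
    have S: "?S \<in> carrier_mat d d" "?T \<in> carrier_mat d d" by (rule gen_closed[OF i], rule gen_closed[OF j])
    have G: "gens i \<in> carrier_mat d d" "gens (i + 1) \<in> carrier_mat d d"
      by (rule gens_closed[OF i], rule gens_closed[OF j])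
    fix a b assume "a < dim_row ((- 1) \<cdot>\<^sub>m (gens (i + 1) * gens i))" "b < dim_col ((- 1) \<cdot>\<^sub>m (gens (i + 1) * gens i))"
    then have ab: "a < d" "b < d" using G by simp_all
    have "(?S * ?T + ?T * ?S) $$ (a, b) = ((\<i> - 1) \<cdot>\<^sub>m (?S + ?T) + \<i> \<cdot>\<^sub>m 1\<^sub>m d) $$ (a, b)"
      unfolding anticommutator[OF i j] ..
    then have *: "(?S * ?T) $$ (a, b) = (\<i> - 1) * (?S $$ (a, b) + ?T $$ (a, b)) + \<i> * 1\<^sub>m d $$ (a, b) - (?T * ?S) $$ (a, b)"
      using ab S by (simp add: algebra_simps del: index_mult_mat(1))
    have e1: "(gens i * gens (i + 1)) $$ (a, b)
        = 2 * \<i> * (?S * ?T) $$ (a, b) + (1 + \<i>) * (?S $$ (a, b) + ?T $$ (a, b)) + 1\<^sub>m d $$ (a, b)"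
      unfolding gens_def lin_mult[OF S] using ab S
      by (simp add: algebra_simps del: index_mult_mat(1) index_one_mat(1))
    have e2: "(gens (i + 1) * gens i) $$ (a, b)
        = 2 * \<i> * (?T * ?S) $$ (a, b) + (1 + \<i>) * (?S $$ (a, b) + ?T $$ (a, b)) + 1\<^sub>m d $$ (a, b)"
      unfolding gens_def lin_mult[OF S(2,1)] using ab S
      by (simp add: algebra_simps del: index_mult_mat(1) index_one_mat(1))
    have e3: "((- 1) \<cdot>\<^sub>m (gens (i + 1) * gens i)) $$ (a, b) = - (gens (i + 1) * gens i) $$ (a, b)"
      using ab G by (simp del: index_mult_mat(1))
    show "(gens i * gens (i + 1)) $$ (a, b) = ((- 1) \<cdot>\<^sub>m (gens (i + 1) * gens i)) $$ (a, b)"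
      unfolding e3 e1 e2 * by (simp add: algebra_simps del: index_mult_mat(1) index_one_mat(1))
  qed (use gens_closed[OF i] gens_closed[OF j] in auto)
  fix j assume j: "j \<in> {1..<n}"
  let ?T = "\<theta> (ga_gen n j)"
  have T: "?T \<in> carrier_mat d d" by (rule gen_closed[OF j])
  consider "j = i" | "j = i + 1" | "i = j + 1" | "\<bar>int i - int j\<bar> \<ge> 2" by linarith
  then show "gens i * gens j = nb_sign i j \<cdot>\<^sub>m (gens j * gens i)"
  proof cases
    case 1
    then show ?thesis by (simp add: nb_sign_def one_smult_mat)
  next
    case 2
    then show ?thesis using adj[OF i] j by (simp add: nb_sign_def)
  next
    case 3
    have "gens j * gens i = (- 1) \<cdot>\<^sub>m (gens i * gens j)" using adj[OF j] i 3 by simp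
    then show ?thesis using 3 by (simp add: nb_sign_def smult_smult_mat one_smult_mat)
  next
    case 4
    then have "nb_sign i j = 1" by (auto simp: nb_sign_def)
    moreover have "?S * ?T = ?T * ?S"
      using braid_gen_far_commute[OF i j 4] of_mult[OF braid_gen_closed[OF i] braid_gen_closed[OF j]]
        of_mult[OF braid_gen_closed[OF j] braid_gen_closed[OF i]] by simp
    ultimately show ?thesis
      unfolding gens_def lin_mult[OF S T] lin_mult[OF T S] using S T
      by (intro eq_matI) (auto simp: algebra_simps simp del: index_mult_mat(1))
  qed
qed

lemma braid_class_expansion:
  assumes "w \<in> gwords {1..<n}"
  shows "\<theta> (ga_of (braid_class n w)) = letter_scale tl_scale w \<cdot>\<^sub>m sgn_mat d gens w"
proof (rule gens.word_expansion[OF tl_scale_nonzero _ _ _ _ assms])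
  show "\<theta> (ga_of x) \<in> carrier_mat d d" if "x \<in> carrier (braid_group n)" for x
    using that by (intro closed ga_of_closed)
  show "\<theta> (ga_of \<one>\<^bsub>braid_group n\<^esub>) = 1\<^sub>m d" using hom_one by (simp add: ga_one)
  show "\<theta> (ga_gen n i) = half_gen d tl_scale (gens i)" if "i \<in> {1..<n}" for i
    using half_gen_gens[OF that] by simp
qed (rule of_mult)

text \<open>By linearity it suffices to treat a group element, which acts as a scalar times a
  product of factors 1 + M_i and 1 - M_i; inverse letters are thus covered by the M_i too.\<close>

lemma invariant:
  assumes W: "subspace_vec d W" and inv: "\<And>i w. i \<in> {1..<n} \<Longrightarrow> w \<in> W \<Longrightarrow> gens i *\<^sub>v w \<in> W"
    and f: "f \<in> carrier (braid_algebra n)" and v: "v \<in> W"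
  shows "\<theta> f *\<^sub>v v \<in> W"
  using f
proof (induction f rule: group_algebra_induct)
  case zero
  show ?case using v subspace_vecD(1,2)[OF W] by (auto simp: hom_zero zero_mat_vec)
next
  case (add f g)
  then show ?case
    using subspace_vecD(1,3)[OF W] v
    by (simp add: hom_add add_mult_distrib_mat_vec[OF closed closed] subset_iff)
next
  case (smult c x)
  obtain w where w: "w \<in> gwords {1..<n}" "x = braid_class n w" using smult by (rule braid_carrierE)
  have V: "v \<in> carrier_vec d" using v subspace_vecD(1)[OF W] by auto
  have "sgn_mat d gens w *\<^sub>v v \<in> W" using w(1)
  proof (induction w rule: list.induct)
    case Nil
    then show ?case using v V by simp
  next
    case (Cons a w)
    obtain x b where a: "a = (x, b)" by force
    have x: "x \<in> {1..<n}" and w: "w \<in> gwords {1..<n}" using Cons.prems a by auto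
    let ?u = "sgn_mat d gens w *\<^sub>v v"
    have u: "?u \<in> W" "?u \<in> carrier_vec d" using Cons.IH[OF w] subspace_vecD(1)[OF W] by auto
    note car = gens_closed[OF x] gens.sgn_mat_closed[OF w]
    have "sgn_mat d gens (a # w) *\<^sub>v v = (if b then 1 else - 1) \<cdot>\<^sub>v (gens x *\<^sub>v ?u) + ?u"
      using car V u(2)
      by (simp add: a assoc_mult_mat_vec[of _ d d _ d] add_mult_distrib_mat_vec[of _ d d] smult_mat_vec[of _ d d])
    then show ?case using inv[OF x u(1)] u(1) subspace_vecD(3,4)[OF W] by metis
  qed
  then show ?case
    using V gens.sgn_mat_closed[OF w(1)] subspace_vecD(4)[OF W] smult
    by (simp add: w(2) hom_smult[OF ga_of_closed] braid_class_expansion[OF w(1)] smult_smult_mat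
        smult_mat_vec[of _ d d] braid_class_closed[OF w(1)])
qed

lemma irr_iff:
  assumes "d > 0"
  shows "irr_family {1..<n} d gens \<longleftrightarrow>
    (\<forall>W. subspace_vec d W \<and> (\<forall>f\<in>carrier (braid_algebra n). \<forall>w\<in>W. \<theta> f *\<^sub>v w \<in> W)
      \<longrightarrow> W = {0\<^sub>v d} \<or> W = carrier_vec d)"
proof -
  have "(\<forall>i\<in>{1..<n}. \<forall>w\<in>W. gens i *\<^sub>v w \<in> W)
      \<longleftrightarrow> (\<forall>f\<in>carrier (braid_algebra n). \<forall>w\<in>W. \<theta> f *\<^sub>v w \<in> W)" if W: "subspace_vec d W" for W
  proof
    assume "\<forall>i\<in>{1..<n}. \<forall>w\<in>W. gens i *\<^sub>v w \<in> W"
    then show "\<forall>f\<in>carrier (braid_algebra n). \<forall>w\<in>W. \<theta> f *\<^sub>v w \<in> W" using invariant[OF W] by blast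
  next
    assume *: "\<forall>f\<in>carrier (braid_algebra n). \<forall>w\<in>W. \<theta> f *\<^sub>v w \<in> W"
    show "\<forall>i\<in>{1..<n}. \<forall>w\<in>W. gens i *\<^sub>v w \<in> W"
    proof (intro ballI)
      fix i w assume i: "i \<in> {1..<n}" and w: "w \<in> W"
      have wc: "w \<in> carrier_vec d" using w subspace_vecD(1)[OF W] by auto
      have "gens i *\<^sub>v w = (- (1 + \<i>)) \<cdot>\<^sub>v (\<theta> (ga_gen n i) *\<^sub>v w) + (- 1) \<cdot>\<^sub>v w"
        unfolding gens_def using gen_closed[OF i] wc
        by (simp add: add_mult_distrib_mat_vec[of _ d d] smult_mat_vec[of _ d d])
      then show "gens i *\<^sub>v w \<in> W"
        using * ga_gen_closed[OF i] w subspace_vecD(3,4)[OF W] by metis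
    qed
  qed
  then show ?thesis using assms unfolding irr_family_def by blast
qed

end

text \<open>One direction extends the relation from letters to words to linear combinations; the
  other holds because M_i is a linear combination of the image of a generator and the
  identity.\<close>

lemma intertwines_iff:
  assumes V: "TL_alg_rep n d \<theta>" and W: "TL_alg_rep n d' \<theta>'" and P: "P \<in> carrier_mat d' d"
  shows "(\<forall>i\<in>{1..<n}. braid_alg_rep.gens n d' \<theta>' i * P = P * braid_alg_rep.gens n d \<theta> i)
    \<longleftrightarrow> (\<forall>f\<in>carrier (braid_algebra n). P * \<theta> f = \<theta>' f * P)"
proof -
  interpret V: TL_alg_rep n d \<theta> by (rule V)
  interpret W: TL_alg_rep n d' \<theta>' by (rule W)
  show ?thesis
  proof (intro iffI ballI)
    fix f assume gen: "\<forall>i\<in>{1..<n}. W.gens i * P = P * V.gens i" and f: "f \<in> carrier (braid_algebra n)"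
    show "P * \<theta> f = \<theta>' f * P" using f
    proof (induction f rule: group_algebra_induct)
      case zero
      show ?case using P by (simp add: V.hom_zero W.hom_zero)
    next
      case (add f g)
      then show ?case
        using P V.closed[OF add(1)] V.closed[OF add(2)] W.closed[OF add(1)] W.closed[OF add(2)]
        by (simp add: V.hom_add W.hom_add mult_add_distrib_mat[of _ d' d _ d] add_mult_distrib_mat[of _ d' d' _ _ d])
    next
      case (smult c x)
      obtain w where w: "w \<in> gwords {1..<n}" "x = braid_class n w" using smult by (rule braid_carrierE)
      have "P * sgn_mat d V.gens w = sgn_mat d' W.gens w * P" using w(1)
      proof (induction w rule: list.induct)
        case Nil
        then show ?case using P by simp
      next
        case (Cons a w)
        obtain x b where a: "a = (x, b)" by force
        have x: "x \<in> {1..<n}" and w: "w \<in> gwords {1..<n}" using Cons.prems a by auto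
        let ?s = "if b then 1 else - 1 :: complex"
        let ?L = "?s \<cdot>\<^sub>m V.gens x + 1 \<cdot>\<^sub>m 1\<^sub>m d" and ?L' = "?s \<cdot>\<^sub>m W.gens x + 1 \<cdot>\<^sub>m 1\<^sub>m d'"
        note car = P V.gens_closed[OF x] W.gens_closed[OF x] V.gens.sgn_mat_closed[OF w] W.gens.sgn_mat_closed[OF w]
        have L: "?L \<in> carrier_mat d d" "?L' \<in> carrier_mat d' d'" using car by auto
        have "P * ?L = ?L' * P"
          using car gen x
          by (simp add: mult_add_distrib_mat[of _ d' d _ d] add_mult_distrib_mat[of _ d' d' _ _ d]
              smult_mult_left[of _ d' d' _ d] smult_mult_right[of _ d' d _ d] one_smult_mat
              right_mult_one_mat[of _ d' d] left_mult_one_mat[of _ d' d])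
        then have "P * (?L * sgn_mat d V.gens w) = (?L' * P) * sgn_mat d V.gens w"
          using assoc_mult_mat[OF P L(1) car(4)] by metis
        also have "\<dots> = ?L' * (sgn_mat d' W.gens w * P)"
          using assoc_mult_mat[OF L(2) P car(4)] Cons.IH[OF w] by simp
        also have "\<dots> = (?L' * sgn_mat d' W.gens w) * P"
          by (rule assoc_mult_mat[OF L(2) car(5) P, symmetric])
        finally show ?case by (simp add: a)
      qed
      then show ?case
        using P V.gens.sgn_mat_closed[OF w(1)] W.gens.sgn_mat_closed[OF w(1)] smult
        by (simp add: w(2) V.hom_smult[OF ga_of_closed] W.hom_smult[OF ga_of_closed] braid_class_closed[OF w(1)]
            V.braid_class_expansion[OF w(1)] W.braid_class_expansion[OF w(1)] smult_smult_mat
            smult_mult_left[of _ d' d' _ d] smult_mult_right[of _ d' d _ d])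
    qed
  next
    fix i assume *: "\<forall>f\<in>carrier (braid_algebra n). P * \<theta> f = \<theta>' f * P" and i: "i \<in> {1..<n}"
    then have "P * \<theta> (ga_gen n i) = \<theta>' (ga_gen n i) * P" using ga_gen_closed by blast
    then show "W.gens i * P = P * V.gens i"
      unfolding V.gens_def W.gens_def using P V.gen_closed[OF i] W.gen_closed[OF i]
      by (simp add: mult_add_distrib_mat[of _ d' d _ d] add_mult_distrib_mat[of _ d' d' _ _ d]
              smult_mult_left[of _ d' d' _ d] smult_mult_right[of _ d' d _ d]
              right_mult_one_mat[of _ d' d] left_mult_one_mat[of _ d' d])
  qed
qed

subsection \<open>Representations of the Temperley-Lieb algebra\<close>

lemma TL_proj_eq_iff:
  assumes "f \<in> carrier (braid_algebra n)" "g \<in> carrier (braid_algebra n)"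
  shows "TL_proj n f = TL_proj n g \<longleftrightarrow> f \<ominus>\<^bsub>braid_algebra n\<^esub> g \<in> TL_ideal n"
proof -
  interpret A: ring "braid_algebra n" by (rule ring_braid_algebra)
  show ?thesis
    unfolding TL_proj_def using A.quotient_eq_iff_same_a_r_cos[OF ideal_TL_ideal assms] by blast
qed

lemma TL_rep_imp_alg_rep:
  assumes "TL_rep n d \<phi>"
  shows "TL_alg_rep n d (\<lambda>f. \<phi> (TL_proj n f))"
proof -
  interpret A: ring "braid_algebra n" by (rule ring_braid_algebra)
  have \<phi>: "\<phi> \<in> Ring.ring_hom (TL n) (ring_mat TYPE(complex) d ())"
    and lin: "\<And>c x. x \<in> carrier (braid_algebra n) \<Longrightarrow>
      \<phi> (TL_proj n (c \<odot>\<^bsub>braid_algebra n\<^esub> x)) = c \<cdot>\<^sub>m \<phi> (TL_proj n x)"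
    using assms by (auto simp: TL_rep_def)
  note p = ring_hom_memE[OF TL_proj_hom[of n]]
  note q = ring_hom_memE[OF \<phi>, unfolded ring_mat_simps]
  interpret braid_alg_rep n d "\<lambda>f. \<phi> (TL_proj n f)"
    by unfold_locales (simp_all add: p q lin)
  show ?thesis
  proof
    fix r assume r: "r \<in> TL_relators n"
    have rc: "r \<in> carrier (braid_algebra n)" using r TL_relators_closed by blast
    have "r \<in> TL_ideal n"
      unfolding TL_ideal_def using A.genideal_self[OF TL_relators_closed] r by blast
    then have "TL_proj n r = TL_proj n \<zero>\<^bsub>braid_algebra n\<^esub>"
      using rc by (simp add: TL_proj_eq_iff a_minus_def)
    then show "\<phi> (TL_proj n r) = 0\<^sub>m d d" using hom_zero by (simp add: ga_zero)
  qed
qed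

text \<open>The kernel of \<open>\<theta>\<close> is an ideal containing the relators, hence
  contains the ideal they generate. On a coset the induced map is \<open>\<theta>\<close> at a
  chosen representative, and the choice does not affect the value.\<close>

lemma alg_rep_imp_TL_rep:
  assumes "TL_alg_rep n d \<theta>"
  shows "\<exists>\<phi>. TL_rep n d \<phi> \<and> (\<forall>f\<in>carrier (braid_algebra n). \<phi> (TL_proj n f) = \<theta> f)"
proof -
  interpret A: ring "braid_algebra n" by (rule ring_braid_algebra)
  interpret TL_alg_rep n d \<theta> by (rule assms)
  interpret R: ring "ring_mat TYPE(complex) d ()" by (rule ring_mat)
  have "\<theta> \<in> Ring.ring_hom (braid_algebra n) (ring_mat TYPE(complex) d ())"
    by (intro ring_hom_memI) (simp_all add: ring_mat_simps closed hom_mult hom_add hom_one)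
  then interpret H: ring_hom_ring "braid_algebra n" "ring_mat TYPE(complex) d ()" \<theta>
    by (rule ring_hom_ringI2[OF A.ring_axioms R.ring_axioms])
  have kernel: "a_kernel (braid_algebra n) (ring_mat TYPE(complex) d ()) \<theta>
      = {f \<in> carrier (braid_algebra n). \<theta> f = 0\<^sub>m d d}"
    unfolding a_kernel_def' ring_mat_simps ..
  have "TL_ideal n \<subseteq> {f \<in> carrier (braid_algebra n). \<theta> f = 0\<^sub>m d d}"
    unfolding TL_ideal_def
  proof (rule A.genideal_minimal[OF H.kernel_is_ideal[unfolded kernel]], rule subsetI)
    fix r assume "r \<in> TL_relators n"
    then show "r \<in> {f \<in> carrier (braid_algebra n). \<theta> f = 0\<^sub>m d d}"
      using kills TL_relators_closed by blast
  qed
  then have ker: "\<theta> f = 0\<^sub>m d d" if "f \<in> TL_ideal n" for f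
    using that by blast
  have wd: "\<theta> f = \<theta> g"
    if fg: "f \<in> carrier (braid_algebra n)" "g \<in> carrier (braid_algebra n)" "TL_proj n f = TL_proj n g" for f g
  proof -
    have "\<theta> f + (- 1) \<cdot>\<^sub>m \<theta> g = 0\<^sub>m d d"
      using ker fg by (simp add: TL_proj_eq_iff hom_minus[symmetric])
    then have "(\<theta> f + (- 1) \<cdot>\<^sub>m \<theta> g) $$ (i, j) = 0" if "i < d" "j < d" for i j using that by simp
    then show ?thesis using closed[OF fg(1)] closed[OF fg(2)] by (intro eq_matI) auto
  qed
  define \<phi> where "\<phi> X = \<theta> (SOME f. f \<in> carrier (braid_algebra n) \<and> TL_proj n f = X)" for X
  have \<phi>: "\<phi> (TL_proj n f) = \<theta> f" if "f \<in> carrier (braid_algebra n)" for f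
  proof -
    have "\<exists>g. g \<in> carrier (braid_algebra n) \<and> TL_proj n g = TL_proj n f" using that by blast
    from someI_ex[OF this] show ?thesis unfolding \<phi>_def using that wd by blast
  qed
  note p = ring_hom_memE[OF TL_proj_hom[of n]]
  have "TL_rep n d \<phi>"
    unfolding TL_rep_def
  proof (intro conjI allI ballI ring_hom_memI)
    show "\<phi> \<one>\<^bsub>TL n\<^esub> = \<one>\<^bsub>ring_mat TYPE(complex) d ()\<^esub>"
      using \<phi>[of "\<one>\<^bsub>braid_algebra n\<^esub>"] by (simp add: p(4) hom_one ring_mat_simps)
    fix x assume "x \<in> carrier (TL n)"
    then obtain f where f: "f \<in> carrier (braid_algebra n)" "x = TL_proj n f" by (auto simp: TL_carrier)
    then show "\<phi> x \<in> carrier (ring_mat TYPE(complex) d ())" by (simp add: \<phi> closed ring_mat_simps)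
    fix y assume "y \<in> carrier (TL n)"
    then obtain g where g: "g \<in> carrier (braid_algebra n)" "y = TL_proj n g" by (auto simp: TL_carrier)
    show "\<phi> (x \<otimes>\<^bsub>TL n\<^esub> y) = \<phi> x \<otimes>\<^bsub>ring_mat TYPE(complex) d ()\<^esub> \<phi> y"
      and "\<phi> (x \<oplus>\<^bsub>TL n\<^esub> y) = \<phi> x \<oplus>\<^bsub>ring_mat TYPE(complex) d ()\<^esub> \<phi> y"
      using f g by (simp_all add: p(2,3)[symmetric] \<phi> hom_mult hom_add ring_mat_simps)
  next
    fix c x assume "x \<in> carrier (braid_algebra n)"
    then show "\<phi> (TL_proj n (c \<odot>\<^bsub>braid_algebra n\<^esub> x)) = c \<cdot>\<^sub>m \<phi> (TL_proj n x)"
      by (simp add: \<phi> hom_smult ga_smult_closed)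
  qed
  then show ?thesis using \<phi> by blast
qed

definition TL_gens :: "nat \<Rightarrow> nat \<Rightarrow> ((nat gword set \<Rightarrow> complex) set \<Rightarrow> complex mat) \<Rightarrow> nat \<Rightarrow> complex mat" where
  "TL_gens n d \<phi> = braid_alg_rep.gens n d (\<lambda>f. \<phi> (TL_proj n f))"

text \<open>The quotient algebra disappears from the irreducibility condition here; the
  classification works with the matrices \<open>TL_gens\<close> alone.\<close>

lemma TL_irrep_iff:
  "TL_irrep n d \<phi> \<longleftrightarrow> TL_rep n d \<phi> \<and> irr_family {1..<n} d (TL_gens n d \<phi>)"
proof (cases "TL_rep n d \<phi> \<and> d > 0")
  case True
  then interpret TL_alg_rep n d "\<lambda>f. \<phi> (TL_proj n f)" by (intro TL_rep_imp_alg_rep) simp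
  show ?thesis
    using True irr_iff unfolding TL_irrep_def TL_gens_def by (simp add: TL_carrier)
next
  case False
  then show ?thesis unfolding TL_irrep_def irr_family_def by auto
qed

lemma TL_rep_iso_iff:
  assumes "TL_rep n d \<phi>" "TL_rep n d' \<phi>'"
  shows "TL_rep_iso n d \<phi> d' \<phi>' \<longleftrightarrow> d = d' \<and> (\<exists>P\<in>carrier_mat d' d. invertible_mat P
    \<and> (\<forall>i\<in>{1..<n}. TL_gens n d' \<phi>' i * P = P * TL_gens n d \<phi> i))"
  unfolding TL_rep_iso_def TL_gens_def
  using intertwines_iff[OF TL_rep_imp_alg_rep[OF assms(1)] TL_rep_imp_alg_rep[OF assms(2)]]
  by (auto simp: TL_carrier)

lemma TL_gens_clifford: "TL_rep n d \<phi> \<Longrightarrow> nb_clifford n d (TL_gens n d \<phi>)"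
proof -
  assume "TL_rep n d \<phi>"
  then interpret TL_alg_rep n d "\<lambda>f. \<phi> (TL_proj n f)" by (rule TL_rep_imp_alg_rep)
  show ?thesis unfolding TL_gens_def by (rule gens.nb_clifford_axioms)
qed

lemma TL_rep_braid_class:
  assumes "TL_rep n d \<phi>" "w \<in> gwords {1..<n}"
  shows "\<phi> (TL_proj n (ga_of (braid_class n w))) = letter_scale tl_scale w \<cdot>\<^sub>m sgn_mat d (TL_gens n d \<phi>) w"
proof -
  interpret TL_alg_rep n d "\<lambda>f. \<phi> (TL_proj n f)" using assms(1) by (rule TL_rep_imp_alg_rep)
  show ?thesis unfolding TL_gens_def by (rule braid_class_expansion[OF assms(2)])
qed

section \<open>From anticommuting matrices back to the Temperley-Lieb algebra\<close>

lemma tl_scale_powers: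
  "2 * tl_scale = \<i> - 1" "tl_scale * tl_scale = - \<i> / 2" "tl_scale ^ 3 = (1 + \<i>) / 4"
  by (simp_all add: tl_scale_def power3_eq_cube field_simps)

lemma (in nb_clifford) half_gen_relations:
  fixes i :: nat
  assumes i: "i \<in> {1..<n}"
  defines "S \<equiv> half_gen d tl_scale (M i)" and "T \<equiv> half_gen d tl_scale (M (i + 1))"
  shows "(S + 1\<^sub>m d) * (S + (- 1) \<cdot>\<^sub>m (\<i> \<cdot>\<^sub>m 1\<^sub>m d)) = 0\<^sub>m d d"
    and "i + 1 \<in> {1..<n} \<Longrightarrow> S * T * S + S * T + T * S + S + T + 1\<^sub>m d = 0\<^sub>m d d"
    and "i + 1 \<in> {1..<n} \<Longrightarrow> (S + (- 1) \<cdot>\<^sub>m T) * (S + (- 1) \<cdot>\<^sub>m T) + (- 1) \<cdot>\<^sub>m (\<i> \<cdot>\<^sub>m 1\<^sub>m d) = 0\<^sub>m d d"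
proof -
  let ?c = tl_scale
  have M: "M i \<in> carrier_mat d d" by (rule closed[OF i])
  have e: "S + 1\<^sub>m d = ?c \<cdot>\<^sub>m M i + (?c + 1) \<cdot>\<^sub>m 1\<^sub>m d"
    "S + (- 1) \<cdot>\<^sub>m (\<i> \<cdot>\<^sub>m 1\<^sub>m d) = ?c \<cdot>\<^sub>m M i + (?c - \<i>) \<cdot>\<^sub>m 1\<^sub>m d"
    unfolding S_def half_gen_def using M by (auto intro!: eq_matI simp: algebra_simps)
  show "(S + 1\<^sub>m d) * (S + (- 1) \<cdot>\<^sub>m (\<i> \<cdot>\<^sub>m 1\<^sub>m d)) = 0\<^sub>m d d"
    unfolding e lin_mult[OF M M] square[OF i] using M
    by (intro eq_matI) (auto simp: tl_scale_def field_simps)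
  assume j: "i + 1 \<in> {1..<n}"
  have N: "M (i + 1) \<in> carrier_mat d d" by (rule closed[OF j])
  have nb: "nb_sign i (i + 1) = - 1" by (simp add: nb_sign_def)
  have ji: "M (i + 1) * M i = (- 1) \<cdot>\<^sub>m (M i * M (i + 1))"
    using commute[OF j i] nb by (simp add: nb_sign_commute)
  \<comment> \<open>In the cubic relator the mixed products cancel. The coefficient of
    \<open>M i + M (i + 1)\<close> is 2 c^3 + 2 c^2 + c = 0, and that of the identity is 2 c^2 + 2 c
    + 1 = 0.\<close>
  have STS: "S * T * S = (2 * ?c ^ 3) \<cdot>\<^sub>m (M i + M (i + 1))"
    unfolding S_def T_def by (rule half_gen_triple[OF i j nb])
  have ST: "S * T = (?c * ?c) \<cdot>\<^sub>m (M i * M (i + 1)) + (?c * ?c) \<cdot>\<^sub>m M i + (?c * ?c) \<cdot>\<^sub>m M (i + 1) + (?c * ?c) \<cdot>\<^sub>m 1\<^sub>m d"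
    unfolding S_def T_def half_gen_def by (rule lin_mult[OF M N])
  have TS: "T * S = (?c * ?c) \<cdot>\<^sub>m (M (i + 1) * M i) + (?c * ?c) \<cdot>\<^sub>m M (i + 1) + (?c * ?c) \<cdot>\<^sub>m M i + (?c * ?c) \<cdot>\<^sub>m 1\<^sub>m d"
    unfolding S_def T_def half_gen_def by (rule lin_mult[OF N M])
  show "S * T * S + S * T + T * S + S + T + 1\<^sub>m d = 0\<^sub>m d d"
    unfolding STS unfolding ST TS ji unfolding S_def T_def half_gen_def tl_scale_powers using M N
    by (intro eq_matI) (auto simp: tl_scale_def field_simps simp del: index_mult_mat(1))
  have ST': "S + (- 1) \<cdot>\<^sub>m T = ?c \<cdot>\<^sub>m (M i + (- 1) \<cdot>\<^sub>m M (i + 1))"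
    unfolding S_def T_def half_gen_def using M N by (intro eq_matI) (auto simp: algebra_simps)
  have D: "M i + (- 1) \<cdot>\<^sub>m M (i + 1) \<in> carrier_mat d d" using M N by simp
  have "(M i + (- 1) \<cdot>\<^sub>m M (i + 1)) * (M i + (- 1) \<cdot>\<^sub>m M (i + 1)) = (- 2) \<cdot>\<^sub>m 1\<^sub>m d"
    using M N by (simp add: mult_add_distrib_mat[of _ d d _ d] add_mult_distrib_mat[of _ d d _ _ d]
        smult_mult_left[of _ d d _ d] smult_mult_right[of _ d d _ d] smult_smult_mat one_smult_mat
        add_smult_distrib_left_mat[of _ d d] square[OF i] square[OF j] ji)
      (auto intro!: eq_matI simp del: index_mult_mat(1))
  then have "(S + (- 1) \<cdot>\<^sub>m T) * (S + (- 1) \<cdot>\<^sub>m T) = \<i> \<cdot>\<^sub>m 1\<^sub>m d"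
    unfolding ST' smult_mult_left[OF D smult_carrier_mat[OF D]] smult_mult_right[OF D D]
    by (simp add: smult_smult_mat tl_scale_powers mult.assoc[symmetric])
  then show "(S + (- 1) \<cdot>\<^sub>m T) * (S + (- 1) \<cdot>\<^sub>m T) + (- 1) \<cdot>\<^sub>m (\<i> \<cdot>\<^sub>m 1\<^sub>m d) = 0\<^sub>m d d"
    by (auto intro!: eq_matI)
qed

text \<open>The matrices c (1 + M_i) define a braid group representation, which extends linearly,
  entry by entry, to the group algebra and kills the relators. Hence every such family comes from
  the Temperley-Lieb algebra, and representations can be built by writing down matrices.\<close>

lemma (in nb_clifford) ex_TL_rep:
  "\<exists>\<phi>. TL_rep n d \<phi> \<and> (\<forall>i\<in>{1..<n}. TL_gens n d \<phi> i = M i)"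
proof -
  interpret B: group "braid_group n" by (rule group_braid_group)
  define \<rho> where "\<rho> = pres_lift (GL d) (\<lambda>i. half_gen d tl_scale (M i))"
  have \<rho>_gen: "\<rho> (braid_gen n i) = half_gen d tl_scale (M i)" if "i \<in> {1..<n}" for i
    unfolding \<rho>_def by (rule braid_hom(2)[OF tl_scale_nonzero HOL.refl that])
  have \<rho>hom: "\<rho> \<in> hom (braid_group n) (GL d)"
    unfolding \<rho>_def by (rule braid_hom(1)[OF tl_scale_nonzero HOL.refl])
  interpret GL: group "GL d" by (rule group_GL)
  have \<rho>_one: "\<rho> \<one>\<^bsub>braid_group n\<^esub> = 1\<^sub>m d"
    using hom_one[OF \<rho>hom B.group_axioms GL.group_axioms] by (simp add: GL_one)
  have \<rho>_closed: "\<rho> x \<in> carrier_mat d d" if "x \<in> carrier (braid_group n)" for x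
    using hom_in_carrier[OF \<rho>hom that] GL_closed by blast
  have \<rho>_mult: "\<rho> (x \<otimes>\<^bsub>braid_group n\<^esub> y) = \<rho> x * \<rho> y"
    if "x \<in> carrier (braid_group n)" "y \<in> carrier (braid_group n)" for x y
    using hom_mult[OF \<rho>hom that] by (simp add: GL_mult)
  define \<theta> where "\<theta> f = mat d d (\<lambda>(i, j). ga_eval (\<lambda>g. \<rho> g $$ (i, j)) f)" for f
  have \<theta>_of: "\<theta> (ga_of x) = \<rho> x" if "x \<in> carrier (braid_group n)" for x
    using \<rho>_closed[OF that] by (intro eq_matI) (auto simp: \<theta>_def)
  interpret braid_alg_rep n d \<theta>
  proof
    show "\<theta> f \<in> carrier_mat d d" for f by (simp add: \<theta>_def)
    show "\<theta> \<one>\<^bsub>braid_algebra n\<^esub> = 1\<^sub>m d" by (simp add: ga_one \<theta>_of \<rho>_one)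
    fix f assume f: "f \<in> carrier (braid_algebra n)"
    show "\<theta> (c \<odot>\<^bsub>braid_algebra n\<^esub> f) = c \<cdot>\<^sub>m \<theta> f" for c
      by (intro eq_matI) (auto simp: \<theta>_def ga_eval_smult)
    fix g assume g: "g \<in> carrier (braid_algebra n)"
    show "\<theta> (f \<oplus>\<^bsub>braid_algebra n\<^esub> g) = \<theta> f + \<theta> g"
      using f g by (intro eq_matI) (auto simp: \<theta>_def ga_eval_oplus)
    show "\<theta> (f \<otimes>\<^bsub>braid_algebra n\<^esub> g) = \<theta> f * \<theta> g"
    proof (rule eq_matI)
      fix i j assume "i < dim_row (\<theta> f * \<theta> g)" "j < dim_col (\<theta> f * \<theta> g)"
      then have ij: "i < d" "j < d" by (simp_all add: \<theta>_def)
      have "\<theta> (f \<otimes>\<^bsub>braid_algebra n\<^esub> g) $$ (i, j)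
          = ga_eval (\<lambda>y. ga_eval (\<lambda>z. \<rho> (y \<otimes>\<^bsub>braid_group n\<^esub> z) $$ (i, j)) g) f"
        using f g ij by (simp add: \<theta>_def B.ga_eval_times)
      also have "\<dots> = ga_eval (\<lambda>y. ga_eval (\<lambda>z. \<Sum>k<d. \<rho> y $$ (i, k) * \<rho> z $$ (k, j)) g) f"
      proof (intro ga_eval_cong)
        fix y z assume "f y \<noteq> 0" "g z \<noteq> 0"
        then have yz: "y \<in> carrier (braid_group n)" "z \<in> carrier (braid_group n)"
          using f g by (auto simp: ga_carrier_iff)
        show "\<rho> (y \<otimes>\<^bsub>braid_group n\<^esub> z) $$ (i, j) = (\<Sum>k<d. \<rho> y $$ (i, k) * \<rho> z $$ (k, j))"
          using ij \<rho>_closed[OF yz(1)] \<rho>_closed[OF yz(2)]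
          by (simp add: \<rho>_mult[OF yz] scalar_prod_def lessThan_atLeast0)
      qed
      also have "\<dots> = (\<Sum>k<d. ga_eval (\<lambda>y. \<rho> y $$ (i, k)) f * ga_eval (\<lambda>z. \<rho> z $$ (k, j)) g)"
        by (simp add: ga_eval_sum_left ga_eval_mult_left mult.commute[of "\<rho> _ $$ _" "ga_eval _ _"])
           (simp add: mult.commute)
      also have "\<dots> = (\<theta> f * \<theta> g) $$ (i, j)"
        using ij by (simp add: \<theta>_def scalar_prod_def lessThan_atLeast0)
      finally show "\<theta> (f \<otimes>\<^bsub>braid_algebra n\<^esub> g) $$ (i, j) = (\<theta> f * \<theta> g) $$ (i, j)" .
    qed (simp_all add: \<theta>_def)
  qed
  interpret A: ring "braid_algebra n" by (rule ring_braid_algebra)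
  have \<theta>_gen: "\<theta> (ga_gen n i) = half_gen d tl_scale (M i)" if "i \<in> {1..<n}" for i
    using \<theta>_of[OF braid_gen_closed[OF that]] \<rho>_gen[OF that] by simp
  have gens: "gens i = M i" if "i \<in> {1..<n}" for i
    using nb_clifford.closed[OF nb_clifford_axioms that]
    by (auto simp: gens_def \<theta>_gen[OF that] half_gen_def tl_scale_def field_simps intro!: eq_matI)
  have "TL_alg_rep n d \<theta>"
  proof
    fix r assume "r \<in> TL_relators n"
    then show "\<theta> r = 0\<^sub>m d d"
    proof (cases rule: TL_relators_cases)
      case (quadratic i)
      then show ?thesis
        using half_gen_relations(1)[OF quadratic(1)] ga_gen_closed[OF quadratic(1)]
        by (simp add: hom_mult hom_add hom_minus hom_smult hom_one ga_smult_closed \<theta>_gen)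
    next
      case (cubic i)
      show ?thesis
        using half_gen_relations(2)[OF cubic(1,2)] ga_gen_closed[OF cubic(1)] ga_gen_closed[OF cubic(2)]
        unfolding cubic(3)
        by (simp only: hom_mult hom_add hom_one A.m_closed A.a_closed A.one_closed \<theta>_gen[OF cubic(1)] \<theta>_gen[OF cubic(2)])
    next
      case (square i)
      show ?thesis
        using half_gen_relations(3)[OF square(1,2)] ga_gen_closed[OF square(1)] ga_gen_closed[OF square(2)]
        unfolding square(3)
        by (simp only: hom_mult hom_minus hom_smult hom_one A.m_closed A.minus_closed A.one_closed
            ga_smult_closed \<theta>_gen[OF square(1)] \<theta>_gen[OF square(2)])
    qed
  qed
  from alg_rep_imp_TL_rep[OF this] obtain \<phi> where \<phi>: "TL_rep n d \<phi>"
      "\<And>f. f \<in> carrier (braid_algebra n) \<Longrightarrow> \<phi> (TL_proj n f) = \<theta> f" by blast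
  interpret \<phi>: TL_alg_rep n d "\<lambda>f. \<phi> (TL_proj n f)" by (rule TL_rep_imp_alg_rep[OF \<phi>(1)])
  have "TL_gens n d \<phi> i = M i" if "i \<in> {1..<n}" for i
    unfolding TL_gens_def \<phi>.gens_def \<phi>(2)[OF ga_gen_closed[OF that]]
    using gens[OF that] by (simp add: gens_def)
  then show ?thesis using \<phi>(1) by blast
qed

subsection \<open>Classification of the irreducible representations\<close>

lemma wmat_cong: "(\<And>i. i \<in> set w \<Longrightarrow> M i = M' i) \<Longrightarrow> wmat d M w = wmat d M' w"
  by (induction w) auto

lemma irr_family_cong:
  "(\<And>i. i \<in> I \<Longrightarrow> M i = M' i) \<Longrightarrow> irr_family I d M \<longleftrightarrow> irr_family I d M'"
  unfolding irr_family_def by simp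

lemma wmat_intertwine:
  assumes "nb_clifford n d V" "nb_clifford n d' W" "P \<in> carrier_mat d' d"
    and "\<And>i. i \<in> {1..<n} \<Longrightarrow> W i * P = P * V i" "set w \<subseteq> {1..<n}"
  shows "wmat d' W w * P = P * wmat d V w"
proof -
  interpret V: nb_clifford n d V by (rule assms(1))
  interpret W: nb_clifford n d' W by (rule assms(2))
  show ?thesis using assms(5)
  proof (induction w)
    case Nil
    then show ?case using assms(3) by (simp add: left_mult_one_mat[of _ d' d] right_mult_one_mat[of _ d' d])
  next
    case (Cons i w)
    have i: "i \<in> {1..<n}" and w: "set w \<subseteq> {1..<n}" using Cons.prems by auto
    note car = assms(3) V.closed[OF i] W.closed[OF i] V.wmat_closed[OF w] W.wmat_closed[OF w]
    have "(W i * wmat d' W w) * P = W i * (wmat d' W w * P)"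
      by (rule assoc_mult_mat[OF car(3,5,1)])
    also have "\<dots> = W i * (P * wmat d V w)" using Cons.IH[OF w] by simp
    also have "\<dots> = (W i * P) * wmat d V w" by (rule assoc_mult_mat[OF car(3,1,4), symmetric])
    also have "\<dots> = P * (V i * wmat d V w)"
      unfolding assms(4)[OF i] by (rule assoc_mult_mat[OF car(1,2,4)])
    finally show ?case by simp
  qed
qed

lemma invertible_mat_nonzero:
  fixes P :: "complex mat"
  assumes P: "P \<in> carrier_mat k l" and inv: "invertible_mat P" and k: "k > 0"
  shows "P \<noteq> 0\<^sub>m k l"
proof
  assume 0: "P = 0\<^sub>m k l"
  obtain Q where Q: "P * Q = 1\<^sub>m k" "Q * P = 1\<^sub>m (dim_row Q)"
    using P inv unfolding invertible_mat_def inverts_mat_def by auto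
  have "dim_col (P * Q) = k" "dim_col (Q * P) = dim_row Q" using Q by simp_all
  then have "Q \<in> carrier_mat l k" using P by auto
  then have "P * Q = 0\<^sub>m k k" unfolding 0 by (rule left_mult_zero_mat)
  then have "(1\<^sub>m k :: complex mat) $$ (0, 0) = 0\<^sub>m k k $$ (0, 0)" unfolding Q(1) by simp
  then show False using k by simp
qed

text \<open>The scalar by which the central word acts, read off in the corner. It has this meaning
  for even n and irreducible representations, whose positive dimension makes the corner entry
  available.\<close>

definition central_char :: "nat \<Rightarrow> nat \<Rightarrow> ((nat gword set \<Rightarrow> complex) set \<Rightarrow> complex mat) \<Rightarrow> complex" where
  "central_char n d \<phi> = wmat d (TL_gens n d \<phi>) (odd_word n) $$ (0, 0)"

lemma central_char:
  assumes "TL_irrep n d \<phi>" "even n"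
  shows "wmat d (TL_gens n d \<phi>) (odd_word n) = central_char n d \<phi> \<cdot>\<^sub>m 1\<^sub>m d"
    and "(central_char n d \<phi>)\<^sup>2 = (- 1) ^ length (odd_word n)" "central_char n d \<phi> \<noteq> 0"
proof -
  have rep: "TL_rep n d \<phi>" and irr: "irr_family {1..<n} d (TL_gens n d \<phi>)"
    using assms(1) by (auto simp: TL_irrep_iff)
  interpret nb_clifford n d "TL_gens n d \<phi>" by (rule TL_gens_clifford[OF rep])
  obtain c where c: "c\<^sup>2 = (- 1) ^ length (odd_word n)"
      "wmat d (TL_gens n d \<phi>) (odd_word n) = c \<cdot>\<^sub>m 1\<^sub>m d"
    using odd_word_scalar[OF irr assms(2)] by blast
  have "d > 0" using irr by (simp add: irr_family_def)
  then have "central_char n d \<phi> = c" by (simp add: central_char_def c(2))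
  then show "wmat d (TL_gens n d \<phi>) (odd_word n) = central_char n d \<phi> \<cdot>\<^sub>m 1\<^sub>m d"
    "(central_char n d \<phi>)\<^sup>2 = (- 1) ^ length (odd_word n)" "central_char n d \<phi> \<noteq> 0"
    using c by auto
qed

text \<open>An invertible intertwiner forces equal scalars for the central word. Conversely, equal
  scalars are what the averaging argument needs to produce a nonzero intertwiner, which the Schur
  lemma makes invertible. For odd n there is no condition, hence one class.\<close>

lemma TL_irrep_iso_iff:
  assumes "TL_irrep n d \<phi>" "TL_irrep n d' \<phi>'"
  shows "TL_rep_iso n d \<phi> d' \<phi>' \<longleftrightarrow> (even n \<longrightarrow> central_char n d \<phi> = central_char n d' \<phi>')"
proof -
  let ?V = "TL_gens n d \<phi>" and ?W = "TL_gens n d' \<phi>'"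
  have rep: "TL_rep n d \<phi>" "TL_rep n d' \<phi>'"
    and irr: "irr_family {1..<n} d ?V" "irr_family {1..<n} d' ?W"
    using assms by (auto simp: TL_irrep_iff)
  have pos: "d > 0" "d' > 0" using irr by (auto simp: irr_family_def)
  interpret nb_clifford_pair n d ?V d' ?W
    unfolding nb_clifford_pair_def using TL_gens_clifford rep by blast
  show ?thesis
  proof
    assume "TL_rep_iso n d \<phi> d' \<phi>'"
    then obtain P where P: "d = d'" "P \<in> carrier_mat d' d" "invertible_mat P"
        "\<And>i. i \<in> {1..<n} \<Longrightarrow> ?W i * P = P * ?V i"
      using rep by (auto simp: TL_rep_iso_iff)
    show "even n \<longrightarrow> central_char n d \<phi> = central_char n d' \<phi>'"
    proof
      assume n: "even n"
      have "wmat d' ?W (odd_word n) * P = P * wmat d ?V (odd_word n)"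
        by (rule wmat_intertwine[OF V.nb_clifford_axioms W.nb_clifford_axioms P(2,4) odd_word_subset])
      then have e: "central_char n d' \<phi>' \<cdot>\<^sub>m P = central_char n d \<phi> \<cdot>\<^sub>m P"
        unfolding central_char(1)[OF assms(1) n] central_char(1)[OF assms(2) n]
        using P(2) by (simp add: smult_mult_left[of _ d' d' _ d] smult_mult_right[of _ d' d _ d]
            left_mult_one_mat[of _ d' d] right_mult_one_mat[of _ d' d])
      have "\<exists>i<d'. \<exists>j<d. P $$ (i, j) \<noteq> 0"
      proof (rule ccontr)
        assume "\<not> ?thesis"
        then have "P = 0\<^sub>m d' d" using P(2) by (intro eq_matI) auto
        then show False using invertible_mat_nonzero[OF P(2,3) pos(2)] by blast
      qed
      then obtain i j where ij: "i < d'" "j < d" "P $$ (i, j) \<noteq> 0" by blast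
      have "(central_char n d' \<phi>' \<cdot>\<^sub>m P) $$ (i, j) = (central_char n d \<phi> \<cdot>\<^sub>m P) $$ (i, j)"
        unfolding e ..
      then show "central_char n d \<phi> = central_char n d' \<phi>'" using ij P(2) by simp
    qed
  next
    assume ch: "even n \<longrightarrow> central_char n d \<phi> = central_char n d' \<phi>'"
    obtain P where P: "P \<in> carrier_mat d' d" "P \<noteq> 0\<^sub>m d' d" "\<And>i. i \<in> {1..<n} \<Longrightarrow> ?W i * P = P * ?V i"
    proof -
      have "\<exists>c. c \<noteq> 0 \<and> wmat d ?V (odd_word n) = c \<cdot>\<^sub>m 1\<^sub>m d \<and> wmat d' ?W (odd_word n) = c \<cdot>\<^sub>m 1\<^sub>m d'"
        if n: "even n"
        using central_char[OF assms(1) n] central_char[OF assms(2) n] ch n by metis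
      then show thesis using ex_nonzero_intertwiner[OF pos] that by blast
    qed
    have "d' = d" "invertible_mat P"
      by (rule schur_iso[OF irr V.closed W.closed P(1,3,2)]; assumption)+
    then show "TL_rep_iso n d \<phi> d' \<phi>'"
      unfolding TL_rep_iso_iff[OF rep] using P by auto
  qed
qed

lemma TL_irrep_exists:
  "\<exists>\<phi>. TL_irrep n (2 ^ ((n - 1) div 2)) \<phi>"
proof -
  let ?m = "(n - 1) div 2"
  interpret nb_clifford n "2 ^ ?m" "std_gen ?m" by (rule std_clifford) simp
  obtain \<phi> where \<phi>: "TL_rep n (2 ^ ?m) \<phi>" "\<And>i. i \<in> {1..<n} \<Longrightarrow> TL_gens n (2 ^ ?m) \<phi> i = std_gen ?m i"
    using ex_TL_rep by blast
  then show ?thesis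
    using std_irr[of ?m n] irr_family_cong[of "{1..<n}" "TL_gens n (2 ^ ?m) \<phi>" "std_gen ?m"]
    by (auto simp: TL_irrep_iff)
qed

text \<open>Realised by negating the last generator, which preserves the relations.\<close>

lemma TL_irrep_negated:
  assumes "TL_irrep n d \<phi>" "even n" "n \<ge> 2"
  shows "\<exists>\<phi>'. TL_irrep n d \<phi>' \<and> central_char n d \<phi>' = - central_char n d \<phi>"
proof -
  let ?V = "TL_gens n d \<phi>"
  have rep: "TL_rep n d \<phi>" and irr: "irr_family {1..<n} d ?V" using assms(1) by (auto simp: TL_irrep_iff)
  interpret V: nb_clifford n d ?V by (rule TL_gens_clifford[OF rep])
  define s :: "nat \<Rightarrow> complex" where "s i = (if i = n - 1 then - 1 else 1)" for i
  define W where "W i = s i \<cdot>\<^sub>m ?V i" for i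
  have s: "s i * s i = 1" for i by (simp add: s_def)
  interpret W: nb_clifford n d W
  proof
    fix i assume i: "i \<in> {1..<n}"
    note Vi = V.closed[OF i]
    show "W i \<in> carrier_mat d d" using Vi by (simp add: W_def)
    show "W i * W i = (- 1) \<cdot>\<^sub>m 1\<^sub>m d"
      using Vi by (simp add: W_def smult_mult_left[of _ d d _ d] smult_mult_right[of _ d d _ d]
          V.square[OF i] smult_smult_mat s)
    fix j assume j: "j \<in> {1..<n}"
    note Vj = V.closed[OF j]
    show "W i * W j = nb_sign i j \<cdot>\<^sub>m (W j * W i)"
      using Vi Vj by (simp add: W_def smult_mult_left[of _ d d _ d] smult_mult_right[of _ d d _ d]
          V.commute[OF i j] smult_smult_mat mult.commute mult.left_commute)
  qed
  have "irr_family {1..<n} d W"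
    unfolding irr_family_def
  proof (intro conjI allI impI)
    show "d > 0" using irr by (simp add: irr_family_def)
    fix U assume U: "subspace_vec d U \<and> (\<forall>i\<in>{1..<n}. \<forall>w\<in>U. W i *\<^sub>v w \<in> U)"
    show "U = {0\<^sub>v d} \<or> U = carrier_vec d"
    proof (rule irr_familyD[OF irr])
      show "subspace_vec d U" using U by blast
      fix i w assume i: "i \<in> {1..<n}" and w: "w \<in> U"
      have wc: "w \<in> carrier_vec d" using w U subspace_vecD(1) by blast
      have "s i \<cdot>\<^sub>v (W i *\<^sub>v w) \<in> U" using U i w subspace_vecD(4) by blast
      also have "s i \<cdot>\<^sub>v (W i *\<^sub>v w) = ?V i *\<^sub>v w"
        using V.closed[OF i] wc by (simp add: W_def smult_mat_vec[of _ d d] smult_smult_assoc s)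
      finally show "?V i *\<^sub>v w \<in> U" .
    qed
  qed
  moreover obtain \<phi>' where \<phi>': "TL_rep n d \<phi>'" "\<And>i. i \<in> {1..<n} \<Longrightarrow> TL_gens n d \<phi>' i = W i"
    using W.ex_TL_rep by blast
  ultimately have irr': "TL_irrep n d \<phi>'"
    using irr_family_cong[of "{1..<n}" "TL_gens n d \<phi>'" W] by (auto simp: TL_irrep_iff)
  have d: "d > 0" using irr by (simp add: irr_family_def)
  \<comment> \<open>For even n the odd letter n - 1 closes the central word and occurs in it once,
    so negating M_(n - 1) negates the scalar.\<close>
  define u where "u = filter odd [1..<n - 1]"
  have u: "odd_word n = u @ [n - 1]" "set u \<subseteq> {1..<n}" "n - 1 \<in> {1..<n}" "n - 1 \<notin> set u"
    using assms(2,3) upt_Suc_append[of 1 "n - 1"] by (auto simp: odd_word_def u_def)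
  have wu: "wmat d W u = wmat d ?V u"
    using u(4) by (intro wmat_cong) (auto simp: W_def s_def one_smult_mat)
  have "wmat d (TL_gens n d \<phi>') (odd_word n) = wmat d W (odd_word n)"
    using \<phi>'(2) odd_word_subset by (intro wmat_cong) blast
  also have "\<dots> = (- 1) \<cdot>\<^sub>m wmat d ?V (odd_word n)"
    using u V.closed[OF u(3)] V.wmat_closed[OF u(2)] W.closed[OF u(3)]
    by (simp add: W.wmat_append V.wmat_append wu right_mult_one_mat[of _ d d])
       (simp add: W_def s_def smult_mult_right[of _ d d _ d] right_mult_one_mat[of _ d d])
  finally have "central_char n d \<phi>' = - central_char n d \<phi>"
    using d V.wmat_closed[OF odd_word_subset] unfolding central_char_def by simp
  then show ?thesis using irr' by blast
qed

text \<open>For even n all central scalars have the same square, so that of \<open>\<phi>\<close> is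
  the one of the explicit representation or its negative, and both occur in the explicit dimension.
  Isomorphism carries the dimension over; for odd n it is automatic.\<close>

lemma TL_irrep_dim:
  assumes "TL_irrep n d \<phi>" "n \<ge> 2"
  shows "d = 2 ^ ((n - 1) div 2)"
proof -
  let ?d = "2 ^ ((n - 1) div 2)"
  obtain \<phi>0 where 0: "TL_irrep n ?d \<phi>0" using TL_irrep_exists by blast
  have "\<exists>\<psi>. TL_irrep n ?d \<psi> \<and> (even n \<longrightarrow> central_char n d \<phi> = central_char n ?d \<psi>)"
  proof (cases "even n")
    case True
    obtain \<phi>1 where 1: "TL_irrep n ?d \<phi>1" "central_char n ?d \<phi>1 = - central_char n ?d \<phi>0"
      using TL_irrep_negated[OF 0 True assms(2)] by blast
    have "(central_char n d \<phi>)\<^sup>2 = (central_char n ?d \<phi>0)\<^sup>2"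
      using central_char(2)[OF assms(1) True] central_char(2)[OF 0 True] by simp
    then have "central_char n d \<phi> = central_char n ?d \<phi>0 \<or> central_char n d \<phi> = - central_char n ?d \<phi>0"
      by (simp add: power2_eq_iff)
    then show ?thesis using 0 1 by metis
  qed (use 0 in blast)
  then obtain \<psi> where \<psi>: "TL_irrep n ?d \<psi>" "even n \<longrightarrow> central_char n d \<phi> = central_char n ?d \<psi>" by blast
  have "TL_rep_iso n d \<phi> ?d \<psi>" using TL_irrep_iso_iff[OF assms(1) \<psi>(1)] \<psi>(2) by blast
  then show ?thesis by (simp add: TL_rep_iso_def)
qed

lemma TL_irrep_listD:
  assumes "TL_irrep_list n L"
  shows "k < length L \<Longrightarrow> TL_irrep n (fst (L ! k)) (snd (L ! k))"
    and "k < length L \<Longrightarrow> l < length L \<Longrightarrow> k \<noteq> l \<Longrightarrow>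
      \<not> TL_rep_iso n (fst (L ! k)) (snd (L ! k)) (fst (L ! l)) (snd (L ! l))"
    and "TL_irrep n d \<phi> \<Longrightarrow> \<exists>k<length L. TL_rep_iso n d \<phi> (fst (L ! k)) (snd (L ! k))"
proof -
  show "TL_irrep n (fst (L ! k)) (snd (L ! k))" if "k < length L"
    using assms nth_mem[OF that] unfolding TL_irrep_list_def by (auto simp: case_prod_beta)
  show "\<not> TL_rep_iso n (fst (L ! k)) (snd (L ! k)) (fst (L ! l)) (snd (L ! l))"
    if "k < length L" "l < length L" "k \<noteq> l"
    using assms that unfolding TL_irrep_list_def by blast
  show "\<exists>k<length L. TL_rep_iso n d \<phi> (fst (L ! k)) (snd (L ! k))" if "TL_irrep n d \<phi>"
  proof -
    have "\<exists>p\<in>set L. TL_rep_iso n d \<phi> (fst p) (snd p)"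
      using assms that unfolding TL_irrep_list_def by (simp add: case_prod_beta)
    then show ?thesis by (metis in_set_conv_nth)
  qed
qed

text \<open>This existence statement is what allows the choice operator in \<open>jones_rep\<close>
  to be opened.\<close>

lemma ex_TL_irrep_list:
  assumes "n \<ge> 2"
  shows "\<exists>L. TL_irrep_list n L"
proof -
  let ?d = "2 ^ ((n - 1) div 2)"
  obtain \<phi>0 where 0: "TL_irrep n ?d \<phi>0" using TL_irrep_exists by blast
  show ?thesis
  proof (cases "even n")
    case False
    have "TL_irrep_list n [(?d, \<phi>0)]"
      unfolding TL_irrep_list_def using 0 TL_irrep_iso_iff[OF _ 0] False by auto
    then show ?thesis by blast
  next
    case True
    obtain \<phi>1 where 1: "TL_irrep n ?d \<phi>1" "central_char n ?d \<phi>1 = - central_char n ?d \<phi>0"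
      using TL_irrep_negated[OF 0 True assms] by blast
    have ne: "central_char n ?d \<phi>0 \<noteq> 0" by (rule central_char(3)[OF 0 True])
    have "central_char n d \<phi> = central_char n ?d \<phi>0 \<or> central_char n d \<phi> = - central_char n ?d \<phi>0"
      if "TL_irrep n d \<phi>" for d \<phi>
      using central_char(2)[OF that True] central_char(2)[OF 0 True] by (simp add: power2_eq_iff[symmetric])
    then have "\<forall>d \<phi>. TL_irrep n d \<phi> \<longrightarrow> TL_rep_iso n d \<phi> ?d \<phi>0 \<or> TL_rep_iso n d \<phi> ?d \<phi>1"
      using TL_irrep_iso_iff[OF _ 0] TL_irrep_iso_iff[OF _ 1(1)] 1(2) by metis
    moreover have "\<not> TL_rep_iso n ?d \<phi>0 ?d \<phi>1" "\<not> TL_rep_iso n ?d \<phi>1 ?d \<phi>0"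
      using TL_irrep_iso_iff[OF 0 1(1)] TL_irrep_iso_iff[OF 1(1) 0] 1(2) ne True by auto
    ultimately have "TL_irrep_list n [(?d, \<phi>0), (?d, \<phi>1)]"
      unfolding TL_irrep_list_def using 0 1(1) by (auto simp: less_Suc_eq numeral_2_eq_2)
    then show ?thesis by blast
  qed
qed

subsection \<open>Traces of the irreducible representations\<close>

definition list_trace :: "nat \<Rightarrow> (nat \<times> ((nat gword set \<Rightarrow> complex) set \<Rightarrow> complex mat)) list \<Rightarrow> nat list \<Rightarrow> complex" where
  "list_trace n L w = (\<Sum>(d, \<phi>)\<leftarrow>L. mat_trace (wmat d (TL_gens n d \<phi>) w))"

lemma TL_irrep_trace:
  assumes "TL_irrep n d \<phi>" "sorted_wrt (<) w" "set w \<subseteq> {1..<n}" "w \<noteq> []"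
  shows "mat_trace (wmat d (TL_gens n d \<phi>) w)
    = (if even n \<and> w = odd_word n then central_char n d \<phi> * of_nat d else 0)"
proof -
  have "TL_rep n d \<phi>" using assms(1) by (simp add: TL_irrep_iff)
  then interpret nb_clifford n d "TL_gens n d \<phi>" by (rule TL_gens_clifford)
  show ?thesis
  proof (cases "even n \<and> w = odd_word n")
    case True
    then show ?thesis
      using central_char(1)[OF assms(1)] by (simp add: mat_trace_smult[OF one_carrier_mat] mat_trace_one)
  next
    case False
    then show ?thesis using anticommuting_letter_or_odd_word[OF assms(2-4)] trace_zero[OF _ assms(3)] by auto
  qed
qed

lemma list_trace_sum:
  "list_trace n L w = (\<Sum>k<length L. mat_trace (wmat (fst (L ! k)) (TL_gens n (fst (L ! k)) (snd (L ! k))) w))"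
  unfolding list_trace_def by (simp add: sum_list_sum_nth case_prod_beta lessThan_atLeast0)

text \<open>The list is an arbitrary complete one, so its index set is first pinned down as
  \<open>{k}\<close> or \<open>{k, l}\<close> by the isomorphism criterion. For even n the opposite
  scalars of \<open>k\<close> and \<open>l\<close> cancel on the central word.\<close>

lemma list_trace_sorted:
  assumes L: "TL_irrep_list n L" and n: "n \<ge> 2" and w: "sorted_wrt (<) w" "set w \<subseteq> {1..<n}"
  shows "list_trace n L w = (if w = [] then 2 ^ (n div 2) else 0)"
proof -
  let ?d = "2 ^ ((n - 1) div 2)"
  note irr = TL_irrep_listD(1)[OF L] and niso = TL_irrep_listD(2)[OF L] and compl = TL_irrep_listD(3)[OF L]
  have dim: "fst (L ! k) = ?d" if "k < length L" for k
    using TL_irrep_dim[OF irr[OF that] n] .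
  define tr where "tr k = mat_trace (wmat (fst (L ! k)) (TL_gens n (fst (L ! k)) (snd (L ! k))) w)" for k
  define ch where "ch k = central_char n (fst (L ! k)) (snd (L ! k))" for k
  have tr: "tr k = (if w = [] then of_nat ?d else if even n \<and> w = odd_word n then ch k * of_nat ?d else 0)"
    if "k < length L" for k
    using TL_irrep_trace[OF irr[OF that] w] dim[OF that] unfolding tr_def ch_def
    by (cases "w = []") (auto simp: mat_trace_one)
  have sum: "list_trace n L w = (\<Sum>k<length L. tr k)" unfolding list_trace_sum tr_def ..
  obtain \<phi>0 where 0: "TL_irrep n ?d \<phi>0" using TL_irrep_exists by blast
  obtain k where k: "k < length L" "TL_rep_iso n ?d \<phi>0 (fst (L ! k)) (snd (L ! k))" using compl[OF 0] by blast
  show ?thesis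
  proof (cases "even n")
    case False
    have "{..<length L} = {k}"
      using k(1) niso[of _ k] TL_irrep_iso_iff[OF irr irr[OF k(1)]] False by blast
    moreover have "(n - 1) div 2 = n div 2" using False by (auto elim!: oddE)
    ultimately show ?thesis using tr[OF k(1)] False by (simp add: sum)
  next
    case True
    obtain \<phi>1 where 1: "TL_irrep n ?d \<phi>1" "central_char n ?d \<phi>1 = - central_char n ?d \<phi>0"
      using TL_irrep_negated[OF 0 True n] by blast
    obtain l where l: "l < length L" "TL_rep_iso n ?d \<phi>1 (fst (L ! l)) (snd (L ! l))" using compl[OF 1(1)] by blast
    have chk: "ch k = central_char n ?d \<phi>0" and chl: "ch l = - central_char n ?d \<phi>0"
      using TL_irrep_iso_iff[OF 0 irr[OF k(1)]] k TL_irrep_iso_iff[OF 1(1) irr[OF l(1)]] l 1(2) True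
      by (auto simp: ch_def)
    have kl: "k \<noteq> l" using chk chl central_char(3)[OF 0 True] by auto
    have "p = k \<or> p = l" if p: "p < length L" for p
    proof -
      have "(ch p)\<^sup>2 = (central_char n ?d \<phi>0)\<^sup>2"
        using central_char(2)[OF irr[OF p] True] central_char(2)[OF 0 True] by (simp add: ch_def)
      then have "ch p = ch k \<or> ch p = ch l" using chk chl by (simp add: power2_eq_iff)
      then show ?thesis
        using niso[OF p k(1)] niso[OF p l(1)] TL_irrep_iso_iff[OF irr[OF p] irr[OF k(1)]]
          TL_irrep_iso_iff[OF irr[OF p] irr[OF l(1)]] unfolding ch_def by blast
    qed
    then have "{..<length L} = {k, l}" using k(1) l(1) by auto
    then have "list_trace n L w = tr k + tr l" using kl by (simp add: sum)
    moreover have "2 * (2 :: complex) ^ ((n - 1) div 2) = 2 ^ (n div 2)"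
    proof -
      have "n div 2 = Suc ((n - 1) div 2)" using True n by (auto elim!: evenE)
      then show ?thesis by simp
    qed
    ultimately show ?thesis using tr[OF k(1)] tr[OF l(1)] chk chl by auto
  qed
qed

subsection \<open>The Yang-Baxter representation\<close>

text \<open>The matrix sqrt 2 R - 1 has only the antidiagonal entries 1, -1, 1, -1 (from the top):
  it flips both strands, with a sign read from the left one. Under the left-into-right convention
  the first tensor factor is the lowest bit, so strands i and i + 1 are the bits
  \<open>i - 1\<close> and \<open>i\<close>.\<close>

definition YB_root :: "nat \<Rightarrow> nat \<Rightarrow> complex mat" where
  "YB_root n i = mono_mat (2 ^ n) (\<lambda>x. flip_bit (i - 1) (flip_bit i x)) (\<lambda>x. if bit x (i - 1) then 1 else - 1)"

text \<open>Each generator flips the bit that decides its own sign, whence the square -1. Of two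
  adjacent generators, the one with larger index reads a bit flipped by the other but not
  conversely, which yields exactly one sign.\<close>

lemma YB_root_clifford: "nb_clifford n (2 ^ n) (YB_root n)"
  unfolding YB_root_def
proof (rule nb_clifford_monoI)
  fix i x assume i: "i \<in> {1..<n}" and x: "x < (2 :: nat) ^ n"
  show "flip_bit (i - 1) (flip_bit i x) < 2 ^ n" using i x by (intro flip_bit_less) auto
  show "flip_bit (i - 1) (flip_bit i (flip_bit (i - 1) (flip_bit i x))) = x"
    by (rule bit_eqI) (simp add: bit_flip_bit_nat)
  show "(if bit (flip_bit (i - 1) (flip_bit i x)) (i - 1) then 1 else - 1)
      * (if bit x (i - 1) then 1 else - 1 :: complex) = - 1"
    using i by (auto simp: bit_flip_bit_nat)
  fix j assume j: "j \<in> {1..<n}"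
  show "flip_bit (i - 1) (flip_bit i (flip_bit (j - 1) (flip_bit j x)))
      = flip_bit (j - 1) (flip_bit j (flip_bit (i - 1) (flip_bit i x)))"
    by (rule bit_eqI) (simp add: bit_flip_bit_nat)
  show "(if bit (flip_bit (j - 1) (flip_bit j x)) (i - 1) then 1 else - 1) * (if bit x (j - 1) then 1 else - 1)
      = nb_sign i j * ((if bit (flip_bit (i - 1) (flip_bit i x)) (j - 1) then 1 else - 1)
        * (if bit x (i - 1) then 1 else - 1))"
  proof -
    consider "i = j" | "i = Suc j" | "j = Suc i" | "i \<noteq> j" "i \<noteq> Suc j" "j \<noteq> Suc i" by blast
    then show ?thesis
      using i j by cases (auto simp: nb_sign_def bit_flip_bit_nat)
  qed
qed

text \<open>The smallest letter of a strictly increasing word is the only one that changes its lower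
  strand, so the underlying permutation has no fixed point.\<close>

lemma YB_root_trace:
  assumes w: "sorted_wrt (<) w" "set w \<subseteq> {1..<n}"
  shows "mat_trace (wmat (2 ^ n) (YB_root n) w) = (if w = [] then 2 ^ n else 0)"
proof (cases w)
  case Nil
  then show ?thesis by (simp add: mat_trace_one)
next
  case (Cons a v)
  define step where "step i x = flip_bit (i - 1) (flip_bit i (x :: nat))" for i x
  have step_less: "step i x < 2 ^ n" if "i \<in> {1..<n}" "x < 2 ^ n" for i x
    using that unfolding step_def by (intro flip_bit_less) auto
  have mono: "\<exists>s. wmat (2 ^ n) (YB_root n) u = mono_mat (2 ^ n) (\<lambda>x. foldr step u x) s
      \<and> (\<forall>x < 2 ^ n. foldr step u x < 2 ^ n)" if "set u \<subseteq> {1..<n}" for u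
    using that
  proof (induction u)
    case Nil
    show ?case by (auto simp: mono_mat_one)
  next
    case (Cons i u)
    then obtain s where s: "wmat (2 ^ n) (YB_root n) u = mono_mat (2 ^ n) (\<lambda>x. foldr step u x) s"
        "\<And>x. x < 2 ^ n \<Longrightarrow> foldr step u x < 2 ^ n" by auto
    obtain t where t: "YB_root n i = mono_mat (2 ^ n) (step i) t"
      unfolding YB_root_def step_def by blast
    have "wmat (2 ^ n) (YB_root n) (i # u)
        = mono_mat (2 ^ n) (\<lambda>x. step i (foldr step u x)) (\<lambda>x. t (foldr step u x) * s x)"
      unfolding wmat.simps s(1) t by (rule mono_mat_mult) (rule s(2))
    moreover have "foldr step (i # u) x < 2 ^ n" if "x < 2 ^ n" for x
      using step_less s(2)[OF that] Cons.prems by simp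
    ultimately show ?case by auto
  qed
  have a: "a \<ge> 1" "\<forall>i\<in>set v. a < i" using w Cons by auto
  have keep: "bit (foldr step u x) (a - 1) = bit x (a - 1)" if "\<forall>i\<in>set u. a < i" for u x
    using that
  proof (induction u)
    case (Cons i u)
    then have "a - 1 \<noteq> i - 1" "a - 1 \<noteq> i" using a(1) by auto
    then show ?case using Cons by (simp add: step_def bit_flip_bit_nat)
  qed simp
  have "bit (foldr step w x) (a - 1) \<noteq> bit x (a - 1)" for x
  proof -
    have "a - 1 \<noteq> a" using a(1) by linarith
    then show ?thesis using keep[OF a(2), of x] by (simp add: Cons step_def bit_flip_bit_nat)
  qed
  then have "foldr step w x \<noteq> x" for x by metis
  then show ?thesis using mono[OF w(2)] Cons by (auto simp: mono_mat_trace)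
qed

section \<open>Tensor products in terms of the bits of the index\<close>

lemma tensor_mat_dim [simp]:
  "dim_row (tensor_mat X A) = dim_row A * dim_row X" "dim_col (tensor_mat X A) = dim_col A * dim_col X"
  by (simp_all add: tensor_mat_def)

lemma tensor_mat_index:
  "i < dim_row A * dim_row X \<Longrightarrow> j < dim_col A * dim_col X \<Longrightarrow> tensor_mat X A $$ (i, j)
    = A $$ (i div dim_row X, j div dim_col X) * X $$ (i mod dim_row X, j mod dim_col X)"
  by (simp add: tensor_mat_def)

lemma tensor_pow_one: "tensor_pow (1\<^sub>m 2) k = (1\<^sub>m (2 ^ k) :: complex mat)"
proof (induction k)
  case (Suc k)
  show ?case
    unfolding tensor_pow.simps Suc
  proof (rule eq_matI)
    fix i j assume "i < dim_row (1\<^sub>m (2 ^ Suc k) :: complex mat)" "j < dim_col (1\<^sub>m (2 ^ Suc k) :: complex mat)"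
    then have ij: "i < 2 * 2 ^ k" "j < 2 * 2 ^ k" by simp_all
    have "tensor_mat (1\<^sub>m (2 ^ k)) (1\<^sub>m 2) $$ (i, j) = (if i div 2 ^ k = j div 2 ^ k then 1 else 0)
        * (if i mod 2 ^ k = j mod 2 ^ k then 1 else 0 :: complex)"
      using ij by (subst tensor_mat_index) (simp_all add: less_mult_imp_div_less)
    moreover have "i = j \<longleftrightarrow> i div 2 ^ k = j div 2 ^ k \<and> i mod 2 ^ k = j mod 2 ^ k"
      by (metis div_mult_mod_eq)
    ultimately show "tensor_mat (1\<^sub>m (2 ^ k)) (1\<^sub>m 2) $$ (i, j) = (1\<^sub>m (2 ^ Suc k) :: complex mat) $$ (i, j)"
      using ij by auto
  qed simp_all
qed (simp add: One_nat_def)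

lemma R_mat_dim [simp]: "dim_row R_mat = 4" "dim_col R_mat = 4"
  by (simp_all add: R_mat_def mat_of_rows_list_def)

text \<open>Row and column are written in bits, low bit first; the low bit belongs to the left
  strand and decides the sign of the flipping entries.\<close>

lemma R_mat_index:
  "R_mat $$ (of_bool a + 2 * of_bool b, of_bool a' + 2 * of_bool b')
    = complex_of_real (1 / sqrt 2) * (if a = a' \<and> b = b' then 1
        else if a \<noteq> a' \<and> b \<noteq> b' then (if a' then 1 else - 1) else 0)"
  by (cases a; cases b; cases a'; cases b')
    (simp_all add: R_mat_def mat_of_rows_list_def numeral_2_eq_2 numeral_3_eq_3 One_nat_def)

lemma div_mod_4_bits: "(x :: nat) div 2 ^ k mod 4 = of_bool (bit x k) + 2 * of_bool (bit x (Suc k))"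
proof -
  have "y mod 4 = of_bool (odd y) + 2 * of_bool (odd (y div 2))" for y :: nat
    by (cases "odd y"; cases "odd (y div 2)"; simp; presburger)
  from this[of "x div 2 ^ k"] show ?thesis
    by (simp add: bit_iff_odd div_mult2_eq[symmetric] mult.commute)
qed

text \<open>The index is cut as in the tensor product: the strands to the left, the two strands on
  which R acts, and the strands to the right.\<close>

lemma nat_eq_iff_parts:
  "(x :: nat) = y \<longleftrightarrow> x mod 2 ^ k = y mod 2 ^ k \<and> bit x k = bit y k \<and> bit x (Suc k) = bit y (Suc k)
    \<and> x div 2 ^ (k + 2) = y div 2 ^ (k + 2)"
proof
  assume *: "x mod 2 ^ k = y mod 2 ^ k \<and> bit x k = bit y k \<and> bit x (Suc k) = bit y (Suc k)
    \<and> x div 2 ^ (k + 2) = y div 2 ^ (k + 2)"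
  show "x = y"
  proof (rule bit_eqI)
    fix l
    consider "l < k" | "l = k" | "l = Suc k" | m where "l = k + 2 + m"
      by (metis Suc_lessI add_2_eq_Suc' le_Suc_ex not_less_eq_eq not_le less_Suc_eq)
    then show "bit x l \<longleftrightarrow> bit y l"
    proof cases
      case 1
      have "bit (take_bit k x) l = bit (take_bit k y) l" using * by (simp add: take_bit_eq_mod)
      then show ?thesis using 1 by (simp add: bit_take_bit_iff)
    next
      case 4
      have "bit (drop_bit (k + 2) x) m = bit (drop_bit (k + 2) y) m" using * by (simp add: drop_bit_eq_div)
      then show ?thesis using 4 by (simp add: bit_drop_bit_eq)
    qed (use * in auto)
  qed
qed simp

lemma YB_gen_eq:
  assumes i: "i \<in> {1..<n}"
  shows "YB_gen n i = half_gen (2 ^ n) (complex_of_real (1 / sqrt 2)) (YB_root n i)"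
proof (rule eq_matI)
  define k where "k = i - 1"
  define h where "h = n - i - 1"
  have ik: "i = Suc k" and n: "n = k + 2 + h" using i by (auto simp: k_def h_def)
  have dims: "2 ^ n = 2 ^ h * (4 * 2 ^ k :: nat)" by (simp add: n power_add)
  let ?R = "tensor_mat (1\<^sub>m (2 ^ k)) R_mat"
  have Y: "YB_gen n i = tensor_mat ?R (1\<^sub>m (2 ^ h))"
    unfolding YB_gen_def tensor_pow_one k_def h_def ..
  fix x y assume "x < dim_row (half_gen (2 ^ n) (complex_of_real (1 / sqrt 2)) (YB_root n i))"
    "y < dim_col (half_gen (2 ^ n) (complex_of_real (1 / sqrt 2)) (YB_root n i))"
  then have x: "x < 2 ^ n" and y: "y < 2 ^ n" by (simp_all add: half_gen_def)
  have q: "(z mod (4 * 2 ^ k)) div 2 ^ k = z div 2 ^ k mod 4" "(z mod (4 * 2 ^ k)) mod 2 ^ k = z mod 2 ^ k"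
    for z :: nat
    using mod_mult2_eq'[of z "2 ^ k" 4] by (simp_all add: mult.commute)
  have D: "4 * 2 ^ k = (2 :: nat) ^ (k + 2)" by simp
  let ?c = "complex_of_real (1 / sqrt 2)"
  have "YB_gen n i $$ (x, y)
      = 1\<^sub>m (2 ^ h) $$ (x div (4 * 2 ^ k), y div (4 * 2 ^ k)) * ?R $$ (x mod (4 * 2 ^ k), y mod (4 * 2 ^ k))"
    unfolding Y using x y unfolding dims by (subst tensor_mat_index) simp_all
  also have "?R $$ (x mod (4 * 2 ^ k), y mod (4 * 2 ^ k))
      = R_mat $$ (x div 2 ^ k mod 4, y div 2 ^ k mod 4) * 1\<^sub>m (2 ^ k) $$ (x mod 2 ^ k, y mod 2 ^ k)"
    by (subst tensor_mat_index) (simp_all add: q)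
  also have "1\<^sub>m (2 ^ k) $$ (x mod 2 ^ k, y mod 2 ^ k) = (if x mod 2 ^ k = y mod 2 ^ k then 1 else 0 :: complex)"
    by simp
  also have "1\<^sub>m (2 ^ h) $$ (x div (4 * 2 ^ k), y div (4 * 2 ^ k))
      = (if x div 2 ^ (k + 2) = y div 2 ^ (k + 2) then 1 else 0 :: complex)"
    using x y unfolding dims D by (simp add: less_mult_imp_div_less)
  finally have lhs: "YB_gen n i $$ (x, y) = (if x div 2 ^ (k + 2) = y div 2 ^ (k + 2) \<and> x mod 2 ^ k = y mod 2 ^ k
      then ?c * (if bit x k = bit y k \<and> bit x (Suc k) = bit y (Suc k) then 1
        else if bit x k \<noteq> bit y k \<and> bit x (Suc k) \<noteq> bit y (Suc k) then (if bit y k then 1 else - 1) else 0) else 0)"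
    unfolding div_mod_4_bits R_mat_index by simp
  \<comment> \<open>The one row in which column \<open>y\<close> of \<open>YB_root\<close> has its
    nonzero entry; outside the two strands it agrees with \<open>y\<close>.\<close>
  define fy where "fy = flip_bit k (flip_bit (Suc k) y)"
  have "take_bit k fy = take_bit k y"
    by (rule bit_eqI) (auto simp: fy_def bit_take_bit_iff bit_flip_bit_nat)
  moreover have "drop_bit (k + 2) fy = drop_bit (k + 2) y"
    by (rule bit_eqI) (auto simp: fy_def bit_drop_bit_eq bit_flip_bit_nat)
  moreover have "bit fy k = (\<not> bit y k)" "bit fy (Suc k) = (\<not> bit y (Suc k))"
    by (simp_all add: fy_def bit_flip_bit_nat)
  ultimately have fy: "x = fy \<longleftrightarrow> x mod 2 ^ k = y mod 2 ^ k \<and> bit x k \<noteq> bit y k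
      \<and> bit x (Suc k) \<noteq> bit y (Suc k) \<and> x div 2 ^ (k + 2) = y div 2 ^ (k + 2)"
    unfolding nat_eq_iff_parts[of x fy k] by (auto simp: take_bit_eq_mod drop_bit_eq_div)
  have "half_gen (2 ^ n) ?c (YB_root n i) $$ (x, y)
      = ?c * (if x = fy then (if bit y k then 1 else - 1) else 0) + ?c * (if x = y then 1 else 0)"
    using x y by (simp add: half_gen_def YB_root_def mono_mat_index ik fy_def mono_mat_def)
  also have "\<dots> = YB_gen n i $$ (x, y)"
    unfolding lhs fy nat_eq_iff_parts[of x y k] by auto
  finally show "YB_gen n i $$ (x, y) = half_gen (2 ^ n) ?c (YB_root n i) $$ (x, y)" ..
next
  have "2 ^ (n - i - 1) * (4 * 2 ^ (i - 1)) = (2 :: nat) ^ (n - i - 1 + 2 + (i - 1))"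
    by (simp add: power_add)
  also have "n - i - 1 + 2 + (i - 1) = n" using i by auto
  finally show "dim_row (YB_gen n i) = dim_row (half_gen (2 ^ n) (complex_of_real (1 / sqrt 2)) (YB_root n i))"
    "dim_col (YB_gen n i) = dim_col (half_gen (2 ^ n) (complex_of_real (1 / sqrt 2)) (YB_root n i))"
    by (simp_all add: YB_gen_def tensor_pow_one half_gen_def)
qed

lemma YB_rep_braid_class:
  assumes "w \<in> gwords {1..<n}"
  shows "YB_rep n (braid_class n w)
    = letter_scale (complex_of_real (1 / sqrt 2)) w \<cdot>\<^sub>m sgn_mat (2 ^ n) (YB_root n) w"
proof -
  let ?c = "complex_of_real (1 / sqrt 2)"
  interpret nb_clifford n "2 ^ n" "YB_root n" by (rule YB_root_clifford)
  interpret B: group "braid_group n" by (rule group_braid_group)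
  interpret GL: group "GL (2 ^ n)" by (rule group_GL)
  have c: "?c \<noteq> 0" by simp
  have hom: "YB_rep n \<in> hom (braid_group n) (GL (2 ^ n))"
    unfolding YB_rep_def by (rule braid_hom(1)[OF c YB_gen_eq])
  show ?thesis
  proof (rule word_expansion[OF c _ _ _ _ assms])
    show "YB_rep n x \<in> carrier_mat (2 ^ n) (2 ^ n)" if "x \<in> carrier (braid_group n)" for x
      using hom_in_carrier[OF hom that] GL_closed by blast
    show "YB_rep n (x \<otimes>\<^bsub>braid_group n\<^esub> y) = YB_rep n x * YB_rep n y"
      if "x \<in> carrier (braid_group n)" "y \<in> carrier (braid_group n)" for x y
      using hom_mult[OF hom that] by (simp add: GL_mult)
    show "YB_rep n \<one>\<^bsub>braid_group n\<^esub> = 1\<^sub>m (2 ^ n)"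
      using hom_one[OF hom B.group_axioms GL.group_axioms] by (simp add: GL_one)
    show "YB_rep n (braid_gen n i) = half_gen (2 ^ n) ?c (YB_root n i)" if "i \<in> {1..<n}" for i
      unfolding YB_rep_def by (rule braid_hom(2)[OF c YB_gen_eq that])
  qed
qed

subsection \<open>Comparison of the traces\<close>

lemma word_functional_combination:
  assumes "word_functional n g" "word_functional n h"
  shows "word_functional n (\<lambda>w. g w + c * h w)"
proof -
  interpret g: word_functional n g by (rule assms(1))
  interpret h: word_functional n h by (rule assms(2))
  show ?thesis
  proof
    fix u w i assume *: "set u \<subseteq> {1..<n}" "set w \<subseteq> {1..<n}" "i \<in> {1..<n}"
    show "g (u @ i # i # w) + c * h (u @ i # i # w) = - (g (u @ w) + c * h (u @ w))"
      by (simp add: g.square[OF *] h.square[OF *])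
    fix j assume j: "j \<in> {1..<n}"
    show "g (u @ i # j # w) + c * h (u @ i # j # w) = nb_sign i j * (g (u @ j # i # w) + c * h (u @ j # i # w))"
      unfolding g.swap[OF * j] h.swap[OF * j] by (simp add: algebra_simps)
  qed
qed

lemma word_functional_zero: "word_functional n (\<lambda>w. 0)"
  by unfold_locales simp_all

lemma word_functional_list_trace:
  assumes "\<And>d \<phi>. (d, \<phi>) \<in> set L \<Longrightarrow> TL_rep n d \<phi>"
  shows "word_functional n (list_trace n L)"
  using assms
proof (induction L)
  case Nil
  then show ?case using word_functional_zero by (simp add: list_trace_def[abs_def])
next
  case (Cons p L)
  obtain d \<phi> where p: "p = (d, \<phi>)" by force
  interpret nb_clifford n d "TL_gens n d \<phi>" by (rule TL_gens_clifford) (use Cons.prems p in auto)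
  have "word_functional n (\<lambda>w. mat_trace (wmat d (TL_gens n d \<phi>) w) + 1 * list_trace n L w)"
    by (intro word_functional_combination word_functional_trace Cons.IH) (use Cons.prems in auto)
  moreover have "list_trace n (p # L) = (\<lambda>w. mat_trace (wmat d (TL_gens n d \<phi>) w) + 1 * list_trace n L w)"
    by (rule ext) (simp add: p list_trace_def)
  ultimately show ?case by simp
qed

text \<open>Both sides vanish on nonempty increasing words, so the factor is the quotient of the
  values at the empty word, 2^n over 2^(n div 2).\<close>

lemma trace_compare_words:
  assumes L: "TL_irrep_list n L" and n: "n \<ge> 2" and w: "set w \<subseteq> {1..<n}"
  shows "mat_trace (wmat (2 ^ n) (YB_root n) w) = 2 ^ ((n + 1) div 2) * list_trace n L w"
proof -
  interpret Y: nb_clifford n "2 ^ n" "YB_root n" by (rule YB_root_clifford)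
  have rep: "TL_rep n d \<phi>" if "(d, \<phi>) \<in> set L" for d \<phi>
    using L that unfolding TL_irrep_list_def TL_irrep_def by auto
  let ?g = "\<lambda>w. mat_trace (wmat (2 ^ n) (YB_root n) w) + (- (2 ^ ((n + 1) div 2))) * list_trace n L w"
  interpret word_functional n ?g
    by (intro word_functional_combination Y.word_functional_trace word_functional_list_trace rep)
  have half: "(2 :: complex) ^ ((n + 1) div 2) * 2 ^ (n div 2) = 2 ^ n"
    unfolding power_add[symmetric] by (rule arg_cong[of _ _ "power 2"]) presburger
  have "?g w = 0"
  proof (rule vanishes[OF _ w])
    fix u assume "sorted_wrt (<) u" "set u \<subseteq> {1..<n}"
    then show "?g u = 0"
      using half by (simp only: YB_root_trace list_trace_sorted[OF L n]) simp
  qed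
  then show ?thesis by simp
qed

text \<open>Expanding the factors of the braid word one by one reduces the claim to words in the
  M_i. The prefix is arbitrary because each factor may append a letter to it.\<close>

lemma trace_compare_sgn_mat:
  assumes L: "TL_irrep_list n L" and n: "n \<ge> 2"
    and u: "u \<in> lists {1..<n}" and w: "w \<in> gwords {1..<n}"
  shows "mat_trace (wmat (2 ^ n) (YB_root n) u * sgn_mat (2 ^ n) (YB_root n) w)
    = 2 ^ ((n + 1) div 2) * (\<Sum>(d, \<phi>)\<leftarrow>L. mat_trace (wmat d (TL_gens n d \<phi>) u * sgn_mat d (TL_gens n d \<phi>) w))"
proof -
  interpret Y: nb_clifford n "2 ^ n" "YB_root n" by (rule YB_root_clifford)
  have cl: "nb_clifford n d (TL_gens n d \<phi>)" if "(d, \<phi>) \<in> set L" for d \<phi>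
    using L that TL_gens_clifford unfolding TL_irrep_list_def TL_irrep_def by auto
  show ?thesis using w u
  proof (induction w arbitrary: u rule: list.induct)
    case Nil
    have us: "set u \<subseteq> {1..<n}" using Nil by auto
    have "wmat d (TL_gens n d \<phi>) u * 1\<^sub>m d = wmat d (TL_gens n d \<phi>) u" if "(d, \<phi>) \<in> set L" for d \<phi>
      by (rule right_mult_one_mat[OF nb_clifford.wmat_closed[OF cl[OF that] us]])
    then have "(\<Sum>(d, \<phi>)\<leftarrow>L. mat_trace (wmat d (TL_gens n d \<phi>) u * sgn_mat d (TL_gens n d \<phi>) []))
        = list_trace n L u"
      unfolding list_trace_def sgn_mat.simps by (intro arg_cong[of _ _ sum_list] map_cong) auto
    then show ?case
      using trace_compare_words[OF L n us] right_mult_one_mat[OF Y.wmat_closed[OF us]] by simp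
  next
    case (Cons a w)
    obtain x b where a: "a = (x, b)" by force
    have x: "x \<in> {1..<n}" and w: "w \<in> gwords {1..<n}" using Cons.prems a by auto
    have ux: "u @ [x] \<in> lists {1..<n}" using Cons.prems x by auto
    let ?s = "if b then 1 else - 1 :: complex"
    let ?F = "\<lambda>u w (d, \<phi>). mat_trace (wmat d (TL_gens n d \<phi>) u * sgn_mat d (TL_gens n d \<phi>) w)"
    have "(\<Sum>p\<leftarrow>L. ?F u (a # w) p) = (\<Sum>p\<leftarrow>L. ?s * ?F (u @ [x]) w p + ?F u w p)"
    proof (intro arg_cong[of _ _ sum_list] map_cong HOL.refl)
      fix p assume "p \<in> set L"
      then show "?F u (a # w) p = ?s * ?F (u @ [x]) w p + ?F u w p"
        using nb_clifford.trace_sgn_mat_step[OF cl Cons.prems(2) x w, of "fst p" "snd p" b]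
        by (simp add: case_prod_beta a)
    qed
    also have "\<dots> = ?s * (\<Sum>p\<leftarrow>L. ?F (u @ [x]) w p) + (\<Sum>p\<leftarrow>L. ?F u w p)"
      by (simp add: sum_list_addf sum_list_const_mult)
    finally have F: "(\<Sum>p\<leftarrow>L. ?F u (a # w) p) = ?s * (\<Sum>p\<leftarrow>L. ?F (u @ [x]) w p) + (\<Sum>p\<leftarrow>L. ?F u w p)" .
    show ?case
      unfolding F unfolding a Y.trace_sgn_mat_step[OF Cons.prems(2) x w]
        Cons.IH[OF w ux] Cons.IH[OF w Cons.prems(2)]
      by (simp add: algebra_simps)
  qed
qed

text \<open>Each generator contributes the quotient of c by 1 / sqrt 2, which is \<open>z\<close>,
  and each inverse generator contributes the inverse of \<open>z\<close>; the total is
  \<open>z\<close> to the exponent sum.\<close>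

lemma letter_scale_compare:
  "letter_scale tl_scale w = (- 1) powi word_exponent_sum w
    * exp (- (complex_of_real pi * \<i> * of_int (word_exponent_sum w) / 4))
    * letter_scale (complex_of_real (1 / sqrt 2)) w"
proof -
  define z where "z = - exp (- (complex_of_real pi * \<i> / 4))"
  have z: "z \<noteq> 0" by (simp add: z_def)
  \<comment> \<open>With this value z / sqrt 2 = - (1 - \<i>) / 2, which is
    \<open>tl_scale\<close>.\<close>
  have e4: "exp (- (complex_of_real pi * \<i> / 4)) = complex_of_real (1 / sqrt 2) * (1 - \<i>)"
  proof -
    have "exp (- (complex_of_real pi * \<i> / 4)) = cis (- (pi / 4))"
      by (simp add: cis_conv_exp mult.commute)
    also have "\<dots> = complex_of_real (1 / sqrt 2) * (1 - \<i>)"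
      by (simp add: complex_eq_iff cos_45 sin_45 real_div_sqrt field_simps)
    finally show ?thesis .
  qed
  have s2: "complex_of_real (sqrt 2) * complex_of_real (sqrt 2) = 2"
    by (simp flip: of_real_mult)
  have t: "tl_scale = z * complex_of_real (1 / sqrt 2)"
    unfolding z_def e4 tl_scale_def using s2 by (simp add: field_simps)
  have t': "1 / (2 * tl_scale) = inverse z * (1 / (2 * complex_of_real (1 / sqrt 2)))"
    unfolding t using z by (simp add: field_simps)
  have "letter_scale tl_scale w = z powi word_exponent_sum w * letter_scale (complex_of_real (1 / sqrt 2)) w"
  proof (induction w)
    case Nil
    then show ?case by (simp add: letter_scale_def word_exponent_sum_def)
  next
    case (Cons a w)
    obtain x b where a: "a = (x, b)" by force
    have s: "letter_scale c (a # w) = (if b then c else 1 / (2 * c)) * letter_scale c w" for c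
      by (simp add: a letter_scale_def)
    have e: "word_exponent_sum (a # w) = (if b then 1 else - 1) + word_exponent_sum w"
      by (simp add: a word_exponent_sum_def)
    show ?case
      unfolding s e Cons t' power_int_add[OF disjI1[OF z]]
      by (cases b) (simp_all add: t power_int_minus)
  qed
  also have "z powi e = (- 1) powi e * exp (- (complex_of_real pi * \<i> * of_int e / 4))" for e
  proof -
    have "z powi e = ((- 1) * exp (- (complex_of_real pi * \<i> / 4))) powi e" by (simp add: z_def)
    also have "\<dots> = (- 1) powi e * exp (- (complex_of_real pi * \<i> / 4)) powi e"
      by (rule power_int_mult_distrib)
    also have "exp (- (complex_of_real pi * \<i> / 4)) powi e = exp (of_int e * - (complex_of_real pi * \<i> / 4))"
      by (rule exp_power_int)
    finally show ?thesis by (simp add: mult.commute mult.assoc)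
  qed
  finally show ?thesis .
qed

text \<open>Of the chosen representation one learns only that some complete list underlies it; this
  is enough, since the comparison of traces holds for every complete list.\<close>

lemma mat_trace_jones_rep:
  assumes n: "n \<ge> 2" and w: "w \<in> gwords {1..<n}"
  obtains L where "TL_irrep_list n L"
    "mat_trace (jones_rep n (braid_class n w))
      = letter_scale tl_scale w * (\<Sum>(d, \<phi>)\<leftarrow>L. mat_trace (sgn_mat d (TL_gens n d \<phi>) w))"
proof -
  have "\<exists>\<rho>. is_jones_rep n \<rho>" using ex_TL_irrep_list[OF n] unfolding is_jones_rep_def by blast
  then have "is_jones_rep n (jones_rep n)" unfolding jones_rep_def by (rule someI_ex)
  then obtain L where L: "TL_irrep_list n L"
    and \<rho>: "jones_rep n = (\<lambda>\<sigma>. diag_block_mat (map (\<lambda>(d, \<phi>). \<phi> (TL_proj n (ga_of \<sigma>))) L))"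
    unfolding is_jones_rep_def by blast
  have rep: "TL_rep n d \<phi>" if "(d, \<phi>) \<in> set L" for d \<phi>
    using L that unfolding TL_irrep_list_def TL_irrep_def by auto
  have car: "sgn_mat d (TL_gens n d \<phi>) w \<in> carrier_mat d d" if "(d, \<phi>) \<in> set L" for d \<phi>
    by (rule nb_clifford.sgn_mat_closed[OF TL_gens_clifford[OF rep[OF that]] w])
  let ?A = "\<lambda>(d, \<phi>). letter_scale tl_scale w \<cdot>\<^sub>m sgn_mat d (TL_gens n d \<phi>) w"
  have "jones_rep n (braid_class n w) = diag_block_mat (map ?A L)"
    unfolding \<rho> by (intro arg_cong[of _ _ diag_block_mat] map_cong) (auto simp: TL_rep_braid_class[OF rep w])
  also have "mat_trace \<dots> = (\<Sum>A\<leftarrow>map ?A L. mat_trace A)"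
    by (rule mat_trace_diag_block_mat) (use car[THEN carrier_matD(1)] car[THEN carrier_matD(2)] in auto)
  also have "\<dots> = (\<Sum>(d, \<phi>)\<leftarrow>L. letter_scale tl_scale w * mat_trace (sgn_mat d (TL_gens n d \<phi>) w))"
    unfolding map_map o_def
    by (intro arg_cong[of _ _ sum_list] map_cong) (auto simp: mat_trace_smult[OF car])
  also have "\<dots> = letter_scale tl_scale w * (\<Sum>(d, \<phi>)\<leftarrow>L. mat_trace (sgn_mat d (TL_gens n d \<phi>) w))"
    unfolding case_prod_beta by (rule sum_list_const_mult)
  finally show thesis using that L by blast
qed

lemma trace_identity:
  assumes n: "n \<ge> 2" and w: "w \<in> gwords {1..<n}"
  shows "mat_trace (jones_rep n (braid_class n w)) * 2 ^ ((n + 1) div 2)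
    = (- 1) powi word_exponent_sum w * exp (- (complex_of_real pi * \<i> * of_int (word_exponent_sum w) / 4))
      * mat_trace (YB_rep n (braid_class n w))"
proof -
  interpret Y: nb_clifford n "2 ^ n" "YB_root n" by (rule YB_root_clifford)
  obtain L where L: "TL_irrep_list n L"
    and J: "mat_trace (jones_rep n (braid_class n w))
      = letter_scale tl_scale w * (\<Sum>(d, \<phi>)\<leftarrow>L. mat_trace (sgn_mat d (TL_gens n d \<phi>) w))"
    by (rule mat_trace_jones_rep[OF n w])
  have cl: "nb_clifford n d (TL_gens n d \<phi>)" if "(d, \<phi>) \<in> set L" for d \<phi>
    using L that TL_gens_clifford unfolding TL_irrep_list_def TL_irrep_def by auto
  have "(\<Sum>(d, \<phi>)\<leftarrow>L. mat_trace (1\<^sub>m d * sgn_mat d (TL_gens n d \<phi>) w))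
      = (\<Sum>(d, \<phi>)\<leftarrow>L. mat_trace (sgn_mat d (TL_gens n d \<phi>) w))"
    using left_mult_one_mat[OF nb_clifford.sgn_mat_closed[OF cl w]]
    by (intro arg_cong[of _ _ sum_list] map_cong) auto
  then have "mat_trace (sgn_mat (2 ^ n) (YB_root n) w)
      = 2 ^ ((n + 1) div 2) * (\<Sum>(d, \<phi>)\<leftarrow>L. mat_trace (sgn_mat d (TL_gens n d \<phi>) w))"
    using trace_compare_sgn_mat[OF L n _ w, of "[]"] left_mult_one_mat[OF Y.sgn_mat_closed[OF w]] by simp
  then show ?thesis
    unfolding J YB_rep_braid_class[OF w] mat_trace_smult[OF Y.sgn_mat_closed[OF w]] letter_scale_compare
    by simp
qed

theorem mainTheorem5:
  fixes n :: nat and \<sigma> :: "nat gword set" and \<alpha> :: complex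
  assumes "n \<ge> 2"
    and "\<sigma> \<in> carrier (braid_group n)"
    and "\<alpha> \<in> {1, - 1}"
  shows "T_R n \<sigma> \<alpha> =
    (- 1) powi (int n - 1 + exponent_sum \<sigma>) * \<alpha> powi (int n - exponent_sum \<sigma>)
      * complex_of_real (sqrt 2) * J4 n \<sigma>"
proof -
  obtain w where w: "w \<in> gwords {1..<n}" "\<sigma> = braid_class n w" using assms(2) by (rule braid_carrierE)
  define e where "e = exponent_sum \<sigma>"
  have e: "word_exponent_sum w = e" unfolding e_def w(2) by (rule exponent_sum_class[OF w(1), symmetric])
  define s where "s = complex_of_real (sqrt 2)"
  have s2: "s * s = 2" unfolding s_def by (simp flip: of_real_mult)
  have s0: "s \<noteq> 0" by (simp add: s_def)
  define E where "E = exp (complex_of_real pi * \<i> * of_int e / 4)"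
  define Y where "Y = mat_trace (YB_rep n \<sigma>)"
  define J where "J = mat_trace (jones_rep n \<sigma>)"
  have E: "E * exp (- (complex_of_real pi * \<i> * of_int e / 4)) = 1"
    unfolding E_def by (simp flip: exp_add)
  have m1: "((- 1 :: complex) powi e) * (- 1) powi e = 1"
    by (simp flip: power_int_mult_distrib)
  have main: "J * 2 ^ ((n + 1) div 2) = (- 1) powi e * exp (- (complex_of_real pi * \<i> * of_int e / 4)) * Y"
    using trace_identity[OF assms(1) w(1)] unfolding w(2)[symmetric] e J_def Y_def .
  have Y: "Y = (- 1) powi e * E * J * 2 ^ ((n + 1) div 2)"
  proof -
    have "(- 1) powi e * E * (J * 2 ^ ((n + 1) div 2))
        = ((- 1) powi e * (- 1) powi e) * (E * exp (- (complex_of_real pi * \<i> * of_int e / 4))) * Y"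
      unfolding main by (simp only: mult_ac)
    then show ?thesis unfolding E m1 by (simp add: mult.assoc)
  qed
  \<comment> \<open>For even n the real power is 1 / sqrt 2 and cancels the extra \<open>s\<close>;
    for odd n it is 1 and \<open>s\<close> completes the exponent to the even number n + 1.\<close>
  have pw: "2 ^ ((n + 1) div 2) = s ^ n * s * complex_of_real (sqrt 2 powr (- ((1 + (- 1) ^ n) / 2)))"
  proof (cases "even n")
    case True
    then obtain m where "n = 2 * m" by (elim evenE)
    then show ?thesis
      using s2 s0 by (simp add: powr_minus power_mult power2_eq_square s_def[symmetric] flip: s_def)
  next
    case False
    then obtain m where m: "n = 2 * m + 1" by (elim oddE)
    have "s ^ n * s = (s * s) ^ (m + 1)"
      by (simp add: m power_add power_mult_distrib power_mult power2_eq_square mult_ac)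
    then show ?thesis unfolding s2 using m by (simp add: power_add)
  qed
  have sn: "s powi (- int n) * s ^ n = 1"
    using s0 by (simp add: power_int_minus)
  have sg: "(- 1 :: complex) powi (int n - 1 + e) = (- 1) ^ (n - 1) * (- 1) powi e"
    using assms(1) by (simp add: power_int_add flip: power_int_of_nat)
  have sq: "(- 1 :: complex) ^ (n - 1) * (- 1) ^ (n - 1) = 1"
    by (simp flip: power_mult_distrib)
  let ?p = "complex_of_real (sqrt 2 powr (- ((1 + (- 1) ^ n) / 2)))"
  have "T_R n \<sigma> \<alpha> = \<alpha> powi (int n - e) * s powi (- int n) * Y"
    unfolding T_R_def e_def s_def Y_def ..
  also have "\<dots> = (s powi (- int n) * s ^ n) * (\<alpha> powi (int n - e) * (- 1) powi e * E * J * s * ?p)"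
    unfolding Y pw by (simp only: mult_ac)
  \<comment> \<open>A square equal to 1 is inserted: one factor goes into the sign of the statement,
    the other into the sign in \<open>J4\<close>.\<close>
  also have "\<dots> = ((- 1) ^ (n - 1) * (- 1) ^ (n - 1)) * (\<alpha> powi (int n - e) * (- 1) powi e * E * J * s * ?p)"
    unfolding sn sq ..
  also have "\<dots> = (- 1) powi (int n - 1 + e) * \<alpha> powi (int n - e) * s
      * ((- 1) ^ (n - 1) * E * ?p * J)"
    unfolding sg by (simp only: mult_ac)
  finally show ?thesis unfolding J4_def e_def E_def J_def s_def .
qed

end
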